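(* For every fixed $0<d\le 1/2$ and $\varepsilon>0$, if $p=n^{-(2/5+\varepsilon)}$, then there is a sequence $(G_n)$ with $G_n\in\mathscr{G}_{d,n}$ such that asymptotically almost surely $G_n\cup\mathbb{G}(n,p)$ does not satisfy $\xrightarrow{\mathrm{rbw}}K_8$, i.e. it admits a proper edge-colouring with no rainbow copy of $K_8$.
   Context: For graphs $G,H$, write $G \xrightarrow{\mathrm{rbw}} H$ if every proper edge-colouring of $G$ contains a rainbow copy of $H$ (a subgraph all of whose edges receive distinct colours). $\mathbb{G}(n,p)$ is the binomial random graph. $\mathscr{G}_{d,n}$ denotes the family of $n$-vertex graphs with edge density at least $d$. $G\cup\mathbb{G}(n,p)$ denotes the union of a fixed $n$-vertex graph $G$ with an independent random graph $\mathbb{G}(n,p)$ on the same vertex set. "Asymptotically almost surely" means with probability tending to $1$ as $n\to\infty$. *)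

theory Defs
  imports Complex_Main
begin

definition all_edges :: "nat \<Rightarrow> nat set set" where
  "all_edges n = {e. \<exists>u v. u < n \<and> v < n \<and> u \<noteq> v \<and> e = {u, v}}"

definition dense_graphs :: "real \<Rightarrow> nat \<Rightarrow> nat set set set" where
  "dense_graphs d n = {E. E \<subseteq> all_edges n \<and> real (card E) \<ge> d * real (n choose 2)}"

definition proper_edge_colouring :: "nat set set \<Rightarrow> (nat set \<Rightarrow> nat) \<Rightarrow> bool" where
  "proper_edge_colouring E c \<longleftrightarrow>
     (\<forall>e\<in>E. \<forall>e'\<in>E. e \<noteq> e' \<and> e \<inter> e' \<noteq> {} \<longrightarrow> c e \<noteq> c e')"

definition has_rainbow_clique :: "nat set set \<Rightarrow> (nat set \<Rightarrow> nat) \<Rightarrow> nat \<Rightarrow> bool" where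
  "has_rainbow_clique E c k \<longleftrightarrow>
     (\<exists>f :: nat \<Rightarrow> nat. inj_on f {..<k} \<and>
        (\<forall>i<k. \<forall>j<k. i \<noteq> j \<longrightarrow> {f i, f j} \<in> E) \<and>
        inj_on c {{f i, f j} | i j. i < k \<and> j < k \<and> i \<noteq> j})"

text \<open>G -rbw-> K_k: every proper edge-colouring of G has a rainbow K_k.
  Colours are natural numbers (no loss since graphs are finite).\<close>
definition rbw_arrows_clique :: "nat set set \<Rightarrow> nat \<Rightarrow> bool" where
  "rbw_arrows_clique E k \<longleftrightarrow>
     (\<forall>c. proper_edge_colouring E c \<longrightarrow> has_rainbow_clique E c k)"

definition gnp_prob :: "nat \<Rightarrow> real \<Rightarrow> (nat set set \<Rightarrow> bool) \<Rightarrow> real" where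
  "gnp_prob n p P =
     (\<Sum>R\<in>Pow (all_edges n). if P R then p ^ card R * (1 - p) ^ (card (all_edges n) - card R) else 0)"

end

theory Submission
  imports Defs
begin

text \<open>Take for \<open>G\<close> the balanced complete bipartite graph. A first moment bound shows that almost surely
  every bounded vertex set of the random graph spanning \<open>e\<close> edges has more than \<open>2 e / 5\<close> vertices.
  Hence the random edges inside the two parts split into edge-disjoint components of bounded size,
  each obtained from an edge by gluing 4-cliques along edges, and the surplus \<open>5 |U| - 2 e(U)\<close> never
  leaves the interval from 1 to 8 during the gluing. This budget lets one colour each component
  properly so that every 4-clique either repeats a colour or contains an edge of a matching \<open>M\<close>.
  All matchings \<open>M\<close> receive the same colour. To keep the colouring proper, components of surplus at
  most 5, the only ones with \<open>M\<close> nonempty, are given roots that \<open>M\<close> avoids, such that two of them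
  only meet in a root of one of them. An 8-clique has at least five vertices in one part or four in
  each; either way two of its edges get the same colour.\<close>

section \<open>Cliques and surplus\<close>

text \<open>The exponent 2/5 is the inverse of (6 - 1) / (4 - 2), the 2-density of a 4-clique. With
  the weights 5 and 2 an edge and a 4-clique both have surplus 8, and gluing a 4-clique along an
  edge costs nothing; it is the extra \<epsilon> that bounds the size of a component. A vertex
  joined to a triangle costs at least one unit, so only seven units are available for such steps. A
  vertex joined to a triangle can repeat the colour of an edge of that triangle only if the opposite
  vertex does not see this colour yet. Where this fails an edge of M is needed, and such edges are
  awkward because they have one colour in all components. Sparsity keeps the surplus of the union of
  two components at 1 or more, while each shared vertex takes away 5. So two components of surplus
  at most 5 share at most one vertex, and then one of them has surplus at least 3. This one takes
  the vertex as its root: ending at 3 or more, it has fewer steps to pay for, needs fewer edges of M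
  and has room to keep them off the root.\<close>

definition clique :: "'a set set \<Rightarrow> 'a set \<Rightarrow> bool" where
  "clique E Q \<longleftrightarrow> (\<forall>u\<in>Q. \<forall>v\<in>Q. u \<noteq> v \<longrightarrow> {u, v} \<in> E)"

definition inner :: "'a set set \<Rightarrow> 'a set \<Rightarrow> 'a set set" where
  "inner E S = {e \<in> E. e \<subseteq> S}"

definition nbrs :: "'a set set \<Rightarrow> 'a set \<Rightarrow> 'a \<Rightarrow> 'a set" where
  "nbrs E S z = {y \<in> S. {z, y} \<in> E}"

definition surplus :: "'a set set \<Rightarrow> 'a set \<Rightarrow> int" where
  "surplus E S = 5 * int (card S) - 2 * int (card (inner E S))"

definition triangle :: "'a set set \<Rightarrow> 'a set \<Rightarrow> 'a set \<Rightarrow> bool" where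
  "triangle E S T \<longleftrightarrow> T \<subseteq> S \<and> card T = 3 \<and> clique E T"

lemma finite_of_card: "card A = numeral k \<Longrightarrow> finite A"
  by (metis card.infinite zero_neq_numeral)

lemma clique_subset: "clique E Q \<Longrightarrow> Q' \<subseteq> Q \<Longrightarrow> clique E Q'"
  unfolding clique_def by blast

lemma cliqueD: "clique E Q \<Longrightarrow> u \<in> Q \<Longrightarrow> v \<in> Q \<Longrightarrow> u \<noteq> v \<Longrightarrow> {u, v} \<in> E"
  unfolding clique_def by blast

lemma clique_insert:
  assumes "clique E Q" "\<And>y. y \<in> Q \<Longrightarrow> {z, y} \<in> E"
  shows "clique E (insert z Q)"
  unfolding clique_def
proof (intro ballI impI)
  fix u v assume "u \<in> insert z Q" "v \<in> insert z Q" "u \<noteq> v"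
  then show "{u, v} \<in> E"
    using assms by (auto simp: clique_def insert_commute)
qed

lemma card_eq_4D:
  assumes "card A = 4"
  obtains a b c d where "A = {a, b, c, d}" "a \<noteq> b" "a \<noteq> c" "a \<noteq> d" "b \<noteq> c" "b \<noteq> d" "c \<noteq> d"
proof -
  obtain xs where xs: "set xs = A" "distinct xs"
    using finite_distinct_list finite_of_card[OF assms] by blast
  then have "length xs = 4" using assms distinct_card by fastforce
  then obtain a b c d where "xs = [a, b, c, d]" by (auto simp: length_Suc_conv eval_nat_numeral)
  then show ?thesis using that xs by auto
qed

lemma card_eq_2D:
  assumes "card e = 2" "x \<in> e"
  obtains y where "e = {x, y}" "x \<noteq> y"
  using assms by (metis card_2_iff doubleton_eq_iff insertE singletonD)

lemma triangle_edge:
  assumes "triangle E S T" "x \<in> T"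
  shows "T - {x} \<in> inner E S" "card (T - {x}) = 2"
proof -
  have fT: "finite T" using assms finite_of_card unfolding triangle_def by blast
  show c2: "card (T - {x}) = 2" using assms fT unfolding triangle_def by simp
  then obtain a b where ab: "T - {x} = {a, b}" "a \<noteq> b" by (meson card_2_iff)
  then have "a \<in> T" "b \<in> T" by blast+
  then show "T - {x} \<in> inner E S"
    using ab assms unfolding triangle_def inner_def by (auto intro: cliqueD)
qed

section \<open>Surplus and its change when vertices are added\<close>

locale simple_graph =
  fixes E :: "'a set set"
  assumes finE: "finite E" and two: "e \<in> E \<Longrightarrow> card e = 2"
begin

abbreviation "V \<equiv> \<Union>E"

abbreviation has_five_clique :: bool where
  "has_five_clique \<equiv> \<exists>K. clique E K \<and> card K = 5"

text \<open>The 3 is the guarantee that comes with a root in \<open>rooted\<close>. Starting from 8,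
  a rooted component spends at most five units, so that few edges of \<open>M\<close> compete with
  the root for vertices.\<close>

abbreviation admissible_roots :: "'a set \<Rightarrow> bool" where
  "admissible_roots X \<equiv> X = {} \<or> (\<exists>r. X = {r} \<and> 3 \<le> surplus E V)"

lemma finV: "finite V"
  using finE two by (metis card.infinite finite_Union zero_neq_numeral)

lemma finS: "S \<subseteq> V \<Longrightarrow> finite S"
  using finV finite_subset by blast

lemma fin_inner: "finite (inner E S)"
  unfolding inner_def using finE by simp

lemma no_loop: "{x, y} \<in> E \<Longrightarrow> x \<noteq> y"
  using two by fastforce

lemma inner_insert:
  assumes "z \<notin> S"
  shows "inner E (insert z S) = inner E S \<union> (\<lambda>y. {z, y}) ` nbrs E S z"
proof (intro equalityI subsetI)
  fix e assume e: "e \<in> inner E (insert z S)"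
  show "e \<in> inner E S \<union> (\<lambda>y. {z, y}) ` nbrs E S z"
  proof (cases "z \<in> e")
    case True
    then obtain y where y: "e = {z, y}" "z \<noteq> y"
      using e two unfolding inner_def by (metis (no_types, lifting) card_eq_2D mem_Collect_eq)
    then have "y \<in> nbrs E S z" using e unfolding inner_def nbrs_def by auto
    then show ?thesis using y by blast
  next
    case False
    then show ?thesis using e unfolding inner_def by auto
  qed
next
  fix e assume "e \<in> inner E S \<union> (\<lambda>y. {z, y}) ` nbrs E S z"
  then show "e \<in> inner E (insert z S)"
    unfolding inner_def nbrs_def by auto
qed

lemma card_star: "card ((\<lambda>y. {z, y}) ` N) = card N"
  by (rule card_image) (auto simp: inj_on_def doubleton_eq_iff)

lemma card_inner_insert:
  assumes "z \<notin> S" "finite S"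
  shows "card (inner E (insert z S)) = card (inner E S) + card (nbrs E S z)"
proof -
  have "inner E S \<inter> (\<lambda>y. {z, y}) ` nbrs E S z = {}"
    using assms(1) unfolding inner_def by auto
  moreover have "finite (nbrs E S z)" using assms(2) unfolding nbrs_def by simp
  ultimately show ?thesis
    unfolding inner_insert[OF assms(1)] by (subst card_Un_disjoint) (auto simp: fin_inner card_star)
qed

lemma surplus_insert:
  assumes "z \<notin> S" "finite S"
  shows "surplus E (insert z S) = surplus E S + 5 - 2 * int (card (nbrs E S z))"
  using assms card_inner_insert[OF assms] unfolding surplus_def by simp

lemma nbrs_insert:
  "{y, x} \<in> E \<Longrightarrow> nbrs E (insert x S) y = insert x (nbrs E S y)"
  unfolding nbrs_def by auto

text \<open>Two vertices bring 10 and the edge between them takes 2 away, hence the 8.\<close>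

lemma surplus_insert2:
  assumes "x \<notin> S" "y \<notin> S" "{x, y} \<in> E" "finite S"
  shows "surplus E (insert y (insert x S)) =
    surplus E S + 8 - 2 * int (card (nbrs E S x)) - 2 * int (card (nbrs E S y))"
proof -
  have "x \<noteq> y" using assms no_loop by blast
  moreover have "nbrs E (insert x S) y = insert x (nbrs E S y)"
    using assms(3) by (intro nbrs_insert) (simp add: insert_commute)
  moreover have "card (insert x (nbrs E S y)) = Suc (card (nbrs E S y))"
    using assms unfolding nbrs_def by simp
  ultimately show ?thesis
    using assms by (simp add: surplus_insert)
qed

end

lemma (in simple_graph) clique_subset_V:
  assumes "clique E Q" "2 \<le> card Q"
  shows "Q \<subseteq> V"
proof
  fix a assume a: "a \<in> Q"
  have "Q \<noteq> {a}" using assms(2) by auto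
  then obtain b where "b \<in> Q" "b \<noteq> a" using a by blast
  then show "a \<in> V" using cliqueD[OF assms(1) a] by blast
qed

text \<open>The assumption is all that is used of \<open>E\<close> being an equivalence class of edges under the
  relation generated by lying in a common 4-clique; single edges are admitted.\<close>

locale k4_component = simple_graph +
  assumes conn: "S \<subset> \<Union>E \<Longrightarrow> e \<in> E \<Longrightarrow> e \<subseteq> S \<Longrightarrow>
    \<exists>Q. clique E Q \<and> card Q = 4 \<and> 2 \<le> card (Q \<inter> S) \<and> \<not> Q \<subseteq> S"
begin

definition candidate :: "'a set \<Rightarrow> 'a \<Rightarrow> 'a set \<Rightarrow> bool" where
  "candidate S z T \<longleftrightarrow> z \<in> V - S \<and> triangle E S T \<and> T \<subseteq> nbrs E S z"

text \<open>The 4-clique given by \<open>conn\<close> has three or two vertices in \<open>S\<close>.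
  Joining a single vertex has priority, so that in the second case no outside vertex sees a triangle
  of \<open>S\<close>; \<open>new_clique_two\<close> relies on this.\<close>

lemma grow_cases:
  assumes "S \<subset> V" "e \<in> E" "e \<subseteq> S"
  obtains (one) z T where "candidate S z T"
  | (two) u v x y where "x \<in> V - S" "y \<in> V - S" "x \<noteq> y" "u \<in> S" "v \<in> S" "u \<noteq> v"
      "clique E {u, v, x, y}" "\<not> (\<exists>z T. candidate S z T)"
proof (cases "\<exists>z T. candidate S z T")
  case True then show ?thesis using one by blast
next
  case False
  obtain Q where Q: "clique E Q" "card Q = 4" "2 \<le> card (Q \<inter> S)" "\<not> Q \<subseteq> S"
    using conn[OF assms] by blast
  have finQ: "finite Q" by (rule finite_of_card[OF Q(2)])
  have QV: "Q \<subseteq> V" using clique_subset_V[OF Q(1)] Q(2) by simp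
  have sum: "card (Q \<inter> S) + card (Q - S) = 4"
    using Q(2) finQ by (metis card_Diff_subset_Int card_Int_Diff)
  have "card (Q - S) \<noteq> 0" using Q(4) finQ by auto
  have "card (Q - S) \<noteq> 1"
  proof
    assume c1: "card (Q - S) = 1"
    then obtain z where z: "Q - S = {z}" using card_1_singletonE by blast
    have "triangle E S (Q \<inter> S)"
      using c1 sum clique_subset[OF Q(1)] unfolding triangle_def by auto
    moreover have "Q \<inter> S \<subseteq> nbrs E S z"
      using z cliqueD[OF Q(1)] unfolding nbrs_def by blast
    ultimately show False using False z QV unfolding candidate_def by blast
  qed
  then have c2: "card (Q - S) = 2" "card (Q \<inter> S) = 2"
    using \<open>card (Q - S) \<noteq> 0\<close> sum Q(3) by linarith+
  then obtain x y u v where "Q - S = {x, y}" "x \<noteq> y" "Q \<inter> S = {u, v}" "u \<noteq> v"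
    by (meson card_2_iff)
  moreover from this have "Q = {u, v, x, y}" by blast
  ultimately show ?thesis using two[of x y u v] False Q(1) QV by blast
qed

lemma grow_induct:
  assumes "P S" "S \<subseteq> V" "e \<in> E" "e \<subseteq> S"
    and one: "\<And>S z T. P S \<Longrightarrow> S \<subseteq> V \<Longrightarrow> candidate S z T \<Longrightarrow> P (insert z S)"
    and two: "\<And>S u v x y. P S \<Longrightarrow> S \<subseteq> V \<Longrightarrow> x \<in> V - S \<Longrightarrow> y \<in> V - S \<Longrightarrow> x \<noteq> y \<Longrightarrow> u \<in> S \<Longrightarrow> v \<in> S \<Longrightarrow> u \<noteq> v \<Longrightarrow>
      clique E {u, v, x, y} \<Longrightarrow> \<not> (\<exists>z T. candidate S z T) \<Longrightarrow> P (insert y (insert x S))"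
  shows "P V"
  using assms(1,2,4)
proof (induction "card (V - S)" arbitrary: S rule: less_induct)
  case less
  show ?case
  proof (cases "S = V")
    case True then show ?thesis using less by simp
  next
    case False
    then have S: "S \<subset> V" using less by blast
    show ?thesis
      using S assms(3) less.prems(3)
    proof (cases rule: grow_cases)
      case (one z T)
      have z: "z \<in> V - S" using one unfolding candidate_def by blast
      have "P (insert z S)" by (rule assms(5)[OF less.prems(1,2) one])
      moreover have "card (V - insert z S) < card (V - S)"
        using z finV by (intro psubset_card_mono) auto
      ultimately show ?thesis using less.hyps[of "insert z S"] less.prems z by blast
    next
      case (two u v x y)
      have "P (insert y (insert x S))" using assms(6) two less.prems by blast
      moreover have "card (V - insert y (insert x S)) < card (V - S)"
        using two finV by (intro psubset_card_mono) auto
      ultimately show ?thesis using less.hyps[of "insert y (insert x S)"] less.prems two by blast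
    qed
  qed
qed

lemma nbrs_ge3:
  assumes "S \<subseteq> V" "candidate S z T"
  shows "3 \<le> card (nbrs E S z)"
proof -
  have "finite (nbrs E S z)" using finS[OF assms(1)] unfolding nbrs_def by simp
  then show ?thesis using assms(2) card_mono unfolding candidate_def triangle_def by metis
qed

lemma nbrs_ge2:
  assumes "S \<subseteq> V" "u \<in> S" "v \<in> S" "u \<noteq> v" "clique E {u, v, x, y}" "x \<notin> S"
  shows "2 \<le> card (nbrs E S x)"
proof -
  have "{u, v} \<subseteq> nbrs E S x" using assms unfolding nbrs_def
    by (auto intro!: cliqueD[OF assms(5)])
  moreover have "finite (nbrs E S x)" using finS[OF assms(1)] unfolding nbrs_def by simp
  ultimately show ?thesis using card_mono assms(4) by (metis card_2_iff)
qed

lemma surplus_one_step: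
  assumes "S \<subseteq> V" "candidate S z T"
  shows "surplus E (insert z S) \<le> surplus E S"
  using surplus_insert[of z S] nbrs_ge3[OF assms] finS[OF assms(1)] assms(2)
  unfolding candidate_def by auto

text \<open>Two vertices bring 10, and at least five edges, one between them and two from each of
  them to \<open>S\<close>, take at least 10 away. Equality means a 4-clique glued along an edge
  with no further edges.\<close>

lemma surplus_two_step:
  assumes "S \<subseteq> V" "x \<in> V - S" "y \<in> V - S" "x \<noteq> y" "u \<in> S" "v \<in> S" "u \<noteq> v" "clique E {u, v, x, y}"
  shows "surplus E (insert y (insert x S)) \<le> surplus E S"
proof -
  have "2 \<le> card (nbrs E S x)" using nbrs_ge2 assms by blast
  moreover have "2 \<le> card (nbrs E S y)"
    using nbrs_ge2[of S u v y x] assms by (simp add: insert_commute)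
  moreover have "{x, y} \<in> E" using cliqueD[OF assms(8)] assms(4) by blast
  ultimately show ?thesis
    using surplus_insert2[of x S y] assms(2,3) finS[OF assms(1)] by auto
qed

text \<open>Carries the lower bound on the surplus of \<open>V\<close> back to every stage of the
  growth, where it limits the number of neighbours of a new vertex.\<close>

lemma surplus_mono:
  assumes "S \<subseteq> V" "e \<in> E" "e \<subseteq> S"
  shows "surplus E V \<le> surplus E S"
proof (rule grow_induct[where P = "\<lambda>S'. surplus E S' \<le> surplus E S", OF _ assms])
  fix S' z T assume *: "surplus E S' \<le> surplus E S" "S' \<subseteq> V" "candidate S' z T"
  then show "surplus E (insert z S') \<le> surplus E S"
    using surplus_one_step[OF *(2,3)] by linarith
next
  fix S' u v x y
  assume *: "surplus E S' \<le> surplus E S" "S' \<subseteq> V" "x \<in> V - S'" "y \<in> V - S'" "x \<noteq> y"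
    "u \<in> S'" "v \<in> S'" "u \<noteq> v" "clique E {u, v, x, y}"
  then show "surplus E (insert y (insert x S')) \<le> surplus E S"
    using surplus_two_step[OF *(2-9)] by linarith
qed simp

end

section \<open>Colouring a component vertex by vertex\<close>

lemma fresh_colours:
  fixes c :: "'b \<Rightarrow> nat"
  assumes "finite A" "finite D" "A \<inter> D = {}"
  obtains c' where "\<And>e. e \<in> A \<Longrightarrow> c' e = c e" "inj_on c' D" "\<And>e h. e \<in> D \<Longrightarrow> h \<in> A \<Longrightarrow> c' e \<noteq> c h"
proof -
  obtain f :: "'b \<Rightarrow> nat" where f: "inj_on f D"
    using finite_imp_inj_to_nat_seg[OF assms(2)] by blast
  define m where "m = Suc (Max (insert 0 (c ` A)))"
  have m: "c h < m" if "h \<in> A" for h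
    unfolding m_def using that assms(1) by (simp add: less_Suc_eq_le)
  define c' where "c' e = (if e \<in> D then m + f e else c e)" for e
  show ?thesis
  proof (rule that[of c'])
    show "c' e = c e" if "e \<in> A" for e using that assms(3) unfolding c'_def by auto
    show "inj_on c' D" using f unfolding c'_def inj_on_def by auto
    show "c' e \<noteq> c h" if "e \<in> D" "h \<in> A" for e h
      using m[OF that(2)] that(1) unfolding c'_def by auto
  qed
qed

section \<open>Proper colourings of the edges in \<open>S\<close> and their extensions\<close>

context simple_graph
begin

text \<open>The edges in \<open>L\<close> (leaf edges) received the colour of an already coloured edge when they were
  added; all other coincidences of colours are between opposite edges of a 4-clique.\<close>

definition coloured :: "'a set \<Rightarrow> ('a set \<Rightarrow> nat) \<Rightarrow> 'a set set \<Rightarrow> bool" where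
  "coloured S c L \<longleftrightarrow>
     (\<forall>e\<in>inner E S. \<forall>h\<in>inner E S. e \<noteq> h \<longrightarrow> c e = c h \<longrightarrow> e \<inter> h = {}) \<and>
     L \<subseteq> inner E S \<and>
     (\<forall>e\<in>inner E S - L. \<forall>h\<in>inner E S - L. e \<noteq> h \<longrightarrow> c e = c h \<longrightarrow> clique E (e \<union> h))"

text \<open>A vertex \<open>x\<close> of \<open>T\<close> is free if a new vertex \<open>z\<close> joined to \<open>T\<close> can give the edge \<open>{z, x}\<close> the
  colour of the opposite edge \<open>T - {x}\<close> of the new 4-clique.\<close>

definition free :: "'a set \<Rightarrow> ('a set \<Rightarrow> nat) \<Rightarrow> 'a set set \<Rightarrow> 'a set \<Rightarrow> 'a \<Rightarrow> bool" where
  "free S c L T x \<longleftrightarrow> T - {x} \<notin> L \<and> (\<forall>g\<in>inner E S. x \<in> g \<longrightarrow> c g \<noteq> c (T - {x}))"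

lemma colouredD:
  assumes "coloured S c L"
  shows "e \<in> inner E S \<Longrightarrow> h \<in> inner E S \<Longrightarrow> e \<noteq> h \<Longrightarrow> c e = c h \<Longrightarrow> e \<inter> h = {}"
    and "L \<subseteq> inner E S"
    and "e \<in> inner E S - L \<Longrightarrow> h \<in> inner E S - L \<Longrightarrow> e \<noteq> h \<Longrightarrow> c e = c h \<Longrightarrow> clique E (e \<union> h)"
  using assms unfolding coloured_def by auto

lemma inner_mono: "S \<subseteq> S' \<Longrightarrow> inner E S \<subseteq> inner E S'"
  unfolding inner_def by auto

lemma coloured_ext:
  assumes "coloured S c L" "S \<subseteq> S'"
    and agree: "\<And>e. e \<in> inner E S \<Longrightarrow> c' e = c e"
    and out: "\<And>e h. e \<in> inner E S' - inner E S \<Longrightarrow> h \<in> inner E S \<Longrightarrow> c' e \<noteq> c h"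
    and same: "\<And>e h. e \<in> inner E S' - inner E S \<Longrightarrow> h \<in> inner E S' - inner E S \<Longrightarrow> e \<noteq> h \<Longrightarrow> c' e = c' h \<Longrightarrow>
      e \<inter> h = {} \<and> clique E (e \<union> h)"
  shows "coloured S' c' L"
  unfolding coloured_def
proof (intro conjI ballI impI)
  fix e h assume eh: "e \<in> inner E S'" "h \<in> inner E S'" "e \<noteq> h" "c' e = c' h"
  consider "e \<in> inner E S" "h \<in> inner E S" | "e \<in> inner E S' - inner E S" "h \<in> inner E S' - inner E S"
    using eh out[of e h] out[of h e] agree[of e] agree[of h] by (cases "e \<in> inner E S"; cases "h \<in> inner E S") auto
  then show "e \<inter> h = {}"
    using colouredD(1)[OF assms(1)] agree same eh by cases auto
next
  show "L \<subseteq> inner E S'" using colouredD(2)[OF assms(1)] inner_mono[OF assms(2)] by blast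
next
  fix e h assume eh: "e \<in> inner E S' - L" "h \<in> inner E S' - L" "e \<noteq> h" "c' e = c' h"
  consider "e \<in> inner E S" "h \<in> inner E S" | "e \<in> inner E S' - inner E S" "h \<in> inner E S' - inner E S"
    using eh out[of e h] out[of h e] agree[of e] agree[of h] by (cases "e \<in> inner E S"; cases "h \<in> inner E S") auto
  then show "clique E (e \<union> h)"
    using colouredD(3)[OF assms(1)] agree same eh by cases auto
qed

lemma free_ext:
  assumes "free S c L T x" "T - {x} \<in> inner E S"
    and agree: "\<And>e. e \<in> inner E S \<Longrightarrow> c' e = c e"
    and out: "\<And>e h. e \<in> inner E S' - inner E S \<Longrightarrow> h \<in> inner E S \<Longrightarrow> c' e \<noteq> c h"
  shows "free S' c' L T x"
  unfolding free_def
proof (intro conjI ballI impI)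
  show "T - {x} \<notin> L" using assms(1) unfolding free_def by blast
  fix g assume g: "g \<in> inner E S'" "x \<in> g"
  show "c' g \<noteq> c' (T - {x})"
  proof (cases "g \<in> inner E S")
    case True then show ?thesis using assms(1,2) g(2) agree unfolding free_def by auto
  next
    case False then show ?thesis using out[of g "T - {x}"] assms(2) g(1) agree by auto
  qed
qed

text \<open>All edges at \<open>z\<close> get distinct new colours. In a triangle through
  \<open>z\<close> the edge opposite to an old vertex \<open>x\<close> contains \<open>z\<close>, so
  its colour occurs on no other edge and \<open>x\<close> is free.\<close>

lemma one_step_colours:
  assumes "coloured S c L" "S \<subseteq> V" "z \<notin> S"
  obtains c' where "\<And>e. e \<in> inner E S \<Longrightarrow> c' e = c e" "inj_on c' ((\<lambda>y. {z, y}) ` nbrs E S z)"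
    "\<And>e h. e \<in> inner E (insert z S) - inner E S \<Longrightarrow> h \<in> inner E S \<Longrightarrow> c' e \<noteq> c h"
    "coloured (insert z S) c' L"
    "\<And>T x. triangle E (insert z S) T \<Longrightarrow> z \<in> T \<Longrightarrow> x \<in> T \<Longrightarrow> x \<noteq> z \<Longrightarrow> free (insert z S) c' L T x"
proof -
  define D where "D = (\<lambda>y. {z, y}) ` nbrs E S z"
  have disj: "inner E S \<inter> D = {}" using assms(3) unfolding inner_def D_def by auto
  have D: "inner E (insert z S) - inner E S = D"
    using inner_insert[OF assms(3)] disj unfolding D_def by blast
  have finD: "finite D" using finS[OF assms(2)] unfolding D_def nbrs_def by simp
  obtain c' where c': "\<And>e. e \<in> inner E S \<Longrightarrow> c' e = c e" "inj_on c' D"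
    "\<And>e h. e \<in> D \<Longrightarrow> h \<in> inner E S \<Longrightarrow> c' e \<noteq> c h"
    by (rule fresh_colours[OF fin_inner finD disj, of c], rule that)
  have col: "coloured (insert z S) c' L"
    using c' by (intro coloured_ext[OF assms(1)]) (auto simp: D inj_on_def)
  show ?thesis
  proof (rule that[of c'])
    fix T x assume T: "triangle E (insert z S) T" "z \<in> T" "x \<in> T" "x \<noteq> z"
    have eD: "T - {x} \<in> D"
      using triangle_edge(1)[OF T(1,3)] T(2,4) assms(3) D unfolding inner_def by blast
    show "free (insert z S) c' L T x"
      unfolding free_def
    proof (intro conjI ballI impI)
      show "T - {x} \<notin> L" using eD disj colouredD(2)[OF assms(1)] by blast
      fix g assume g: "g \<in> inner E (insert z S)" "x \<in> g"
      show "c' g \<noteq> c' (T - {x})"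
      proof
        assume eq: "c' g = c' (T - {x})"
        then have "g \<notin> inner E S" using c'(1,3) eD by metis
        then have "g \<in> D" using D g(1) by blast
        then have "g = T - {x}" using eq c'(2) eD by (auto dest: inj_onD)
        then show False using g(2) by blast
      qed
    qed
  qed (use c' col D D_def in auto)
qed

text \<open>Two edges outside \<open>L\<close> with the same colour are opposite edges of a
  4-clique, and \<open>x\<close>, which forms a triangle with each of them, is adjacent to all four
  of its vertices.\<close>

lemma five_clique:
  assumes "coloured S c L" "free S c L T x" "triangle E S T" "x \<in> T"
    "free S c L T' x" "triangle E S T'" "x \<in> T'" "T \<noteq> T'" "c (T - {x}) = c (T' - {x})"
  shows has_five_clique
proof -
  let ?b = "T - {x}" and ?b' = "T' - {x}"
  have b: "?b \<in> inner E S - L" "?b' \<in> inner E S - L" "card ?b = 2" "card ?b' = 2"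
    using triangle_edge[OF assms(3,4)] triangle_edge[OF assms(6,7)] assms(2,5) unfolding free_def by blast+
  have ne: "?b \<noteq> ?b'" using assms by blast
  have cl: "clique E (?b \<union> ?b')" using colouredD(3)[OF assms(1)] b ne assms(9) by blast
  have disj: "?b \<inter> ?b' = {}" using colouredD(1)[OF assms(1)] b ne assms(9) by blast
  have fin: "finite ?b" "finite ?b'" by (rule finite_of_card[OF b(3)], rule finite_of_card[OF b(4)])
  have "card (insert x (?b \<union> ?b')) = 5"
    using fin disj b by (simp add: card_Un_disjoint)
  moreover have "clique E (insert x (?b \<union> ?b'))"
  proof (rule clique_insert[OF cl])
    fix y assume "y \<in> ?b \<union> ?b'"
    then show "{x, y} \<in> E" using assms(3,4,6,7) unfolding triangle_def by (auto dest: cliqueD)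
  qed
  ultimately show ?thesis by blast
qed

text \<open>The leaf edge \<open>{z, x}\<close> copies the colour of \<open>T - {x}\<close>, so the
  new 4-clique repeats a colour. No other new edge can destroy the freedom of an old vertex. That
  vertex is then \<open>x\<close>, and its opposite edges in \<open>T\<close> and \<open>T'\<close>
  have equal colours, so that \<open>five_clique\<close> applies.\<close>

lemma leaf_step_colours:
  assumes "coloured S c L" "S \<subseteq> V" "z \<notin> S" "triangle E S T" "T \<subseteq> nbrs E S z" "x \<in> T" "free S c L T x"
  obtains c' L' where "\<And>e. e \<in> inner E S \<Longrightarrow> c' e = c e" "coloured (insert z S) c' L'"
    "c' {z, x} = c' (T - {x})"
    "\<And>T' a. triangle E S T' \<Longrightarrow> a \<in> T' \<Longrightarrow> free S c L T' a \<Longrightarrow>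
      T' = T \<and> a = x \<or> free (insert z S) c' L' T' a \<or> has_five_clique"
    "\<And>T'. triangle E (insert z S) T' \<Longrightarrow> z \<in> T' \<Longrightarrow> \<exists>a\<in>T'. free (insert z S) c' L' T' a"
proof -
  obtain c0 where c0: "\<And>e. e \<in> inner E S \<Longrightarrow> c0 e = c e" "inj_on c0 ((\<lambda>y. {z, y}) ` nbrs E S z)"
    "\<And>e h. e \<in> inner E (insert z S) - inner E S \<Longrightarrow> h \<in> inner E S \<Longrightarrow> c0 e \<noteq> c h"
    "coloured (insert z S) c0 L"
    "\<And>T x. triangle E (insert z S) T \<Longrightarrow> z \<in> T \<Longrightarrow> x \<in> T \<Longrightarrow> x \<noteq> z \<Longrightarrow> free (insert z S) c0 L T x"
    by (rule one_step_colours[OF assms(1-3)], rule that)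
  define D where "D = (\<lambda>y. {z, y}) ` nbrs E S z"
  have D: "inner E (insert z S) - inner E S = D"
  proof -
    have "inner E S \<inter> D = {}" using assms(3) unfolding inner_def D_def by auto
    then show ?thesis using inner_insert[OF assms(3)] unfolding D_def by blast
  qed
  define l where "l = {z, x}"
  define b where "b = T - {x}"
  define c' where "c' = c0(l := c b)"
  define L' where "L' = insert l L"
  have bS: "b \<in> inner E S" using triangle_edge(1)[OF assms(4,6)] unfolding b_def .
  have lD: "l \<in> D" using assms(5,6) unfolding l_def D_def by blast
  then have lS: "l \<notin> inner E S" "l \<in> inner E (insert z S)" using D by auto
  have xS: "x \<in> S" using assms(4,6) unfolding triangle_def by blast
  have bL: "b \<notin> L" and xb: "\<And>g. g \<in> inner E S \<Longrightarrow> x \<in> g \<Longrightarrow> c g \<noteq> c b"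
    using assms(7) unfolding free_def b_def by auto
  have agree: "c' e = c e" if "e \<in> inner E S" for e
    using that c0(1) lS unfolding c'_def by auto
  have c'D: "c' e = c0 e" if "e \<noteq> l" for e using that unfolding c'_def by simp
  have cl: "c' l = c b" unfolding c'_def by simp
  have LS: "L \<subseteq> inner E S" using colouredD(2)[OF assms(1)] .
  \<comment> \<open>The colour of \<open>l\<close> is old, so any other edge with this colour lies
    in \<open>S\<close> and misses \<open>z\<close>; it misses \<open>x\<close> because
    \<open>x\<close> is free.\<close>
  have l_disj: "e \<inter> l = {}" if "e \<in> inner E (insert z S)" "e \<noteq> l" "c' e = c' l" for e
  proof -
    have ce: "c0 e = c b" using that cl c'D by auto
    then have eS: "e \<in> inner E S" using that(1) c0(3)[of e b] bS by blast
    then have "x \<notin> e" using xb[of e] ce c0(1) by auto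
    moreover have "z \<notin> e" using eS assms(3) unfolding inner_def by blast
    ultimately show ?thesis unfolding l_def by blast
  qed
  have col: "coloured (insert z S) c' L'"
    unfolding coloured_def
  proof (intro conjI ballI impI)
    fix e h assume eh: "e \<in> inner E (insert z S)" "h \<in> inner E (insert z S)" "e \<noteq> h" "c' e = c' h"
    show "e \<inter> h = {}"
    proof (cases "e = l \<or> h = l")
      case True
      then consider "e = l" "h \<noteq> l" | "h = l" "e \<noteq> l" using eh(3) by blast
      then show ?thesis
      proof cases
        case 1
        then have "h \<inter> l = {}" using l_disj[OF eh(2)] eh(4) by simp
        then show ?thesis using 1 by blast
      next
        case 2
        then show ?thesis using l_disj[OF eh(1)] eh(4) by simp
      qed
    next
      case False then show ?thesis using colouredD(1)[OF c0(4)] eh c'D by auto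
    qed
  next
    show "L' \<subseteq> inner E (insert z S)"
      unfolding L'_def using LS lS inner_mono[of S "insert z S"] by blast
  next
    fix e h assume eh: "e \<in> inner E (insert z S) - L'" "h \<in> inner E (insert z S) - L'" "e \<noteq> h" "c' e = c' h"
    then have "e \<noteq> l" "h \<noteq> l" unfolding L'_def by auto
    then show "clique E (e \<union> h)" using colouredD(3)[OF c0(4)] eh c'D unfolding L'_def by auto
  qed
  have old: "T' = T \<and> a = x \<or> free (insert z S) c' L' T' a \<or> has_five_clique"
    if T': "triangle E S T'" "a \<in> T'" "free S c L T' a" for T' a
  proof (rule ccontr)
    assume neg: "\<not> ?thesis"
    let ?e = "T' - {a}"
    have eS: "?e \<in> inner E S" using triangle_edge(1)[OF T'(1,2)] .
    have "?e \<notin> L'" using T'(3) eS lS unfolding free_def L'_def by auto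
    then obtain g where g: "g \<in> inner E (insert z S)" "a \<in> g" "c' g = c' ?e"
      using neg unfolding free_def by blast
    have ce: "c' ?e = c ?e" using agree eS by blast
    have "g = l"
    proof (rule ccontr)
      assume "g \<noteq> l"
      show False
      proof (cases "g \<in> inner E S")
        case True then show False using T'(3) g ce agree unfolding free_def by auto
      next
        case False then show False using c0(3)[of g ?e] g \<open>g \<noteq> l\<close> c'D ce eS by auto
      qed
    qed
    moreover have "a \<noteq> z" using T'(1,2) assms(3) unfolding triangle_def by blast
    ultimately have "a = x" using g(2) unfolding l_def by blast
    moreover have "T \<noteq> T'" using neg \<open>a = x\<close> by blast
    moreover have "c (T - {x}) = c (T' - {x})"
      using g(3) \<open>g = l\<close> cl ce \<open>a = x\<close> unfolding b_def by simp
    ultimately show False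
      using five_clique[OF assms(1,7,4,6)] T' neg by blast
  qed
  have new: "\<exists>a\<in>T'. free (insert z S) c' L' T' a"
    if T': "triangle E (insert z S) T'" "z \<in> T'" for T'
  proof -
    have "card (T' - {z}) = 2" using triangle_edge(2)[OF T'] .
    then obtain s t where st: "T' - {z} = {s, t}" "s \<noteq> t" by (meson card_2_iff)
    \<comment> \<open>Two old vertices are available and their opposite edges differ, so one of
      these is not the leaf edge, the only edge at \<open>z\<close> whose colour is not new.\<close>
    then have "\<exists>a\<in>T'. a \<noteq> z \<and> T' - {a} \<noteq> l"
    proof (cases "T' - {s} = l")
      case True
      have "s \<in> T' - {t}" "s \<notin> T' - {s}" using st by blast+
      then have "T' - {t} \<noteq> l" using True by auto
      then show ?thesis using st by blast
    next
      case False then show ?thesis using st by blast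
    qed
    then obtain a where a: "a \<in> T'" "a \<noteq> z" "T' - {a} \<noteq> l" by blast
    let ?e = "T' - {a}"
    have eS': "?e \<in> inner E (insert z S)" using triangle_edge(1)[OF T'(1) a(1)] .
    have "z \<in> ?e" using T'(2) a by blast
    then have eD: "?e \<in> D" using eS' assms(3) D unfolding inner_def by auto
    have fr: "free (insert z S) c0 L T' a" using c0(5)[OF T' a(1,2)] .
    have "free (insert z S) c' L' T' a"
      unfolding free_def
    proof (intro conjI ballI impI)
      show "?e \<notin> L'" using fr a(3) unfolding free_def L'_def by blast
      fix g assume g: "g \<in> inner E (insert z S)" "a \<in> g"
      show "c' g \<noteq> c' ?e"
      proof (cases "g = l")
        case True
        have "c0 ?e \<noteq> c b" using c0(3)[of ?e b] eD D bS by blast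
        then show ?thesis using True cl c'D[OF a(3)] by auto
      next
        case False
        then show ?thesis using fr g c'D a(3) unfolding free_def by auto
      qed
    qed
    then show ?thesis using a(1) by blast
  qed
  show ?thesis
  proof (rule that[of c' L'])
    show "c' {z, x} = c' (T - {x})" using cl agree[OF bS] unfolding l_def b_def by simp
    show "coloured (insert z S) c' L'" by (rule col)
    show "c' e = c e" if "e \<in> inner E S" for e by (rule agree[OF that])
  qed (rule old new; assumption)+
qed

text \<open>The opposite edges \<open>{u, x}\<close> and \<open>{v, y}\<close> share one new colour,
  and the other new edges have colours of their own. So a vertex whose opposite edge is new fails to
  be free only if that edge is one of these two and the vertex lies on the other.\<close>

lemma two_step_colours:
  assumes "coloured S c L" "S \<subseteq> V" "x \<notin> S" "y \<notin> S" "x \<noteq> y" "u \<in> S" "v \<in> S" "u \<noteq> v"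
    "clique E {u, v, x, y}"
  defines "S' \<equiv> insert y (insert x S)"
  obtains c' where "\<And>e. e \<in> inner E S \<Longrightarrow> c' e = c e" "coloured S' c' L" "c' {u, x} = c' {v, y}"
    "\<And>e h. e \<in> inner E S' - inner E S \<Longrightarrow> h \<in> inner E S \<Longrightarrow> c' e \<noteq> c h"
    "\<And>T. triangle E S' T \<Longrightarrow> \<not> T \<subseteq> S \<Longrightarrow> \<exists>a\<in>T. free S' c' L T a"
    "\<And>T a b. L = {} \<Longrightarrow> triangle E S' T \<Longrightarrow> \<not> T \<subseteq> S \<Longrightarrow> a \<in> T \<Longrightarrow> b \<in> T \<Longrightarrow> a \<noteq> b \<Longrightarrow>
      free S' c' L T a \<or> free S' c' L T b"
proof -
  define D where "D = inner E S' - inner E S"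
  have finD: "finite D" unfolding D_def using fin_inner by blast
  obtain c0 where c0: "\<And>e. e \<in> inner E S \<Longrightarrow> c0 e = c e" "inj_on c0 D"
    "\<And>e h. e \<in> D \<Longrightarrow> h \<in> inner E S \<Longrightarrow> c0 e \<noteq> c h"
    by (rule fresh_colours[OF fin_inner finD, of S c]) (simp add: D_def, rule that)
  define p where "p = {u, x}"
  define q where "q = {v, y}"
  have pE: "p \<in> E" "q \<in> E" unfolding p_def q_def using assms
    by (metis cliqueD insertI1 insertI2)+
  then have pD: "p \<in> D" "q \<in> D" unfolding D_def inner_def S'_def p_def q_def using assms(3,4,6,7) by auto
  have pq: "p \<inter> q = {}" "p \<noteq> q" unfolding p_def q_def using assms(3-8) by auto
  have pqcl: "clique E (p \<union> q)"
    unfolding p_def q_def by (rule clique_subset[OF assms(9)]) auto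
  define c' where "c' = c0(q := c0 p)"
  have agree: "c' e = c e" if "e \<in> inner E S" for e
    using that c0(1) pD unfolding c'_def D_def by auto
  have out: "c' e \<noteq> c h" if "e \<in> D" "h \<in> inner E S" for e h
    using that c0(3) pD unfolding c'_def by auto
  have same: "e = p \<and> h = q \<or> e = q \<and> h = p" if "e \<in> D" "h \<in> D" "e \<noteq> h" "c' e = c' h" for e h
    using that c0(2) pD unfolding c'_def inj_on_def by (auto split: if_splits)
  have SS': "S \<subseteq> S'" unfolding S'_def by blast
  have col: "coloured S' c' L"
  proof (rule coloured_ext[OF assms(1) SS'])
    fix e h assume "e \<in> inner E S' - inner E S" "h \<in> inner E S' - inner E S" "e \<noteq> h" "c' e = c' h"
    then consider "e = p \<and> h = q" | "e = q \<and> h = p" using same unfolding D_def by blast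
    then show "e \<inter> h = {} \<and> clique E (e \<union> h)"
      using pq pqcl by cases (auto simp: Un_commute)
  qed (use agree out D_def in auto)
  have LS: "L \<subseteq> inner E S" using colouredD(2)[OF assms(1)] .
  have nfree: "T - {a} = p \<and> a \<in> q \<or> T - {a} = q \<and> a \<in> p"
    if nf: "T - {a} \<in> D" "\<not> free S' c' L T a" for T a
  proof -
    have "T - {a} \<notin> L" using LS nf(1) unfolding D_def by blast
    then obtain g where g: "g \<in> inner E S'" "a \<in> g" "c' g = c' (T - {a})"
      using nf(2) unfolding free_def by blast
    have "g \<in> D" using g out[OF nf(1), of g] agree unfolding D_def by auto
    moreover have "g \<noteq> T - {a}" using g(2) by blast
    ultimately show ?thesis using same[of g "T - {a}"] g nf(1) by blast
  qed
  \<comment> \<open>If both \<open>a\<close> and \<open>b\<close> failed, the triangle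
    \<open>T\<close> would contain all four vertices of \<open>p\<close> and
    \<open>q\<close>.\<close>
  have two: "free S' c' L T a \<or> free S' c' L T b"
    if T: "triangle E S' T" "a \<in> T" "b \<in> T" "a \<noteq> b" "T - {a} \<in> D" "T - {b} \<in> D" for T a b
  proof (rule ccontr)
    assume "\<not> ?thesis"
    then have "T - {a} = p \<and> a \<in> q \<or> T - {a} = q \<and> a \<in> p" "T - {b} = p \<and> b \<in> q \<or> T - {b} = q \<and> b \<in> p"
      using nfree T by blast+
    moreover have "T - {a} \<noteq> T - {b}" using T by blast
    ultimately have "p \<union> q \<subseteq> T" by blast
    moreover have "card (p \<union> q) = 4"
      using pq assms(3-8) unfolding p_def q_def by (auto simp: card_insert_if)
    moreover have "finite T" using T(1) finite_of_card unfolding triangle_def by blast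
    ultimately have "4 \<le> card T" by (metis card_mono)
    then show False using T(1) unfolding triangle_def by simp
  qed
  \<comment> \<open>The opposite edge is old but \<open>a\<close> is new, so every edge at
    \<open>a\<close> has a new colour; \<open>L = {}\<close> ensures that the opposite edge is not a
    leaf edge.\<close>
  have old: "free S' c' L T a" if T: "triangle E S' T" "a \<in> T" "T - {a} \<in> inner E S" "a \<notin> S" "L = {}" for T a
    unfolding free_def
  proof (intro conjI ballI impI)
    show "T - {a} \<notin> L" using T by simp
    fix g assume g: "g \<in> inner E S'" "a \<in> g"
    then have "g \<in> D" using T(4) unfolding D_def inner_def by blast
    then show "c' g \<noteq> c' (T - {a})" using out[of g "T - {a}"] T(3) agree by auto
  qed
  have inD: "T - {a} \<in> D \<or> T - {a} \<in> inner E S" if "triangle E S' T" "a \<in> T" for T a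
    using triangle_edge(1)[OF that] unfolding D_def by blast
  show ?thesis
  proof (rule that[of c'])
    show "c' {u, x} = c' {v, y}" using pq(2) unfolding c'_def p_def q_def by (metis fun_upd_other fun_upd_same)
    show "coloured S' c' L" by (rule col)
    show "c' e = c e" if "e \<in> inner E S" for e by (rule agree[OF that])
    show "c' e \<noteq> c h" if "e \<in> inner E S' - inner E S" "h \<in> inner E S" for e h
      using out that unfolding D_def by blast
    fix T assume T: "triangle E S' T" "\<not> T \<subseteq> S"
    \<comment> \<open>The edges opposite to the two other vertices of \<open>T\<close> contain the
      new vertex \<open>w\<close>, so both are new and \<open>two\<close> applies.\<close>
    then obtain w where w: "w \<in> T" "w \<notin> S" by blast
    then obtain s t where st: "T - {w} = {s, t}" "s \<noteq> t"
      using triangle_edge(2)[OF T(1) w(1)] by (meson card_2_iff)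
    then have "T - {s} \<in> D" "T - {t} \<in> D"
      using triangle_edge(1)[OF T(1), of s] triangle_edge(1)[OF T(1), of t] w unfolding D_def inner_def by blast+
    then show "\<exists>a\<in>T. free S' c' L T a" using two[OF T(1), of s t] st by blast
  next
    fix T a b assume T: "L = {}" "triangle E S' T" "\<not> T \<subseteq> S" "a \<in> T" "b \<in> T" "a \<noteq> b"
    have old': "free S' c' L T a" if "T - {a} \<in> inner E S" "a \<in> T" for a
    proof -
      have "a \<notin> S" using that T(3) unfolding inner_def by blast
      then show ?thesis using old T that by blast
    qed
    show "free S' c' L T a \<or> free S' c' L T b"
      using two[OF T(2,4-6)] inD[OF T(2,4)] inD[OF T(2,5)] old' T by blast
  qed
qed

end

section \<open>States of the growth and the effect of a step on them\<close>

definition hit :: "'a set set \<Rightarrow> 'a set \<Rightarrow> bool" where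
  "hit M Q \<longleftrightarrow> (\<exists>e\<in>M. e \<subseteq> Q)"

abbreviation repeats :: "('b \<Rightarrow> 'c) \<Rightarrow> 'b set \<Rightarrow> bool" where
  "repeats c F \<equiv> \<exists>e\<in>F. \<exists>h\<in>F. e \<noteq> h \<and> c e = c h"

definition matching_avoiding :: "'a set \<Rightarrow> 'a set set \<Rightarrow> bool" where
  "matching_avoiding X M \<longleftrightarrow> (\<forall>e\<in>M. \<forall>h\<in>M. e \<noteq> h \<longrightarrow> e \<inter> h = {}) \<and> \<Union>M \<inter> X = {}"

lemma hit_mono: "hit M Q \<Longrightarrow> M \<subseteq> M' \<Longrightarrow> Q \<subseteq> Q' \<Longrightarrow> hit M' Q'"
  unfolding hit_def by blast

lemma matching_avoiding_insert:
  assumes "matching_avoiding X M" "e \<inter> (\<Union>M \<union> X) = {}"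
  shows "matching_avoiding X (insert e M)"
  unfolding matching_avoiding_def
proof (intro conjI ballI impI)
  fix a b assume ab: "a \<in> insert e M" "b \<in> insert e M" "a \<noteq> b"
  then consider "a \<in> M" "b \<in> M" | "a = e" "b \<in> M" | "a \<in> M" "b = e" by blast
  then show "a \<inter> b = {}"
  proof cases
    case 1 then show ?thesis using assms(1) ab(3) unfolding matching_avoiding_def by blast
  next
    case 2 then show ?thesis using assms(2) by blast
  next
    case 3 then show ?thesis using assms(2) by blast
  qed
next
  show "\<Union> (insert e M) \<inter> X = {}" using assms unfolding matching_avoiding_def by blast
qed

context simple_graph
begin

definition good :: "'a set \<Rightarrow> ('a set \<Rightarrow> nat) \<Rightarrow> 'a set set \<Rightarrow> bool" where
  "good S c M \<longleftrightarrow> (\<forall>Q. Q \<subseteq> S \<longrightarrow> card Q = 4 \<longrightarrow> clique E Q \<longrightarrow>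
     hit M Q \<or> repeats c (inner E Q))"

text \<open>\<open>M\<close> is the set of edges that will get the one colour shared by all components; \<open>X\<close> contains
  the root of the component, which \<open>M\<close> has to avoid.\<close>

definition state :: "'a set \<Rightarrow> 'a set \<Rightarrow> ('a set \<Rightarrow> nat) \<Rightarrow> 'a set set \<Rightarrow> 'a set set \<Rightarrow> bool" where
  "state X S c L M \<longleftrightarrow> S \<subseteq> V \<and> (\<exists>e\<in>E. e \<subseteq> S) \<and> coloured S c L \<and> M \<subseteq> inner E S \<and>
     matching_avoiding X M \<and> good S c M"

text \<open>The triangles to which no further vertex could be joined without using a new edge of \<open>M\<close>.\<close>

definition blocked :: "'a set \<Rightarrow> ('a set \<Rightarrow> nat) \<Rightarrow> 'a set set \<Rightarrow> 'a set set \<Rightarrow> 'a set set" where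
  "blocked S c L M = {T. triangle E S T \<and> \<not> hit M T \<and> (\<forall>x\<in>T. \<not> free S c L T x)}"

definition all_free :: "'a set \<Rightarrow> ('a set \<Rightarrow> nat) \<Rightarrow> 'a set set \<Rightarrow> bool" where
  "all_free S c L \<longleftrightarrow> (\<forall>T. triangle E S T \<longrightarrow> (\<exists>x\<in>T. free S c L T x))"

text \<open>At most one vertex of each triangle is not free. This lasts until the first leaf step;
  without 5-cliques that step takes away at most one free vertex, so it blocks no triangle at
  all.\<close>

definition almost_free :: "'a set \<Rightarrow> ('a set \<Rightarrow> nat) \<Rightarrow> 'a set set \<Rightarrow> bool" where
  "almost_free S c L \<longleftrightarrow> L = {} \<and>
     (\<forall>T. triangle E S T \<longrightarrow> (\<forall>a\<in>T. \<forall>b\<in>T. a \<noteq> b \<longrightarrow> free S c L T a \<or> free S c L T b))"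

lemma finite_blocked: "finite S \<Longrightarrow> finite (blocked S c L M)"
  by (rule finite_subset[of _ "Pow S"]) (auto simp: blocked_def triangle_def)

lemma triangle_subset: "triangle E S' T \<Longrightarrow> T \<subseteq> S \<Longrightarrow> triangle E S T"
  unfolding triangle_def by blast

lemma triangle_three:
  assumes "triangle E S T" "x \<in> T"
  obtains a b where "T = {x, a, b}" "x \<noteq> a" "x \<noteq> b" "a \<noteq> b"
proof -
  obtain a b where "T - {x} = {a, b}" "a \<noteq> b"
    using triangle_edge(2)[OF assms] by (meson card_2_iff)
  then show ?thesis using that[of a b] assms(2) by blast
qed

lemma good_ext:
  assumes "good S c M" "M \<subseteq> M'" "\<And>e. e \<in> inner E S \<Longrightarrow> c' e = c e"
    and "\<And>Q. Q \<subseteq> S' \<Longrightarrow> \<not> Q \<subseteq> S \<Longrightarrow> card Q = 4 \<Longrightarrow> clique E Q \<Longrightarrow>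
      hit M' Q \<or> repeats c' (inner E Q)"
  shows "good S' c' M'"
  unfolding good_def
proof (intro allI impI)
  fix Q assume Q: "Q \<subseteq> S'" "card Q = 4" "clique E Q"
  show "hit M' Q \<or> repeats c' (inner E Q)"
  proof (cases "Q \<subseteq> S")
    case True
    have "inner E Q \<subseteq> inner E S" using True inner_mono by blast
    moreover have "hit M Q \<or> repeats c (inner E Q)"
      using assms(1) True Q unfolding good_def by blast
    ultimately show ?thesis using hit_mono[OF _ assms(2)] assms(3) by (metis order_refl subset_iff)
  next
    case False then show ?thesis using assms(4) Q by blast
  qed
qed

lemma new_clique_triangle:
  assumes "Q \<subseteq> insert z S" "\<not> Q \<subseteq> S" "card Q = 4" "clique E Q" "z \<notin> S"
  shows "z \<in> Q" "triangle E S (Q - {z})" "Q - {z} \<subseteq> nbrs E S z"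
proof -
  show z: "z \<in> Q" using assms by blast
  have "card (Q - {z}) = 3" using z assms(3) finite_of_card[OF assms(3)] by simp
  then show "triangle E S (Q - {z})"
    using assms clique_subset[OF assms(4), of "Q - {z}"] unfolding triangle_def by blast
  show "Q - {z} \<subseteq> nbrs E S z" using z assms(1) cliqueD[OF assms(4) z] unfolding nbrs_def by blast
qed

text \<open>Every edge at \<open>z\<close> gets a new colour, so all 4-cliques through
  \<open>z\<close> have to contain an edge of \<open>M'\<close>. No freedom is lost, and enlarging
  \<open>M\<close> can only unblock triangles.\<close>

lemma plain_step:
  assumes st: "state X S c L M" and z: "z \<in> V - S"
    and M': "M \<subseteq> M'" "M' \<subseteq> inner E (insert z S)" "matching_avoiding X M'"
    and all_hit: "\<And>T. triangle E S T \<Longrightarrow> T \<subseteq> nbrs E S z \<Longrightarrow> hit M' (insert z T)"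
  obtains c' where "state X (insert z S) c' L M'"
    "blocked (insert z S) c' L M' \<subseteq> blocked S c L M"
    "all_free S c L \<Longrightarrow> all_free (insert z S) c' L"
    "almost_free S c L \<Longrightarrow> almost_free (insert z S) c' L"
proof -
  have S: "S \<subseteq> V" and col: "coloured S c L" and ed: "\<exists>e\<in>E. e \<subseteq> S" and gd: "good S c M"
    using st unfolding state_def by auto
  have zS: "z \<notin> S" using z by blast
  obtain c' where c': "\<And>e. e \<in> inner E S \<Longrightarrow> c' e = c e" "inj_on c' ((\<lambda>y. {z, y}) ` nbrs E S z)"
    "\<And>e h. e \<in> inner E (insert z S) - inner E S \<Longrightarrow> h \<in> inner E S \<Longrightarrow> c' e \<noteq> c h"
    "coloured (insert z S) c' L"
    "\<And>T x. triangle E (insert z S) T \<Longrightarrow> z \<in> T \<Longrightarrow> x \<in> T \<Longrightarrow> x \<noteq> z \<Longrightarrow> free (insert z S) c' L T x"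
    by (rule one_step_colours[OF col S zS], rule that)
  have keep: "free (insert z S) c' L T x" if "triangle E S T" "x \<in> T" "free S c L T x" for T x
    using free_ext[OF that(3) triangle_edge(1)[OF that(1,2)] c'(1,3)] .
  have new: "\<exists>a\<in>T. \<exists>b\<in>T. a \<noteq> b \<and> a \<noteq> z \<and> b \<noteq> z \<and> free (insert z S) c' L T a \<and> free (insert z S) c' L T b"
    if T: "triangle E (insert z S) T" "z \<in> T" for T
  proof -
    obtain a b where "T = {z, a, b}" "z \<noteq> a" "z \<noteq> b" "a \<noteq> b" using triangle_three[OF T] .
    then show ?thesis using c'(5)[OF T] by (metis insertI1 insertI2)
  qed
  have old: "triangle E S T" if "triangle E (insert z S) T" "z \<notin> T" for T
    using that unfolding triangle_def by blast
  show ?thesis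
  proof (rule that[of c'])
    have "good (insert z S) c' M'"
    proof (rule good_ext[OF gd M'(1) c'(1)])
      fix Q assume Q: "Q \<subseteq> insert z S" "\<not> Q \<subseteq> S" "card Q = 4" "clique E Q"
      note nt = new_clique_triangle[OF Q zS]
      have "hit M' (insert z (Q - {z}))" using all_hit[OF nt(2,3)] .
      then show "hit M' Q \<or> repeats c' (inner E Q)"
        unfolding insert_Diff[OF nt(1)] by (rule disjI1)
    qed
    then show "state X (insert z S) c' L M'"
      unfolding state_def using S z ed c'(4) M'(2,3) by blast
    show "blocked (insert z S) c' L M' \<subseteq> blocked S c L M"
    proof
      fix T assume T: "T \<in> blocked (insert z S) c' L M'"
      then have tr: "triangle E (insert z S) T" and nh: "\<not> hit M' T" and
        nf: "\<And>x. x \<in> T \<Longrightarrow> \<not> free (insert z S) c' L T x" unfolding blocked_def by auto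
      have "z \<notin> T" using new[OF tr] nf by blast
      then have "triangle E S T" using old tr by blast
      then show "T \<in> blocked S c L M"
        unfolding blocked_def using nf keep nh hit_mono[OF _ M'(1) order_refl] by blast
    qed
    show "all_free (insert z S) c' L" if "all_free S c L"
      unfolding all_free_def
    proof (intro allI impI)
      fix T assume T: "triangle E (insert z S) T"
      show "\<exists>x\<in>T. free (insert z S) c' L T x"
        using new[OF T] old[OF T] keep that unfolding all_free_def by blast
    qed
    show "almost_free (insert z S) c' L" if af: "almost_free S c L"
      unfolding almost_free_def
    proof (intro conjI allI impI ballI)
      show "L = {}" using af unfolding almost_free_def by blast
      fix T a b assume T: "triangle E (insert z S) T" "a \<in> T" "b \<in> T" "a \<noteq> b"
      show "free (insert z S) c' L T a \<or> free (insert z S) c' L T b"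
      proof (cases "z \<in> T")
        case True
        then have "a \<noteq> z \<or> b \<noteq> z" using T by blast
        then show ?thesis using c'(5)[OF T(1) True] T by blast
      next
        case False
        then show ?thesis using old[OF T(1) False] keep T af unfolding almost_free_def by blast
      qed
    qed
  qed
qed

text \<open>The cheap treatment of one triangle seen by \<open>z\<close>: it spends no edge of
  \<open>M\<close>, and without 5-cliques \<open>T\<close> is the only triangle that can become
  blocked.\<close>

lemma leaf_step:
  assumes st: "state X S c L M" and z: "z \<in> V - S"
    and M': "M \<subseteq> M'" "M' \<subseteq> inner E (insert z S)" "matching_avoiding X M'"
    and T: "triangle E S T" "T \<subseteq> nbrs E S z" "x \<in> T" "free S c L T x"
    and rest_hit: "\<And>T'. triangle E S T' \<Longrightarrow> T' \<subseteq> nbrs E S z \<Longrightarrow> T' \<noteq> T \<Longrightarrow> hit M' (insert z T')"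
  obtains c' L' where "state X (insert z S) c' L' M'"
    "\<not> has_five_clique \<Longrightarrow> blocked (insert z S) c' L' M' \<subseteq> insert T (blocked S c L M)"
    "\<not> has_five_clique \<Longrightarrow> almost_free S c L \<Longrightarrow> blocked (insert z S) c' L' M' = {}"
proof -
  have S: "S \<subseteq> V" and col: "coloured S c L" and ed: "\<exists>e\<in>E. e \<subseteq> S" and gd: "good S c M"
    using st unfolding state_def by auto
  have zS: "z \<notin> S" using z by blast
  obtain c' L' where c': "\<And>e. e \<in> inner E S \<Longrightarrow> c' e = c e" "coloured (insert z S) c' L'"
    "c' {z, x} = c' (T - {x})"
    "\<And>T' a. triangle E S T' \<Longrightarrow> a \<in> T' \<Longrightarrow> free S c L T' a \<Longrightarrow>
      T' = T \<and> a = x \<or> free (insert z S) c' L' T' a \<or> has_five_clique"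
    "\<And>T'. triangle E (insert z S) T' \<Longrightarrow> z \<in> T' \<Longrightarrow> \<exists>a\<in>T'. free (insert z S) c' L' T' a"
    by (rule leaf_step_colours[OF col S zS T], rule that)
  have old: "z \<notin> T' \<and> triangle E S T'" if "T' \<in> blocked (insert z S) c' L' M'" for T'
  proof -
    have tr: "triangle E (insert z S) T'" and nf: "\<And>x. x \<in> T' \<Longrightarrow> \<not> free (insert z S) c' L' T' x"
      using that unfolding blocked_def by auto
    then have "z \<notin> T'" using c'(5) by blast
    then show ?thesis using tr unfolding triangle_def by blast
  qed
  show ?thesis
  proof (rule that[of c' L'])
    have "good (insert z S) c' M'"
    proof (rule good_ext[OF gd M'(1) c'(1)])
      fix Q assume Q: "Q \<subseteq> insert z S" "\<not> Q \<subseteq> S" "card Q = 4" "clique E Q"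
      note nt = new_clique_triangle[OF Q zS]
      show "hit M' Q \<or> repeats c' (inner E Q)"
      proof (cases "Q - {z} = T")
        case True
        have "{z, x} \<in> inner E Q" using T(3) True nt(1) cliqueD[OF Q(4) nt(1), of x]
          unfolding inner_def by blast
        moreover have "T - {x} \<in> inner E Q"
          using triangle_edge(1)[OF T(1,3)] True unfolding inner_def by blast
        moreover have "{z, x} \<noteq> T - {x}" by blast
        ultimately show ?thesis using c'(3) by (intro disjI2 bexI[of _ "{z, x}"] bexI[of _ "T - {x}"] conjI)
      next
        case False
        have "hit M' (insert z (Q - {z}))" using rest_hit[OF nt(2,3) False] .
        then show ?thesis unfolding insert_Diff[OF nt(1)] by (rule disjI1)
      qed
    qed
    then show "state X (insert z S) c' L' M'"
      unfolding state_def using S z ed c'(2) M'(2,3) by blast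
  next
    assume no5: "\<not> has_five_clique"
    show "blocked (insert z S) c' L' M' \<subseteq> insert T (blocked S c L M)"
    proof
      fix T' assume T': "T' \<in> blocked (insert z S) c' L' M'"
      then have tr: "triangle E S T'" using old by blast
      have "\<not> hit M T'" using T' hit_mono[OF _ M'(1) order_refl] unfolding blocked_def by blast
      moreover have "\<not> free S c L T' a" if "a \<in> T'" "T' \<noteq> T" for a
        using c'(4)[OF tr that(1)] no5 that T' unfolding blocked_def by blast
      ultimately show "T' \<in> insert T (blocked S c L M)" using tr unfolding blocked_def by blast
    qed
    show "blocked (insert z S) c' L' M' = {}" if af: "almost_free S c L"
    proof (rule ccontr)
      assume "blocked (insert z S) c' L' M' \<noteq> {}"
      then obtain T' where T': "T' \<in> blocked (insert z S) c' L' M'" by blast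
      then have tr: "triangle E S T'" using old by blast
      \<comment> \<open>\<open>almost_free\<close> gives a free vertex among any two, so even
        \<open>T\<close> has one besides the used vertex \<open>x\<close>.\<close>
      have "\<exists>a\<in>T'. free S c L T' a \<and> \<not> (T' = T \<and> a = x)"
      proof (cases "T' = T")
        case True
        obtain a b where "T = {x, a, b}" "x \<noteq> a" "x \<noteq> b" "a \<noteq> b" using triangle_three[OF T(1,3)] .
        then show ?thesis using af T(1) True unfolding almost_free_def by (metis insertI1 insertI2)
      next
        case False
        obtain p where "p \<in> T'" using tr unfolding triangle_def by (metis card.empty equals0I zero_neq_numeral)
        then obtain a b where "T' = {p, a, b}" "p \<noteq> a" "p \<noteq> b" "a \<noteq> b" using triangle_three[OF tr] by metis
        then show ?thesis using af tr False unfolding almost_free_def by (metis insertI1 insertI2)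
      qed
      then show False using c'(4)[OF tr] no5 T' unfolding blocked_def by blast
    qed
  qed
qed

text \<open>Only \<open>{u, v, x, y}\<close> receives a repeated colour; any further new 4-clique is
  left to \<open>M'\<close>. A triangle with a new vertex always has a free vertex, so nothing
  becomes blocked.\<close>

lemma two_step:
  assumes st: "state X S c L M" and xy: "x \<in> V - S" "y \<in> V - S" "x \<noteq> y"
    and uv: "u \<in> S" "v \<in> S" "u \<noteq> v" "clique E {u, v, x, y}"
    and M': "M \<subseteq> M'" "M' \<subseteq> inner E (insert y (insert x S))" "matching_avoiding X M'"
    and new_hit: "\<And>Q. Q \<subseteq> insert y (insert x S) \<Longrightarrow> \<not> Q \<subseteq> S \<Longrightarrow> card Q = 4 \<Longrightarrow> clique E Q \<Longrightarrow>
      Q = {u, v, x, y} \<or> hit M' Q"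
  obtains c' where "state X (insert y (insert x S)) c' L M'"
    "blocked (insert y (insert x S)) c' L M' \<subseteq> blocked S c L M"
    "all_free S c L \<Longrightarrow> all_free (insert y (insert x S)) c' L"
    "almost_free S c L \<Longrightarrow> almost_free (insert y (insert x S)) c' L"
proof -
  have S: "S \<subseteq> V" and col: "coloured S c L" and ed: "\<exists>e\<in>E. e \<subseteq> S" and gd: "good S c M"
    using st unfolding state_def by auto
  have nS: "x \<notin> S" "y \<notin> S" using xy by auto
  let ?S = "insert y (insert x S)"
  obtain c' where c': "\<And>e. e \<in> inner E S \<Longrightarrow> c' e = c e" "coloured ?S c' L" "c' {u, x} = c' {v, y}"
    "\<And>e h. e \<in> inner E ?S - inner E S \<Longrightarrow> h \<in> inner E S \<Longrightarrow> c' e \<noteq> c h"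
    "\<And>T. triangle E ?S T \<Longrightarrow> \<not> T \<subseteq> S \<Longrightarrow> \<exists>a\<in>T. free ?S c' L T a"
    "\<And>T a b. L = {} \<Longrightarrow> triangle E ?S T \<Longrightarrow> \<not> T \<subseteq> S \<Longrightarrow> a \<in> T \<Longrightarrow> b \<in> T \<Longrightarrow> a \<noteq> b \<Longrightarrow>
      free ?S c' L T a \<or> free ?S c' L T b"
    by (rule two_step_colours[OF col S nS xy(3) uv], rule that)
  have keep: "free ?S c' L T x" if "triangle E S T" "x \<in> T" "free S c L T x" for T x
    using free_ext[OF that(3) triangle_edge(1)[OF that(1,2)] c'(1,4)] .
  show ?thesis
  proof (rule that[of c'])
    have "good ?S c' M'"
    proof (rule good_ext[OF gd M'(1) c'(1)])
      fix Q assume Q: "Q \<subseteq> ?S" "\<not> Q \<subseteq> S" "card Q = 4" "clique E Q"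
      show "hit M' Q \<or> repeats c' (inner E Q)"
      proof (cases "Q = {u, v, x, y}")
        case True
        have "{u, x} \<in> E" "{v, y} \<in> E" using cliqueD[OF uv(4)] nS uv(1,2) by blast+
        then have "{u, x} \<in> inner E Q" "{v, y} \<in> inner E Q" using True unfolding inner_def by auto
        moreover have "{u, x} \<noteq> {v, y}" using nS uv xy by (auto simp: doubleton_eq_iff)
        ultimately show ?thesis using c'(3) by (intro disjI2 bexI[of _ "{u, x}"] bexI[of _ "{v, y}"] conjI)
      next
        case False then show ?thesis using new_hit[OF Q] by blast
      qed
    qed
    then show "state X ?S c' L M'"
      unfolding state_def using S xy ed c'(2) M'(2,3) by blast
    show "blocked ?S c' L M' \<subseteq> blocked S c L M"
    proof
      fix T assume T: "T \<in> blocked ?S c' L M'"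
      then have tr: "triangle E ?S T" and nh: "\<not> hit M' T" and
        nf: "\<And>x. x \<in> T \<Longrightarrow> \<not> free ?S c' L T x" unfolding blocked_def by auto
      have "T \<subseteq> S" using c'(5)[OF tr] nf by blast
      then have "triangle E S T" using tr triangle_subset by blast
      then show "T \<in> blocked S c L M"
        unfolding blocked_def using nf keep nh hit_mono[OF _ M'(1) order_refl] by blast
    qed
    show "all_free ?S c' L" if ff: "all_free S c L"
      unfolding all_free_def
    proof (intro allI impI)
      fix T assume T: "triangle E ?S T"
      show "\<exists>x\<in>T. free ?S c' L T x"
      proof (cases "T \<subseteq> S")
        case True
        have tr: "triangle E S T" using triangle_subset[OF T True] .
        then obtain a where "a \<in> T" "free S c L T a" using ff unfolding all_free_def by blast
        then show ?thesis using keep[OF tr] by blast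
      next
        case False then show ?thesis using c'(5)[OF T] by blast
      qed
    qed
    show "almost_free ?S c' L" if af: "almost_free S c L"
      unfolding almost_free_def
    proof (intro conjI allI impI ballI)
      show L: "L = {}" using af unfolding almost_free_def by blast
      fix T a b assume T: "triangle E ?S T" "a \<in> T" "b \<in> T" "a \<noteq> b"
      show "free ?S c' L T a \<or> free ?S c' L T b"
      proof (cases "T \<subseteq> S")
        case True
        have tr: "triangle E S T" using triangle_subset[OF T(1) True] .
        then have "free S c L T a \<or> free S c L T b" using af T unfolding almost_free_def by blast
        then show ?thesis using keep[OF tr] T(2,3) by blast
      next
        case False
        then show ?thesis using c'(6)[OF L T(1) False T(2-4)] by blast
      qed
    qed
  qed
qed

lemma almost_free_blocked: "almost_free S c L \<Longrightarrow> blocked S c L M = {}"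
proof (rule ccontr)
  assume af: "almost_free S c L" and "blocked S c L M \<noteq> {}"
  then obtain T where T: "triangle E S T" "\<And>x. x \<in> T \<Longrightarrow> \<not> free S c L T x" unfolding blocked_def by blast
  then obtain p where "p \<in> T" unfolding triangle_def by (metis card.empty equals0I zero_neq_numeral)
  then obtain a b where "T = {p, a, b}" "p \<noteq> a" using triangle_three[OF T(1)] by metis
  then show False using af T unfolding almost_free_def by (metis insertI1 insertI2)
qed

lemma all_free_blocked: "all_free S c L \<Longrightarrow> blocked S c L M = {}"
  unfolding all_free_def blocked_def by blast

text \<open>An edge of \<open>M\<close> not contained in \<open>T\<close> covers at most one vertex
  of \<open>T\<close>, so \<open>M\<close> and \<open>X\<close> take away at most
  \<open>card M + card (T \<inter> X)\<close> of the three.\<close>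

lemma unhit_triangle_card:
  assumes "triangle E S T" "\<not> hit M T" "M \<subseteq> E"
  shows "3 \<le> card (T - (\<Union>M \<union> X)) + card M + card (T \<inter> X)"
proof -
  have fT: "finite T" and cT: "card T = 3" using assms(1) finite_of_card unfolding triangle_def by auto
  have fM: "finite M" using assms(3) finE finite_subset by blast
  have UN: "T \<inter> \<Union>M = (\<Union>e\<in>M. T \<inter> e)" by blast
  have "card (T \<inter> \<Union>M) \<le> (\<Sum>e\<in>M. card (T \<inter> e))"
    unfolding UN by (rule card_UN_le[OF fM])
  also have "\<dots> \<le> (\<Sum>e\<in>M. 1)"
  proof (rule sum_mono)
    fix e assume e: "e \<in> M"
    then have c2: "card e = 2" using two assms(3) by blast
    have "T \<inter> e \<subset> e" using e assms(2) unfolding hit_def by blast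
    then show "card (T \<inter> e) \<le> 1"
      using psubset_card_mono[OF finite_of_card[OF c2], of "T \<inter> e"] c2 by linarith
  qed
  finally have 1: "card (T \<inter> \<Union>M) \<le> card M" by simp
  have "T = ((T - (\<Union>M \<union> X)) \<union> (T \<inter> \<Union>M)) \<union> (T \<inter> X)" by blast
  then have "card T = card (((T - (\<Union>M \<union> X)) \<union> (T \<inter> \<Union>M)) \<union> (T \<inter> X))" by (rule arg_cong)
  then have "card T \<le> card (T - (\<Union>M \<union> X)) + card (T \<inter> \<Union>M) + card (T \<inter> X)"
    using card_Un_le[of "(T - (\<Union>M \<union> X)) \<union> (T \<inter> \<Union>M)" "T \<inter> X"]
      card_Un_le[of "T - (\<Union>M \<union> X)" "T \<inter> \<Union>M"] by linarith
  then show ?thesis using 1 cT by linarith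
qed

lemma edge_inside_triangle:
  assumes "triangle E S T" "\<not> hit M T" "M \<subseteq> E" "matching_avoiding X M" "card M + card (T \<inter> X) \<le> 1"
  obtains e where "e \<in> inner E S" "e \<subseteq> T" "e \<inter> (\<Union>M \<union> X) = {}" "matching_avoiding X (insert e M)"
proof -
  let ?F = "T - (\<Union>M \<union> X)"
  have "2 \<le> card ?F" using unhit_triangle_card[OF assms(1-3), of X] assms(5) by linarith
  then obtain B where B: "B \<subseteq> ?F" "card B = 2" by (meson obtain_subset_with_card_n)
  then obtain a b where ab: "B = {a, b}" "a \<noteq> b" by (meson card_2_iff)
  have sub: "{a, b} \<subseteq> T" using ab B by blast
  then have "{a, b} \<in> inner E S"
    using ab(2) assms(1) cliqueD[of E T a b] unfolding triangle_def inner_def by blast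
  moreover have "{a, b} \<inter> (\<Union>M \<union> X) = {}" using ab B by blast
  ultimately show ?thesis
    using that[of "{a, b}"] sub matching_avoiding_insert[OF assms(4)] by blast
qed

text \<open>As \<open>z\<close> is new to \<open>M\<close>, one remaining vertex of \<open>T\<close>
  is enough, where \<open>edge_inside_triangle\<close> needs two. In exchange only the 4-clique with
  \<open>z\<close> is hit, and \<open>T\<close> itself may stay blocked.\<close>

lemma edge_to_triangle:
  assumes "triangle E S T" "\<not> hit M T" "M \<subseteq> inner E S" "matching_avoiding X M" "card M + card (T \<inter> X) \<le> 2"
    "z \<notin> S" "z \<notin> X" "T \<subseteq> nbrs E S z"
  obtains x where "x \<in> T" "{z, x} \<in> inner E (insert z S)" "matching_avoiding X (insert {z, x} M)"
proof -
  have ME: "M \<subseteq> E" using assms(3) unfolding inner_def by blast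
  have "T - (\<Union>M \<union> X) \<noteq> {}"
    using unhit_triangle_card[OF assms(1,2) ME, of X] assms(5) by (metis add.commute add_0 card.empty le_trans not_less_eq_eq numeral_2_eq_2 numeral_3_eq_3 order_refl group_cancel.add1)
  then obtain x where x: "x \<in> T" "x \<notin> \<Union>M" "x \<notin> X" by blast
  have "z \<notin> \<Union>M" using assms(3,6) unfolding inner_def by blast
  then have "{z, x} \<inter> (\<Union>M \<union> X) = {}" using x assms(7) by blast
  moreover have "{z, x} \<in> inner E (insert z S)" using x assms(8) unfolding nbrs_def inner_def by blast
  ultimately show ?thesis using that x(1) matching_avoiding_insert[OF assms(4)] by blast
qed

lemma edge_in_triple:
  assumes "{a, b} \<in> E" "{a, d} \<in> E" "{b, d} \<in> E" "card (F \<inter> {a, b, d}) \<le> 1"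
  obtains e where "e \<in> E" "e \<subseteq> {a, b, d}" "e \<inter> F = {}"
proof -
  have d: "a \<noteq> b" "a \<noteq> d" "b \<noteq> d" using assms no_loop by blast+
  have two: "\<not> (p \<in> F \<and> q \<in> F)" if "p \<noteq> q" "p \<in> {a, b, d}" "q \<in> {a, b, d}" for p q
  proof
    assume "p \<in> F \<and> q \<in> F"
    then have "{p, q} \<subseteq> F \<inter> {a, b, d}" using that by blast
    then have "card {p, q} \<le> card (F \<inter> {a, b, d})" by (intro card_mono) auto
    then show False using that(1) assms(4) by simp
  qed
  consider "a \<in> F" | "b \<in> F" | "a \<notin> F" "b \<notin> F" by blast
  then show ?thesis
  proof cases
    case 1
    then have "b \<notin> F" "d \<notin> F" using two[of a b] two[of a d] d by auto
    then show ?thesis using that[of "{b, d}"] assms(3) by blast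
  next
    case 2
    then have "a \<notin> F" "d \<notin> F" using two[of a b] two[of b d] d by auto
    then show ?thesis using that[of "{a, d}"] assms(2) by blast
  next
    case 3 then show ?thesis using that[of "{a, b}"] assms(1) by blast
  qed
qed

lemma triangle_in_four:
  assumes "card N = 4" "triangle E S T" "T \<subseteq> N"
  obtains q where "q \<in> N" "T = N - {q}"
proof -
  have "card T = 3" using assms(2) unfolding triangle_def by blast
  then have "card (N - T) = 1"
    using assms(1) card_Diff_subset[OF finite_subset[OF assms(3) finite_of_card[OF assms(1)]] assms(3)] by simp
  then obtain q where "N - T = {q}" by (meson card_1_singletonE)
  then show ?thesis using that[of q] assms(3) by blast
qed

lemma two_triangles_card:
  assumes "triangle E S T1" "triangle E S T2" "T1 \<noteq> T2" "T1 \<subseteq> N" "T2 \<subseteq> N" "finite N"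
  shows "4 \<le> card N"
proof -
  have c: "card T1 = 3" "card T2 = 3" using assms(1,2) unfolding triangle_def by auto
  have "T1 \<noteq> N"
    using card_subset_eq[OF finite_of_card[OF c(1)], of T2] assms(3,5) c by metis
  then have "T1 \<subset> N" using assms(4) by blast
  then have "card T1 < card N" by (rule psubset_card_mono[OF assms(6)])
  then show ?thesis using c(1) by linarith
qed

text \<open>A triangle in \<open>N\<close> leaves out one vertex. \<open>T1\<close> and
  \<open>T2\<close> contain all pairs of \<open>N\<close> except that of the two vertices left out,
  and a third triangle supplies this pair. The edge \<open>{w, x}\<close> is the intersection of
  \<open>T1\<close> and \<open>T2\<close>.\<close>

lemma two_triangles_in_four:
  assumes "triangle E S T1" "triangle E S T2" "T1 \<noteq> T2" "T1 \<subseteq> N" "T2 \<subseteq> N" "card N = 4"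
  obtains w x where "w \<in> T1" "x \<in> T1" "w \<in> T2" "x \<in> T2" "w \<noteq> x"
    "\<And>T. triangle E S T \<Longrightarrow> T \<subseteq> N \<Longrightarrow> T = T1 \<or> T = T2 \<or> clique E N"
proof -
  obtain q1 where q1: "q1 \<in> N" "T1 = N - {q1}" by (rule triangle_in_four[OF assms(6,1,4)])
  obtain q2 where q2: "q2 \<in> N" "T2 = N - {q2}" by (rule triangle_in_four[OF assms(6,2,5)])
  have ne: "q1 \<noteq> q2" using assms(3) q1 q2 by blast
  have "card (N - {q1, q2}) = 2" using q1 q2 ne assms(6) finite_of_card[OF assms(6)] by simp
  then obtain w x where wx: "N - {q1, q2} = {w, x}" "w \<noteq> x" by (meson card_2_iff)
  show ?thesis
  proof (rule that[of w x])
    fix T assume T: "triangle E S T" "T \<subseteq> N"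
    obtain q where q: "q \<in> N" "T = N - {q}" by (rule triangle_in_four[OF assms(6) T])
    show "T = T1 \<or> T = T2 \<or> clique E N"
    proof (rule ccontr)
      assume neg: "\<not> ?thesis"
      then have "q \<noteq> q1" "q \<noteq> q2" using q q1 q2 by auto
      have "clique E N"
        unfolding clique_def
      proof (intro ballI impI)
        fix s t assume st: "s \<in> N" "t \<in> N" "s \<noteq> t"
        have "{s, t} \<subseteq> T \<or> {s, t} \<subseteq> T1 \<or> {s, t} \<subseteq> T2"
          using st q q1 q2 \<open>q \<noteq> q1\<close> \<open>q \<noteq> q2\<close> ne by blast
        then show "{s, t} \<in> E"
          using assms(1,2) T(1) st(3) unfolding triangle_def by (meson cliqueD insert_subset)
      qed
      then show False using neg by blast
    qed
  qed (use wx q1 q2 in auto)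
qed

text \<open>Two triangles on four vertices miss at most one edge. If this were so for all five
  vertex-deleted subgraphs, two missing edges, one of them avoiding a vertex of the other, would
  both avoid some fifth vertex.\<close>

lemma vertex_leaving_one_triangle:
  assumes "card N = 5" "\<And>Q. Q \<subseteq> N \<Longrightarrow> card Q = 4 \<Longrightarrow> \<not> clique E Q"
  shows "\<exists>a\<in>N. \<forall>T1 T2. triangle E S T1 \<longrightarrow> triangle E S T2 \<longrightarrow> T1 \<subseteq> N - {a} \<longrightarrow> T2 \<subseteq> N - {a} \<longrightarrow> T1 = T2"
proof (rule ccontr)
  assume neg: "\<not> ?thesis"
  have fN: "finite N" by (rule finite_of_card[OF assms(1)])
  have c4: "card (N - {a}) = 4" if "a \<in> N" for a using that assms(1) by simp
  have one: "f = h"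
    if a: "a \<in> N" and fh: "f \<subseteq> N - {a}" "card f = 2" "f \<notin> E" "h \<subseteq> N - {a}" "card h = 2" "h \<notin> E" for a f h
  proof -
    obtain T1 T2 where T: "triangle E S T1" "triangle E S T2" "T1 \<subseteq> N - {a}" "T2 \<subseteq> N - {a}" "T1 \<noteq> T2"
      using neg a by blast
    obtain q1 where q1: "q1 \<in> N - {a}" "T1 = N - {a} - {q1}" by (rule triangle_in_four[OF c4[OF a] T(1,3)])
    obtain q2 where q2: "q2 \<in> N - {a}" "T2 = N - {a} - {q2}" by (rule triangle_in_four[OF c4[OF a] T(2,4)])
    have eq: "g = {q1, q2}" if g: "g \<subseteq> N - {a}" "card g = 2" "g \<notin> E" for g
    proof -
      obtain s t where st: "g = {s, t}" "s \<noteq> t" using g(2) by (meson card_2_iff)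
      have "\<not> g \<subseteq> T1" "\<not> g \<subseteq> T2"
        using T(1,2) st g(3) cliqueD[of E _ s t] unfolding triangle_def by blast+
      then have "{q1, q2} \<subseteq> g" using g(1) q1(2) q2(2) by blast
      moreover have "q1 \<noteq> q2" using T(5) q1(2) q2(2) by blast
      ultimately show ?thesis using st by auto
    qed
    show ?thesis using eq[OF fh(1-3)] eq[OF fh(4-6)] by simp
  qed
  have ex: "\<exists>f\<subseteq>N - {a}. card f = 2 \<and> f \<notin> E" if a: "a \<in> N" for a
  proof -
    obtain u v where "u \<in> N - {a}" "v \<in> N - {a}" "u \<noteq> v" "{u, v} \<notin> E"
      using assms(2)[OF _ c4[OF a]] unfolding clique_def by blast
    then show ?thesis by (intro exI[of _ "{u, v}"]) auto
  qed
  obtain p where "p \<in> N" using assms(1) by fastforce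
  then obtain f where f: "f \<subseteq> N - {p}" "card f = 2" "f \<notin> E" using ex by blast
  obtain x where x: "x \<in> f" using f(2) by fastforce
  then obtain h where h: "h \<subseteq> N - {x}" "card h = 2" "h \<notin> E" using ex f(1) by blast
  have "card (f \<union> h) \<le> 4" using card_Un_le[of f h] f(2) h(2) by simp
  then have "f \<union> h \<noteq> N" using assms(1) by auto
  then obtain b where "b \<in> N" "b \<notin> f \<union> h" using f(1) h(1) by blast
  then have "f = h" using f h by (intro one[of b]) auto
  then show False using x h(1) by blast
qed

end

section \<open>Joining two vertices along an edge\<close>

context k4_component
begin

lemma surplus_V_le:
  assumes "S \<subseteq> V" "\<exists>e\<in>E. e \<subseteq> S"
  shows "surplus E V \<le> surplus E S"
proof -
  obtain e where "e \<in> E" "e \<subseteq> S" using assms(2) by blast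
  then show ?thesis by (rule surplus_mono[OF assms(1)])
qed

lemma candidate_surplus:
  assumes "S \<subseteq> V" "\<exists>e\<in>E. e \<subseteq> S" "candidate S z T"
  shows "surplus E (insert z S) = surplus E S + 5 - 2 * int (card (nbrs E S z))"
    and "surplus E V \<le> surplus E (insert z S)" and "3 \<le> card (nbrs E S z)"
proof -
  have z: "z \<in> V - S" "triangle E S T" "T \<subseteq> nbrs E S z" using assms(3) unfolding candidate_def by auto
  show "surplus E (insert z S) = surplus E S + 5 - 2 * int (card (nbrs E S z))"
    using surplus_insert finS[OF assms(1)] z(1) by blast
  show "surplus E V \<le> surplus E (insert z S)"
    using z(1) assms(1,2) by (intro surplus_V_le) auto
  show "3 \<le> card (nbrs E S z)" by (rule nbrs_ge3[OF assms(1,3)])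
qed

text \<open>A new 4-clique with a single new vertex would make this vertex a candidate.\<close>

lemma new_clique_two:
  assumes "\<not> (\<exists>z T. candidate S z T)" "x \<in> V - S" "y \<in> V - S"
    and Q: "Q \<subseteq> insert y (insert x S)" "\<not> Q \<subseteq> S" "card Q = 4" "clique E Q"
  obtains p q where "Q = {p, q, x, y}" "p \<noteq> q" "{p, q} \<in> E" "{p, q} \<subseteq> nbrs E S x \<inter> nbrs E S y"
proof -
  have notone: False if "Q \<subseteq> insert z S" "z \<in> V - S" for z
  proof -
    have "z \<notin> S" using that(2) by blast
    note nt = new_clique_triangle[OF that(1) Q(2-4) this]
    show False using assms(1) nt(2,3) that(2) unfolding candidate_def by blast
  qed
  have "x \<in> Q" "y \<in> Q" using notone[of y] notone[of x] Q(1) assms(2,3) by blast+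
  have "x \<noteq> y" using notone[of x] Q(1) assms(2) by blast
  have "card (Q - {x, y}) = 2"
    using \<open>x \<in> Q\<close> \<open>y \<in> Q\<close> \<open>x \<noteq> y\<close> Q(3) finite_of_card[OF Q(3)] by (simp add: card_Diff_subset)
  then obtain p q where pq: "Q - {x, y} = {p, q}" "p \<noteq> q" by (meson card_2_iff)
  have pqQ: "p \<in> Q" "q \<in> Q" "p \<in> S" "q \<in> S" "p \<noteq> x" "p \<noteq> y" "q \<noteq> x" "q \<noteq> y"
    using pq Q(1) by blast+
  show ?thesis
  proof (rule that[of p q])
    show "Q = {p, q, x, y}" using pq \<open>x \<in> Q\<close> \<open>y \<in> Q\<close> by blast
    show "{p, q} \<in> E" using cliqueD[OF Q(4) pqQ(1,2) pq(2)] .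
    show "{p, q} \<subseteq> nbrs E S x \<inter> nbrs E S y"
      using cliqueD[OF Q(4) \<open>x \<in> Q\<close> pqQ(1)] cliqueD[OF Q(4) \<open>x \<in> Q\<close> pqQ(2)]
        cliqueD[OF Q(4) \<open>y \<in> Q\<close> pqQ(1)] cliqueD[OF Q(4) \<open>y \<in> Q\<close> pqQ(2)] pqQ
      unfolding nbrs_def by blast
  qed (rule pq(2))
qed

text \<open>If \<open>{u, v, x, y}\<close> is not the only new 4-clique, then \<open>x\<close> and
  \<open>y\<close> have at least three common neighbours in \<open>S\<close>. The surplus drops by
  at least 2 * 3 + 2 * 3 - 8 = 4, which pays for one edge of \<open>M\<close>, and one edge can be
  chosen to hit all new 4-cliques.\<close>

lemma two_step_free:
  assumes st: "state X S c L M" and s8: "surplus E S \<le> 8" and V1: "1 \<le> surplus E V"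
    and X: "admissible_roots X"
    and M0: "X \<noteq> {} \<Longrightarrow> 7 \<le> surplus E S \<Longrightarrow> M = {}"
    and xy: "x \<in> V - S" "y \<in> V - S" "x \<noteq> y"
    and uv: "u \<in> S" "v \<in> S" "u \<noteq> v" "clique E {u, v, x, y}"
    and nc: "\<not> (\<exists>z T. candidate S z T)"
  defines "S' \<equiv> insert y (insert x S)"
  obtains c' M' where "state X S' c' L M'" "blocked S' c' L M' \<subseteq> blocked S c L M"
    "all_free S c L \<Longrightarrow> all_free S' c' L" "almost_free S c L \<Longrightarrow> almost_free S' c' L"
    "surplus E S' \<le> surplus E S"
    "M' = M \<or> (\<exists>e. M' = insert e M) \<and> surplus E S' \<le> surplus E S - 4"
proof -
  have S: "S \<subseteq> V" and ed: "\<exists>e\<in>E. e \<subseteq> S" and MS: "M \<subseteq> inner E S" and mM: "matching_avoiding X M"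
    using st unfolding state_def by auto
  have fS: "finite S" by (rule finS[OF S])
  let ?W = "nbrs E S x \<inter> nbrs E S y"
  have exy: "{x, y} \<in> E" using cliqueD[OF uv(4)] xy(3) by blast
  have sS': "surplus E S' = surplus E S + 8 - 2 * int (card (nbrs E S x)) - 2 * int (card (nbrs E S y))"
    unfolding S'_def using surplus_insert2[of x S y] xy exy fS by blast
  have VS': "surplus E V \<le> surplus E S'"
    unfolding S'_def using xy S ed by (intro surplus_V_le) auto
  have fN: "finite (nbrs E S x)" "finite (nbrs E S y)" using fS unfolding nbrs_def by auto
  have n2: "2 \<le> card (nbrs E S x)" "2 \<le> card (nbrs E S y)"
    using nbrs_ge2[OF S uv(1-3), of x y] nbrs_ge2[OF S uv(1-3), of y x] uv(4) xy(1,2)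
    by (auto simp: insert_commute)
  have SS': "S \<subseteq> S'" unfolding S'_def by blast
  have MS': "M \<subseteq> inner E S'" using MS inner_mono[OF SS'] by blast
  show ?thesis
  proof (cases "\<forall>Q. Q \<subseteq> S' \<longrightarrow> \<not> Q \<subseteq> S \<longrightarrow> card Q = 4 \<longrightarrow> clique E Q \<longrightarrow> Q = {u, v, x, y}")
    case True
    then have "Q = {u, v, x, y} \<or> hit M Q"
      if "Q \<subseteq> insert y (insert x S)" "\<not> Q \<subseteq> S" "card Q = 4" "clique E Q" for Q
      using that unfolding S'_def by blast
    then obtain c' where c': "state X S' c' L M" "blocked S' c' L M \<subseteq> blocked S c L M"
      "all_free S c L \<Longrightarrow> all_free S' c' L" "almost_free S c L \<Longrightarrow> almost_free S' c' L"
      using two_step[OF st xy uv order_refl MS'[unfolded S'_def] mM] unfolding S'_def by metis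
    show ?thesis by (rule that[OF c']) (use sS' n2 in auto)
  next
    case False
    then obtain Q where Q: "Q \<subseteq> insert y (insert x S)" "\<not> Q \<subseteq> S" "card Q = 4" "clique E Q" "Q \<noteq> {u, v, x, y}"
      unfolding S'_def by blast
    obtain p q where pq: "Q = {p, q, x, y}" "p \<noteq> q" "{p, q} \<in> E" "{p, q} \<subseteq> ?W"
      by (rule new_clique_two[OF nc xy(1,2) Q(1-4)], rule that)
    have uvW: "{u, v} \<subseteq> ?W"
      using uv xy cliqueD[OF uv(4), of x u] cliqueD[OF uv(4), of x v] cliqueD[OF uv(4), of y u]
        cliqueD[OF uv(4), of y v] unfolding nbrs_def by auto
    have ne: "{p, q} \<noteq> {u, v}" using Q(5) pq(1) by auto
    have fW: "finite ?W" using fN by blast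
    have cW: "3 \<le> card ?W"
    proof (rule ccontr)
      assume "\<not> ?thesis"
      then have c2: "card ?W \<le> 2" by simp
      have "{p, q} = ?W" using card_seteq[OF fW pq(4)] c2 pq(2) by simp
      moreover have "{u, v} = ?W" using card_seteq[OF fW uvW] c2 uv(3) by simp
      ultimately show False using ne by blast
    qed
    have le: "card ?W \<le> card (nbrs E S x)" "card ?W \<le> card (nbrs E S y)"
      using fN by (auto intro: card_mono)
    then have drop: "surplus E S' \<le> surplus E S - 4" using sS' cW by linarith
    \<comment> \<open>Four common neighbours would cost eight units and bring the surplus below
      1.\<close>
    have c3: "card ?W = 3" using sS' VS' V1 s8 cW le by linarith
    \<comment> \<open>The edge \<open>{x, y}\<close> lies in every new 4-clique and serves unless
      one of its ends is the root.\<close>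
    obtain e where e: "e \<in> inner E S'" "e \<inter> (\<Union>M \<union> X) = {}"
      "\<And>Q. Q \<subseteq> S' \<Longrightarrow> \<not> Q \<subseteq> S \<Longrightarrow> card Q = 4 \<Longrightarrow> clique E Q \<Longrightarrow> e \<subseteq> Q"
    proof (cases "x \<in> X \<or> y \<in> X")
      case False
      show ?thesis
      proof (rule that[of "{x, y}"])
        show "{x, y} \<in> inner E S'" using exy unfolding inner_def S'_def by blast
        show "{x, y} \<inter> (\<Union>M \<union> X) = {}" using False MS xy unfolding inner_def by blast
        fix Q assume Q: "Q \<subseteq> S'" "\<not> Q \<subseteq> S" "card Q = 4" "clique E Q"
        obtain p q where "Q = {p, q, x, y}"
          by (rule new_clique_two[OF nc xy(1,2) Q[unfolded S'_def]], rule that)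
        then show "{x, y} \<subseteq> Q" by blast
      qed
    next
      case True
      then obtain r where r: "X = {r}" "3 \<le> surplus E V" using X by blast
      \<comment> \<open>The surplus is still at least 3 after a drop of four, so it was at least
        7.\<close>
      then have M: "M = {}" using M0 drop VS' by fastforce
      obtain w where w: "?W = {p, q, w}" "w \<noteq> p" "w \<noteq> q"
      proof -
        have "card (?W - {p, q}) = 1"
          using c3 pq(2,4) fW card_Diff_subset[of "{p, q}" ?W] by simp
        then obtain w where "?W - {p, q} = {w}" by (meson card_1_singletonE)
        then show ?thesis using that[of w] pq(4) by blast
      qed
      have "{u, v} \<inter> {p, q} \<noteq> {}"
        using uvW w uv(3) ne by auto
      then obtain d where d: "d \<in> {u, v}" "d \<in> {p, q}" by blast
      \<comment> \<open>With all three edges, the three common neighbours would be a triangle seen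
        by \<open>x\<close>. So the edges among them are only \<open>{u, v}\<close> and
        \<open>{p, q}\<close>, and both contain \<open>d\<close>.\<close>
      have dp: "d \<in> f" if f: "f \<subseteq> ?W" "f \<in> E" for f
      proof (rule ccontr)
        assume nd: "d \<notin> f"
        obtain p' where p': "{p, q} = {d, p'}" "p' \<noteq> d" using d(2) pq(2) by auto
        obtain u' where u': "{u, v} = {d, u'}" "u' \<noteq> d" using d(1) uv(3) by auto
        have "p' \<noteq> u'" using ne p' u' by auto
        have W3: "?W = {d, p', u'}"
        proof -
          have "{d, p', u'} \<subseteq> ?W" using p' u' uvW pq(4) by blast
          moreover have "card {d, p', u'} = 3" using p' u' \<open>p' \<noteq> u'\<close> by simp
          ultimately show ?thesis using card_subset_eq[OF fW] c3 by metis
        qed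
        have "f \<subseteq> {p', u'}" using f(1) nd unfolding W3 by auto
        then have fe: "f = {p', u'}"
          using card_subset_eq[of "{p', u'}" f] two[OF f(2)] \<open>p' \<noteq> u'\<close> by simp
        have "{d, p'} \<in> E" using pq(3) p' by simp
        moreover have "{u, v} \<in> E" by (rule cliqueD[OF uv(4)]) (use uv in auto)
        then have "{d, u'} \<in> E" using u' by simp
        ultimately have "clique E {d, p', u'}"
          using f(2) unfolding fe clique_def by (auto simp: insert_commute)
        then have "triangle E S ?W" using W3 c3 unfolding triangle_def nbrs_def by auto
        then have "candidate S x ?W" using xy(1) unfolding candidate_def by blast
        then show False using nc by blast
      qed
      have dW: "d \<in> ?W" using d uvW by blast
      then have dS: "d \<in> S" "{x, d} \<in> E" "{y, d} \<in> E" unfolding nbrs_def by auto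
      define w where "w = (if x \<in> X then y else x)"
      have wX: "w \<notin> X" "w \<in> {x, y}" using r xy(3) unfolding w_def by auto
      have dX: "d \<notin> X" using True r xy dS by blast
      show ?thesis
      proof (rule that[of "{w, d}"])
        show "{w, d} \<in> inner E S'" using dS wX(2) unfolding inner_def S'_def by auto
        show "{w, d} \<inter> (\<Union>M \<union> X) = {}" using M wX dX by auto
        fix Q assume Q: "Q \<subseteq> S'" "\<not> Q \<subseteq> S" "card Q = 4" "clique E Q"
        obtain p q where pq: "Q = {p, q, x, y}" "p \<noteq> q" "{p, q} \<in> E" "{p, q} \<subseteq> ?W"
          by (rule new_clique_two[OF nc xy(1,2) Q[unfolded S'_def]], rule that)
        have "d \<in> {p, q}" using dp[OF pq(4,3)] .
        then show "{w, d} \<subseteq> Q" using wX(2) pq(1) by blast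
      qed
    qed
    define M' where "M' = insert e M"
    have M': "M \<subseteq> M'" "M' \<subseteq> inner E S'" "matching_avoiding X M'"
      unfolding M'_def using MS' e(1) matching_avoiding_insert[OF mM e(2)] by auto
    have "Q = {u, v, x, y} \<or> hit M' Q"
      if "Q \<subseteq> insert y (insert x S)" "\<not> Q \<subseteq> S" "card Q = 4" "clique E Q" for Q
      using e(3) that unfolding S'_def hit_def M'_def by blast
    then obtain c' where c': "state X S' c' L M'" "blocked S' c' L M' \<subseteq> blocked S c L M"
      "all_free S c L \<Longrightarrow> all_free S' c' L" "almost_free S c L \<Longrightarrow> almost_free S' c' L"
      using two_step[OF st xy uv M'[unfolded S'_def]] unfolding S'_def by metis
    show ?thesis by (rule that[OF c']) (use drop M'_def in auto)
  qed
qed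

end

lemma hitI: "e \<in> M \<Longrightarrow> e \<subseteq> Q \<Longrightarrow> hit M Q"
  unfolding hit_def by blast

section \<open>Joining one vertex in the absence of 5-cliques\<close>

context k4_component
begin

text \<open>Every joined vertex lowers the surplus by at least one, starting from 8. The second disjunct says
  that enough has been spent to pay two units per edge of \<open>M\<close> and one per blocked triangle; in the
  last one the surplus is minimal and no vertex can be joined any more.\<close>

definition inv_free :: "'a set \<Rightarrow> ('a set \<Rightarrow> nat) \<Rightarrow> 'a set set \<Rightarrow> 'a set set \<Rightarrow> bool" where
  "inv_free S c L M \<longleftrightarrow> surplus E S \<le> 8 \<and> (M \<noteq> {} \<longrightarrow> surplus E S \<le> 5) \<and>
     (M = {} \<and> almost_free S c L \<or>
      2 * int (card M) + int (card (blocked S c L M)) + 1 \<le> 8 - surplus E S \<or>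
      surplus E S \<le> surplus E V)"

lemma card_le_blocked:
  assumes "B \<subseteq> blocked S c L M" "finite S"
  shows "card B \<le> card (blocked S c L M)"
  by (rule card_mono[OF finite_blocked[OF assms(2)] assms(1)])

text \<open>What matters is how many triangles seen by \<open>z\<close> are missed by
  \<open>M\<close>. A single one with a free vertex takes a leaf step, and the triangle this may
  block is paid for by the drop of at least one; a single blocked one takes an edge of
  \<open>M\<close>. Two of them require at least four neighbours, hence a drop of at least three,
  which buys an edge of \<open>M\<close> hitting both or, with five neighbours, up to two
  edges.\<close>

lemma one_step_free:
  assumes no5: "\<not> has_five_clique"
    and st: "state X S c L M" and iv: "inv_free S c L M" and cand: "candidate S z T"
    and V1: "1 \<le> surplus E V" and X: "admissible_roots X"
    and cond: "surplus E S \<le> 7 \<or> card (nbrs E S z) = 3"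
  shows "\<exists>c' L' M'. state X (insert z S) c' L' M' \<and> inv_free (insert z S) c' L' M'"
proof -
  have S: "S \<subseteq> V" and ed: "\<exists>e\<in>E. e \<subseteq> S" and MS: "M \<subseteq> inner E S" and mM: "matching_avoiding X M"
    using st unfolding state_def by auto
  have ME: "M \<subseteq> E" using MS unfolding inner_def by blast
  have finM: "finite M" using ME finE finite_subset by blast
  have fS: "finite S" by (rule finS[OF S])
  have z: "z \<in> V - S" and zS: "z \<notin> S" using cand unfolding candidate_def by auto
  let ?N = "nbrs E S z" and ?S = "insert z S"
  have fN: "finite ?N" using fS unfolding nbrs_def by auto
  note cs = candidate_surplus[OF S ed cand]
  define s t k m b where "s = surplus E S" and "t = surplus E V" and "k = int (card ?N)"
    and "m = int (card M)" and "b = int (card (blocked S c L M))"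
  have s': "surplus E ?S = s + 5 - 2 * k" and ts: "t \<le> s + 5 - 2 * k" and k3: "3 \<le> k"
    using cs unfolding s_def t_def k_def by auto
  have s8: "s \<le> 8" using iv unfolding inv_free_def s_def by blast
  have m0: "0 \<le> m" "0 \<le> b" unfolding m_def b_def by auto
  have D: "M = {} \<and> almost_free S c L \<and> b = 0 \<and> m = 0 \<or> 2 * m + b + 1 \<le> 8 - s"
    using iv ts k3 almost_free_blocked[of S c L M] unfolding inv_free_def m_def b_def s_def t_def by auto
  have MS': "M \<subseteq> inner E ?S" using MS inner_mono[of S ?S] by blast
  have Mne: "M \<noteq> {} \<Longrightarrow> s \<le> 5" using iv unfolding inv_free_def s_def by blast
  have cardins: "int (card (insert e M)) \<le> m + 1" for e unfolding m_def using card_insert_le_m1 finM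
    by (simp add: card_insert_if)
  have invI: "inv_free ?S c' L' M'"
    if "M' = {} \<or> s + 5 - 2 * k \<le> 5"
      "M' = {} \<and> almost_free ?S c' L' \<or>
       2 * int (card M') + int (card (blocked ?S c' L' M')) + 1 \<le> 8 - (s + 5 - 2 * k) \<or> s + 5 - 2 * k \<le> t"
    for c' L' M'
    unfolding inv_free_def s' t_def[symmetric] using that s8 k3 by auto
  have Mne': "M = {} \<or> s + 5 - 2 * k \<le> 5" using Mne k3 by (cases "M = {}") auto
  have add: ?thesis
    if M': "M \<subseteq> M'" "M' \<subseteq> inner E ?S" "matching_avoiding X M'"
      and all: "\<And>T. triangle E S T \<Longrightarrow> T \<subseteq> ?N \<Longrightarrow> hit M' (insert z T)"
      and ok: "\<And>c'. blocked ?S c' L M' \<subseteq> blocked S c L M \<Longrightarrow> int (card (blocked ?S c' L M')) \<le> b \<Longrightarrow>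
        almost_free S c L \<longrightarrow> almost_free ?S c' L \<Longrightarrow> inv_free ?S c' L M'" for M'
  proof -
    obtain c' where c': "state X ?S c' L M'" "blocked ?S c' L M' \<subseteq> blocked S c L M"
      "all_free S c L \<Longrightarrow> all_free ?S c' L" "almost_free S c L \<Longrightarrow> almost_free ?S c' L"
      by (rule plain_step[OF st z M' all], assumption+, rule that)
    have "int (card (blocked ?S c' L M')) \<le> b"
      unfolding b_def using card_le_blocked[OF c'(2) fS] by simp
    then show ?thesis using c'(1) ok[OF c'(2)] c'(4) by blast
  qed
  define U where "U = {T. triangle E S T \<and> T \<subseteq> ?N \<and> \<not> hit M T}"
  have hitU: "hit M' (insert z T')" if "triangle E S T'" "T' \<subseteq> ?N" "T' \<notin> U" "M \<subseteq> M'" for T' M'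
    using that hit_mono[of M T' M' "insert z T'"] unfolding U_def by blast
  consider (none) "U = {}" | (one) T0 where "U = {T0}" | (more) T1 T2 where "T1 \<in> U" "T2 \<in> U" "T1 \<noteq> T2"
    by blast
  then show ?thesis
  proof cases
    case none
    show ?thesis
    proof (rule add[OF order_refl MS' mM])
      show "hit M (insert z T)" if "triangle E S T" "T \<subseteq> ?N" for T
        using hitU[OF that _ order_refl] none by blast
      fix c' assume "int (card (blocked ?S c' L M)) \<le> b" "almost_free S c L \<longrightarrow> almost_free ?S c' L"
      then show "inv_free ?S c' L M" using D k3 by (intro invI[OF Mne']) (auto simp: m_def)
    qed
  next
    case (one T0)
    then have T0: "triangle E S T0" "T0 \<subseteq> ?N" "\<not> hit M T0" unfolding U_def by auto
    have rest: "hit M' (insert z T')" if "triangle E S T'" "T' \<subseteq> ?N" "T' \<noteq> T0" "M \<subseteq> M'" for T' M'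
      using hitU[OF that(1,2) _ that(4)] one that(3) by blast
    show ?thesis
    proof (cases "T0 \<in> blocked S c L M")
      case False
      then obtain x where x: "x \<in> T0" "free S c L T0 x" using T0 unfolding blocked_def by blast
      obtain c' L' where c': "state X ?S c' L' M"
        "\<not> has_five_clique \<Longrightarrow> blocked ?S c' L' M \<subseteq> insert T0 (blocked S c L M)"
        "\<not> has_five_clique \<Longrightarrow> almost_free S c L \<Longrightarrow> blocked ?S c' L' M = {}"
        by (rule leaf_step[OF st z order_refl MS' mM T0(1,2) x(1,2) rest[OF _ _ _ order_refl]], assumption+, rule that)
      have fb: "finite (blocked S c L M)" by (rule finite_blocked[OF fS])
      have "card (blocked ?S c' L' M) \<le> card (insert T0 (blocked S c L M))"
        using c'(2)[OF no5] fb by (intro card_mono) auto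
      then have "int (card (blocked ?S c' L' M)) \<le> b + 1"
        unfolding b_def using fb by (simp add: card_insert_if split: if_splits)
      \<comment> \<open>The first drop may be just one unit, which the \<open>+ 1\<close> in
        \<open>inv_free\<close> already uses up; so it matters that the first leaf step blocks
        nothing.\<close>
      moreover have "almost_free S c L \<Longrightarrow> card (blocked ?S c' L' M) = 0" using c'(3)[OF no5] by simp
      ultimately have "2 * m + int (card (blocked ?S c' L' M)) + 1 \<le> 8 - (s + 5 - 2 * k)"
        using D k3 s8 by auto
      then have "inv_free ?S c' L' M"
        by (intro invI[OF Mne']) (auto simp: m_def)
      then show ?thesis using c'(1) by blast
    next
      case True
      have fb: "finite (blocked S c L M)" by (rule finite_blocked[OF fS])
      have b1: "1 \<le> b"
      proof -
        have "card (blocked S c L M) \<noteq> 0" using True fb by auto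
        then show ?thesis unfolding b_def by linarith
      qed
      then have D2: "2 * m + b + 1 \<le> 8 - s" using D by linarith
      define q where "q = card (T0 \<inter> X)"
      have q1: "q \<le> 1" unfolding q_def using X card_mono[of X "T0 \<inter> X"] by auto
      show ?thesis
      proof (cases "card M + q \<le> 1")
        case True
        \<comment> \<open>An edge inside \<open>T0\<close> unblocks \<open>T0\<close>, so one of the
          two units it costs is returned.\<close>
        obtain e where e: "e \<in> inner E S" "e \<subseteq> T0" "e \<inter> (\<Union>M \<union> X) = {}" "matching_avoiding X (insert e M)"
          by (rule edge_inside_triangle[OF T0(1,3) ME mM True[unfolded q_def]], rule that)
        have hT0: "hit (insert e M) T0" using e(2) by (intro hitI[of e]) auto
        have all: "hit (insert e M) (insert z T')" if "triangle E S T'" "T' \<subseteq> ?N" for T'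
          using rest[OF that] hit_mono[OF hT0 order_refl] by (cases "T' = T0") blast+
        have M': "M \<subseteq> insert e M" "insert e M \<subseteq> inner E ?S"
          using MS' e(1) inner_mono[of S ?S] by auto
        show ?thesis
        proof (rule add[OF M' e(4) all])
          fix c' assume "blocked ?S c' L (insert e M) \<subseteq> blocked S c L M"
          then have "blocked ?S c' L (insert e M) \<subseteq> blocked S c L M - {T0}"
            using hT0 unfolding blocked_def by blast
          then have "card (blocked ?S c' L (insert e M)) \<le> card (blocked S c L M - {T0})"
            using fb by (intro card_mono) auto
          then have "int (card (blocked ?S c' L (insert e M))) \<le> b - 1"
            unfolding b_def using fb \<open>T0 \<in> blocked S c L M\<close> b1 b_def by (simp add: of_nat_diff)
          then have "2 * int (card (insert e M)) + int (card (blocked ?S c' L (insert e M))) + 1 \<le> 8 - (s + 5 - 2 * k)"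
            using D2 k3 cardins[of e] by linarith
          then show "inv_free ?S c' L (insert e M)"
            using D2 b1 m0 k3 by (intro invI) linarith+
        qed
      next
        case False
        \<comment> \<open>In this case the budget leaves a single unit: the step brings the surplus
          down to that of \<open>V\<close>, the last disjunct of \<open>inv_free\<close>, and
          nothing need be saved for later.\<close>
        have fin: "card M + q = 2 \<and> z \<notin> X \<and> surplus E ?S \<le> surplus E V"
        proof (cases "X = {}")
          case True
          then have "q = 0" unfolding q_def by simp
          then show ?thesis using False D2 b1 ts k3 V1 True s' unfolding m_def t_def by auto
        next
          case F: False
          then obtain r where r: "X = {r}" "3 \<le> t" using X unfolding t_def by blast
          then have "m \<le> 1" using D2 b1 ts k3 by linarith
          then have q: "q = 1" "m = 1" using False q1 unfolding m_def by linarith+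
          then have "r \<in> T0" unfolding q_def r(1) by (cases "r \<in> T0") auto
          then have "z \<notin> X" using T0(1) zS r unfolding triangle_def by blast
          then show ?thesis using q D2 b1 ts k3 r(2) s' unfolding m_def t_def by auto
        qed
        then have le2: "card M + card (T0 \<inter> X) \<le> 2" and zX: "z \<notin> X" unfolding q_def by auto
        obtain x where x: "x \<in> T0" "{z, x} \<in> inner E ?S" "matching_avoiding X (insert {z, x} M)"
          by (rule edge_to_triangle[OF T0(1,3) MS mM le2 zS zX T0(2)], rule that)
        have all: "hit (insert {z, x} M) (insert z T')" if "triangle E S T'" "T' \<subseteq> ?N" for T'
        proof (cases "T' = T0")
          case True then show ?thesis using x(1) by (intro hitI[of "{z, x}"]) auto
        next
          case False then show ?thesis using rest[OF that] by blast
        qed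
        have M': "M \<subseteq> insert {z, x} M" "insert {z, x} M \<subseteq> inner E ?S" using MS' x(2) by auto
        show ?thesis
          by (rule add[OF M' x(3) all], assumption+, rule invI) (use fin s' t_def D2 b1 m0 k3 in auto)
      qed
    qed
  next
    case (more T1 T2)
    then have T12: "triangle E S T1" "triangle E S T2" "T1 \<subseteq> ?N" "T2 \<subseteq> ?N" "\<not> hit M T1" "\<not> hit M T2"
      unfolding U_def by auto
    have "4 \<le> card ?N" by (rule two_triangles_card[OF T12(1,2) more(3) T12(3,4) fN])
    then have k4: "4 \<le> k" unfolding k_def by linarith
    then have s7: "s \<le> 7" using cond unfolding s_def k_def by auto
    have clN: "\<not> clique E Q" if "Q \<subseteq> ?N" "card Q = 4" for Q
    proof
      assume cl: "clique E Q"
      have "clique E (insert z Q)" using that(1) by (intro clique_insert[OF cl]) (auto simp: nbrs_def)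
      moreover have "card (insert z Q) = 5"
        using that zS finite_of_card[OF that(2)] by (subst card_insert_disjoint) (auto simp: nbrs_def)
      ultimately show False using no5 by blast
    qed
    \<comment> \<open>Six neighbours cost seven units, but from surplus at most 7 only six can be
      spent. Surplus 8 is excluded by \<open>cond\<close>.\<close>
    have "k < 6" using ts s7 V1 unfolding t_def by linarith
    then consider "k = 4" | "k = 5" using k4 by linarith
    then show ?thesis
    proof cases
      case 1
      then have cN: "card ?N = 4" unfolding k_def by simp
      obtain w x where wx: "w \<in> T1" "x \<in> T1" "w \<in> T2" "x \<in> T2" "w \<noteq> x"
        "\<And>T. triangle E S T \<Longrightarrow> T \<subseteq> ?N \<Longrightarrow> T = T1 \<or> T = T2 \<or> clique E ?N"
        by (rule two_triangles_in_four[OF T12(1,2) more(3) T12(3,4) cN], rule that)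
      have wxS: "w \<in> S" "x \<in> S" using wx T12(1) unfolding triangle_def by auto
      have wxE: "{w, x} \<in> E" using wx T12(1) unfolding triangle_def by (auto intro: cliqueD)
      have zwx: "{z, w} \<in> E" "{z, x} \<in> E" using wx T12(3) unfolding nbrs_def by auto
      \<comment> \<open>Four neighbours cost three units; this and the final surplus leave room for
        at most one earlier edge of \<open>M\<close>, and for none if there is a root. That edge
        cannot contain both \<open>w\<close> and \<open>x\<close>, since it would hit
        \<open>T1\<close>.\<close>
      have few: "card ((\<Union>M \<union> X) \<inter> {z, w, x}) \<le> 1"
      proof (cases "X = {}")
        case True
        have "m \<le> 1" using D ts 1 V1 m0 unfolding t_def by linarith
        then consider "M = {}" | f where "M = {f}"
        proof (cases "card M = 0")
          case True then show ?thesis using finM that(1) by simp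
        next
          case False
          then have "card M = 1" using \<open>m \<le> 1\<close> unfolding m_def by linarith
          then show ?thesis using that(2) card_1_singletonE by blast
        qed
        then show ?thesis
        proof cases
          case 1 then show ?thesis using True by simp
        next
          case (2 f)
          have "z \<notin> f" using 2 MS zS unfolding inner_def by blast
          moreover have "\<not> {w, x} \<subseteq> f"
          proof
            assume "{w, x} \<subseteq> f"
            moreover have "card f = 2" using 2 ME two by blast
            ultimately have "f = {w, x}" using wx(5) card_subset_eq[of f "{w, x}"] finite_of_card[of f] by simp
            then have "hit M T1" using 2 wx by (intro hitI[of f]) auto
            then show False using T12 by blast
          qed
          ultimately have "f \<inter> {z, w, x} \<subseteq> {w} \<or> f \<inter> {z, w, x} \<subseteq> {x}" by auto
          then have "card (f \<inter> {z, w, x}) \<le> 1"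
            using card_mono[of "{w}" "f \<inter> {z, w, x}"] card_mono[of "{x}" "f \<inter> {z, w, x}"] by auto
          then show ?thesis using 2 True by simp
        qed
      next
        case False
        then obtain r where r: "X = {r}" "3 \<le> t" using X unfolding t_def by blast
        then have "m = 0" using D ts 1 m0 by linarith
        then have "M = {}" unfolding m_def using finM by simp
        then show ?thesis using r card_mono[of "{r}" "{r} \<inter> {z, w, x}"] by simp
      qed
      obtain e where e: "e \<in> E" "e \<subseteq> {z, w, x}" "e \<inter> (\<Union>M \<union> X) = {}"
        by (rule edge_in_triple[OF zwx wxE few], rule that)
      have M': "M \<subseteq> insert e M" "insert e M \<subseteq> inner E ?S" "matching_avoiding X (insert e M)"
        using MS' e wxS matching_avoiding_insert[OF mM e(3)] unfolding inner_def by auto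
      have all: "hit (insert e M) (insert z T')" if "triangle E S T'" "T' \<subseteq> ?N" for T'
      proof -
        have "T' = T1 \<or> T' = T2" using wx(6)[OF that] clN[OF order_refl cN] by blast
        then have "e \<subseteq> insert z T'" using e(2) wx by auto
        then show ?thesis by (intro hitI[of e]) auto
      qed
      show ?thesis
      proof (rule add[OF M' all])
        fix c' assume "int (card (blocked ?S c' L (insert e M))) \<le> b"
        then have "2 * int (card (insert e M)) + int (card (blocked ?S c' L (insert e M))) + 1 \<le> 8 - (s + 5 - 2 * k)"
          using D 1 s7 cardins[of e] by linarith
        then show "inv_free ?S c' L (insert e M)" using 1 s7 by (intro invI) linarith+
      qed
    next
      case 2
      then have cN: "card ?N = 5" unfolding k_def by simp
      \<comment> \<open>Five neighbours cost five units: the surplus falls from 6 or 7 to 1 or 2.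
        This excludes a root, and hardly anything can have been spent before.\<close>
      have "t < 3" "6 \<le> s" using ts s7 V1 2 unfolding t_def by linarith+
      then have Xe: "X = {}" and mz: "m = 0" and b2: "b \<le> 1" using X D m0 unfolding t_def by auto
      then have Me: "M = {}" unfolding m_def using finM by simp
      \<comment> \<open>The edge \<open>{z, a}\<close> hits all new 4-cliques through
        \<open>a\<close>. At most one triangle remains; it takes a leaf step or a second edge of
        \<open>M\<close>.\<close>
      obtain a where a: "a \<in> ?N"
        "\<And>T1 T2. triangle E S T1 \<Longrightarrow> triangle E S T2 \<Longrightarrow> T1 \<subseteq> ?N - {a} \<Longrightarrow> T2 \<subseteq> ?N - {a} \<Longrightarrow> T1 = T2"
        using vertex_leaving_one_triangle[OF cN clN, of S] by metis
      let ?f = "{z, a}"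
      have f: "?f \<in> inner E ?S" "a \<in> S" using a(1) unfolding nbrs_def inner_def by auto
      have M0: "M \<subseteq> {?f}" "{?f} \<subseteq> inner E ?S" "matching_avoiding X {?f}"
        using Me f Xe unfolding matching_avoiding_def by auto
      have hita: "hit M' (insert z T')" if "a \<in> T'" "?f \<in> M'" for T' M'
        using that by (intro hitI[of ?f]) auto
      show ?thesis
      proof (cases "\<exists>T. triangle E S T \<and> T \<subseteq> ?N - {a}")
        case False
        have all: "hit {?f} (insert z T')" if "triangle E S T'" "T' \<subseteq> ?N" for T'
          using False that hita[of T' "{?f}"] by blast
        show ?thesis
        proof (rule add[OF M0 all])
          fix c' assume "int (card (blocked ?S c' L {?f})) \<le> b"
          then show "inv_free ?S c' L {?f}" using b2 2 s7 by (intro invI) auto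
        qed
      next
        case True
        then obtain T0 where T0: "triangle E S T0" "T0 \<subseteq> ?N - {a}" by blast
        then have T0N: "T0 \<subseteq> ?N" "a \<notin> T0" by auto
        have rest: "hit M' (insert z T')" if "triangle E S T'" "T' \<subseteq> ?N" "T' \<noteq> T0" "?f \<in> M'" for T' M'
        proof -
          have "a \<in> T'" using a(2)[OF that(1) T0(1) _ T0(2)] that by blast
          then show ?thesis using hita that(4) by blast
        qed
        have nh: "\<not> hit M T0" unfolding Me hit_def by blast
        have fb: "finite (blocked S c L M)" by (rule finite_blocked[OF fS])
        show ?thesis
        proof (cases "T0 \<in> blocked S c L M")
          case False
          then obtain x where x: "x \<in> T0" "free S c L T0 x" using T0 nh unfolding blocked_def by blast
          obtain c' L' where c': "state X ?S c' L' {?f}"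
            "\<not> has_five_clique \<Longrightarrow> blocked ?S c' L' {?f} \<subseteq> insert T0 (blocked S c L M)"
            "\<not> has_five_clique \<Longrightarrow> almost_free S c L \<Longrightarrow> blocked ?S c' L' {?f} = {}"
            by (rule leaf_step[OF st z M0 T0(1) T0N(1) x rest[OF _ _ _ singletonI]], assumption+, rule that)
          have "card (blocked ?S c' L' {?f}) \<le> card (insert T0 (blocked S c L M))"
            using c'(2)[OF no5] fb by (intro card_mono) auto
          then have "int (card (blocked ?S c' L' {?f})) \<le> 2"
            using b2 fb unfolding b_def by (simp add: card_insert_if split: if_splits)
          then have "inv_free ?S c' L' {?f}" using 2 s7 by (intro invI) auto
          then show ?thesis using c'(1) by blast
        next
          case True
          obtain e where e: "e \<in> inner E S" "e \<subseteq> T0" "e \<inter> (\<Union>M \<union> X) = {}"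
            by (rule edge_inside_triangle[OF T0(1) nh ME mM]) (use Me Xe in auto)
          have "e \<inter> (\<Union>{?f} \<union> X) = {}" using e T0N zS Xe unfolding inner_def by auto
          then have M': "M \<subseteq> {e, ?f}" "{e, ?f} \<subseteq> inner E ?S" "matching_avoiding X {e, ?f}"
            using Me f e(1) inner_mono[of S ?S] matching_avoiding_insert[OF M0(3)] by auto
          have all: "hit {e, ?f} (insert z T')" if "triangle E S T'" "T' \<subseteq> ?N" for T'
          proof (cases "T' = T0")
            case True then show ?thesis using e(2) by (intro hitI[of e]) auto
          next
            case False then show ?thesis using rest[OF that False] by blast
          qed
          show ?thesis
          proof (rule add[OF M' all])
            fix c' assume "int (card (blocked ?S c' L {e, ?f})) \<le> b"
            moreover have "int (card {e, ?f}) \<le> 2" by (simp add: card_insert_if)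
            ultimately have "2 * int (card {e, ?f}) + int (card (blocked ?S c' L {e, ?f})) + 1 \<le> 8 - (s + 5 - 2 * k)"
              using b2 2 s7 by linarith
            then show "inv_free ?S c' L {e, ?f}" using 2 s7 by (intro invI) linarith+
          qed
        qed
      qed
    qed
  qed
qed

end

section \<open>Starting from a 5-clique or a 4-clique\<close>

context simple_graph
begin

lemma inner_clique: "clique E Q \<Longrightarrow> inner E Q = {e. e \<subseteq> Q \<and> card e = 2}"
proof (intro equalityI subsetI)
  fix e assume "e \<in> inner E Q" then show "e \<in> {e. e \<subseteq> Q \<and> card e = 2}"
    using two unfolding inner_def by blast
next
  fix e assume cl: "clique E Q" and "e \<in> {e. e \<subseteq> Q \<and> card e = 2}"
  then have e: "e \<subseteq> Q" "card e = 2" by auto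
  then obtain a b where "e = {a, b}" "a \<noteq> b" by (meson card_2_iff)
  then show "e \<in> inner E Q" using cliqueD[OF cl, of a b] e unfolding inner_def by auto
qed

lemma card_inner_clique:
  assumes "clique E Q" "finite Q"
  shows "card (inner E Q) = card Q choose 2"
  unfolding inner_clique[OF assms(1)] by (rule n_subsets[OF assms(2)])

lemma add_mod_5_cancel:
  fixes i a b :: nat
  assumes "(i + a) mod 5 = (i + b) mod 5" "i < 5" "a < 5" "b < 5"
  shows "a = b"
proof -
  have "i \<in> {0, 1, 2, 3, 4}" "a \<in> {0, 1, 2, 3, 4}" "b \<in> {0, 1, 2, 3, 4}" using assms by auto
  then show ?thesis using assms(1) by (elim insertE emptyE) simp_all
qed

text \<open>Any three residues modulo 5 form an arithmetic progression: five midpoints and two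
  differences up to sign account for all ten triples.\<close>

lemma midpoint_mod_5:
  fixes i j k :: nat
  assumes "i < 5" "j < 5" "k < 5" "i \<noteq> j" "i \<noteq> k" "j \<noteq> k"
  shows "(i + i) mod 5 = (j + k) mod 5 \<or> (j + j) mod 5 = (i + k) mod 5 \<or> (k + k) mod 5 = (i + j) mod 5"
proof -
  have "i \<in> {0, 1, 2, 3, 4}" "j \<in> {0, 1, 2, 3, 4}" "k \<in> {0, 1, 2, 3, 4}" using assms by auto
  then show ?thesis using assms by (elim insertE emptyE) simp_all
qed

text \<open>A 5-clique is coloured by the sums of the labels modulo 5. Exactly one vertex of each triangle
  has a label that is the midpoint of the other two, and this vertex is free.\<close>

lemma five_clique_state:
  assumes K: "clique E K" "card K = 5"
  obtains c where "state X K c {} {}" "all_free K c {}"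
proof -
  have fK: "finite K" by (rule finite_of_card[OF K(2)])
  obtain g where g: "bij_betw g K {0..<5::nat}"
    using ex_bij_betw_finite_nat[OF fK] K(2) by auto
  have glt: "g v < 5" if "v \<in> K" for v using bij_betwE[OF g] that by auto
  have ginj: "g u = g v \<Longrightarrow> u = v" if "u \<in> K" "v \<in> K" for u v
    using g that unfolding bij_betw_def inj_on_def by blast
  have gmod: "u = v" if "u \<in> K" "v \<in> K" "w \<in> K" "(g w + g u) mod 5 = (g w + g v) mod 5" for u v w
    by (rule ginj[OF that(1,2)], rule add_mod_5_cancel[OF that(4) glt[OF that(3)] glt[OF that(1)] glt[OF that(2)]])
  define c where "c e = (\<Sum>v\<in>e. g v) mod 5" for e
  have c2: "c {u, v} = (g u + g v) mod 5" if "u \<noteq> v" for u v unfolding c_def using that by simp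
  have edge: "\<exists>b. e = {a, b} \<and> a \<noteq> b \<and> b \<in> K" if ea: "e \<in> inner E K" "a \<in> e" for e a
  proof -
    have "card e = 2" "e \<subseteq> K" using ea two unfolding inner_def by auto
    then obtain b where "e = {a, b}" "a \<noteq> b" using card_eq_2D ea(2) by metis
    then show ?thesis using \<open>e \<subseteq> K\<close> by blast
  qed
  have KV: "K \<subseteq> V"
  proof
    fix a assume a: "a \<in> K"
    have "card (K - {a}) = 4" using a K(2) by simp
    then obtain b where "b \<in> K - {a}" by (metis card.empty equals0I zero_neq_numeral)
    then show "a \<in> V" using cliqueD[OF K(1) a] by blast
  qed
  have ed: "\<exists>e\<in>E. e \<subseteq> K"
  proof -
    have "card (inner E K) = 10" using card_inner_clique[OF K(1) fK] K(2) by (simp add: choose_two)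
    then have "inner E K \<noteq> {}" by auto
    then show ?thesis unfolding inner_def by blast
  qed
  have col: "coloured K c {}"
    unfolding coloured_def
  proof (intro conjI ballI impI)
    fix e h assume eh: "e \<in> inner E K" "h \<in> inner E K" "e \<noteq> h" "c e = c h"
    show "e \<inter> h = {}"
    proof (rule ccontr)
      assume "e \<inter> h \<noteq> {}"
      then obtain a where a: "a \<in> e" "a \<in> h" by blast
      obtain b d where "e = {a, b}" "a \<noteq> b" "b \<in> K" "h = {a, d}" "a \<noteq> d" "d \<in> K"
        using edge[OF eh(1) a(1)] edge[OF eh(2) a(2)] by blast
      then show False using gmod[of b d a] a(1) eh c2 unfolding inner_def by auto
    qed
  next
    fix e h assume "e \<in> inner E K - {}" "h \<in> inner E K - {}"
    then have "e \<union> h \<subseteq> K" unfolding inner_def by blast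
    then show "clique E (e \<union> h)" by (rule clique_subset[OF K(1)])
  qed simp
  have gd: "good K c {}"
    unfolding good_def
  proof (intro allI impI disjI2)
    fix Q assume Q: "Q \<subseteq> K" "card Q = 4" "clique E Q"
    \<comment> \<open>Six edges and only five colours.\<close>
    have "card (inner E Q) = 6" using card_inner_clique[OF Q(3) finite_of_card[OF Q(2)]] Q(2)
      by (simp add: choose_two)
    moreover have "card (c ` inner E Q) \<le> card {0..<5::nat}" by (rule card_mono) (auto simp: c_def)
    ultimately have "\<not> inj_on c (inner E Q)" using card_image by fastforce
    then show "\<exists>e\<in>inner E Q. \<exists>h\<in>inner E Q. e \<noteq> h \<and> c e = c h" unfolding inj_on_def by blast
  qed
  have af: "all_free K c {}"
    unfolding all_free_def
  proof (intro allI impI)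
    fix T assume T: "triangle E K T"
    then have "card T = 3" "T \<subseteq> K" unfolding triangle_def by auto
    then obtain x y w where xyw: "T = {x, y, w}" "x \<noteq> y" "x \<noteq> w" "y \<noteq> w" by (metis card_3_iff)
    have inK: "x \<in> K" "y \<in> K" "w \<in> K" using xyw \<open>T \<subseteq> K\<close> by auto
    \<comment> \<open>The edges at \<open>p\<close> have the sums \<open>g p + g b\<close> with
      \<open>b \<noteq> p\<close>, so the residue of \<open>g p + g p\<close> is missing at
      \<open>p\<close>; it is the colour of the edge opposite to a midpoint.\<close>
    have fr: "free K c {} {p, q, s} p"
      if "p \<in> K" "p \<noteq> q" "p \<noteq> s" "q \<noteq> s" "(g p + g p) mod 5 = (g q + g s) mod 5" for p q s
      unfolding free_def
    proof (intro conjI ballI impI)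
      fix h assume h: "h \<in> inner E K" "p \<in> h"
      obtain b where b: "h = {p, b}" "p \<noteq> b" "b \<in> K" using edge[OF h] by blast
      have "{p, q, s} - {p} = {q, s}" using that by auto
      then show "c h \<noteq> c ({p, q, s} - {p})"
        using gmod[of b p p] b that c2 by auto
    qed simp
    have ne: "g x \<noteq> g y" "g x \<noteq> g w" "g y \<noteq> g w" using ginj inK xyw by blast+
    consider "(g x + g x) mod 5 = (g y + g w) mod 5" | "(g y + g y) mod 5 = (g x + g w) mod 5"
      | "(g w + g w) mod 5 = (g x + g y) mod 5"
      using midpoint_mod_5[OF glt[OF inK(1)] glt[OF inK(2)] glt[OF inK(3)] ne] by blast
    then show "\<exists>x\<in>T. free K c {} T x"
    proof cases
      case 1 then show ?thesis using fr[of x y w] xyw inK by auto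
    next
      case 2
      have "T = {y, x, w}" using xyw by auto
      then show ?thesis using fr[of y x w] 2 xyw inK by auto
    next
      case 3
      have "T = {w, x, y}" using xyw by auto
      then show ?thesis using fr[of w x y] 3 xyw inK by auto
    qed
  qed
  have "state X K c {} {}"
    unfolding state_def matching_avoiding_def using KV ed col gd by simp
  then show ?thesis using that af by blast
qed

text \<open>A double step from the edge \<open>{u, v}\<close>, on which \<open>almost_free\<close>
  holds for want of triangles.\<close>

lemma four_clique_state:
  assumes Q: "clique E {u, v, x, y}" "card {u, v, x, y} = 4"
  obtains c where "state X {u, v, x, y} c {} {}" "almost_free {u, v, x, y} c {}"
proof -
  have d: "u \<noteq> v" "u \<noteq> x" "u \<noteq> y" "v \<noteq> x" "v \<noteq> y" "x \<noteq> y"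
    using Q(2) by (auto simp: card_insert_if split: if_splits)
  have e: "{u, v} \<in> E" "{u, x} \<in> E" "{u, y} \<in> E" using d by (auto intro: cliqueD[OF Q(1)])
  have tri: "\<not> triangle E {u, v} T" for T
  proof
    assume "triangle E {u, v} T"
    then have "T \<subseteq> {u, v}" "card T = 3" unfolding triangle_def by auto
    then show False using card_mono[of "{u, v}" T] d(1) by simp
  qed
  have inn: "inner E {u, v} \<subseteq> {{u, v}}"
  proof
    fix f assume "f \<in> inner E {u, v}"
    then have "f \<subseteq> {u, v}" "card f = 2" using two unfolding inner_def by auto
    then have "f = {u, v}" using card_subset_eq[of "{u, v}" f] d(1) by simp
    then show "f \<in> {{u, v}}" by simp
  qed
  have "good {u, v} (\<lambda>_. 0) {}"
    unfolding good_def
  proof (intro allI impI)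
    fix Q :: "'a set" assume "Q \<subseteq> {u, v}" "card Q = 4"
    then show "hit {} Q \<or> (\<exists>e\<in>inner E Q. \<exists>h\<in>inner E Q. e \<noteq> h \<and> (0::nat) = 0)"
      using card_mono[of "{u, v}" Q] d(1) by simp
  qed
  then have st: "state X {u, v} (\<lambda>_. 0) {} {}"
    unfolding state_def coloured_def matching_avoiding_def using e inn by blast
  have af: "almost_free {u, v} (\<lambda>_. 0) {}" unfolding almost_free_def using tri by blast
  have xy: "x \<in> V - {u, v}" "y \<in> V - {u, v}" using d e by auto
  have eq: "insert y (insert x {u, v}) = {u, v, x, y}" by blast
  have new: "P = {u, v, x, y} \<or> hit {} P"
    if "P \<subseteq> insert y (insert x {u, v})" "card P = 4" for P
    using that Q(2) card_subset_eq[of "{u, v, x, y}" P] unfolding eq by simp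
  have M: "{} \<subseteq> inner E (insert y (insert x {u, v}))" "matching_avoiding X {}"
    unfolding matching_avoiding_def by simp_all
  have uv: "u \<in> {u, v}" "v \<in> {u, v}" by simp_all
  obtain c where "state X (insert y (insert x {u, v})) c {} {}"
    "blocked (insert y (insert x {u, v})) c {} {} \<subseteq> blocked {u, v} (\<lambda>_. 0) {} {}"
    "all_free {u, v} (\<lambda>_. 0) {} \<Longrightarrow> all_free (insert y (insert x {u, v})) c {}"
    "almost_free {u, v} (\<lambda>_. 0) {} \<Longrightarrow> almost_free (insert y (insert x {u, v})) c {}"
    by (rule two_step[OF st xy d(6) uv d(1) Q(1) order_refl M new], assumption+, rule that)
  then show ?thesis using that[of c] af unfolding eq by blast
qed

end

section \<open>Growth from a 5-clique, and the colouring of a whole component\<close>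

context k4_component
begin

text \<open>A 5-clique has surplus 5, so at most four units remain. An edge of \<open>M\<close> is
  charged one unit instead of two, and the constant 4 sets aside the first unit below 5 for a leaf
  step, after which the free vertices are no longer tracked.\<close>

definition inv_five :: "'a set \<Rightarrow> ('a set \<Rightarrow> nat) \<Rightarrow> 'a set set \<Rightarrow> 'a set set \<Rightarrow> bool" where
  "inv_five S c L M \<longleftrightarrow> surplus E S \<le> 5 \<and>
     (M = {} \<and> all_free S c L \<or> int (card M) + 4 \<le> 8 - surplus E S)"

text \<open>Blocked triangles are not counted, since in the presence of 5-cliques one leaf step may
  block several. The smaller surplus makes up for it: \<open>z\<close> has at most four
  neighbours.\<close>

lemma one_step_five:
  assumes st: "state X S c L M" and iv: "inv_five S c L M" and cand: "candidate S z T"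
    and V1: "1 \<le> surplus E V" and X: "admissible_roots X"
  shows "\<exists>c' L' M'. state X (insert z S) c' L' M' \<and> inv_five (insert z S) c' L' M'"
proof -
  have S: "S \<subseteq> V" and ed: "\<exists>e\<in>E. e \<subseteq> S" and MS: "M \<subseteq> inner E S" and mM: "matching_avoiding X M"
    using st unfolding state_def by auto
  have ME: "M \<subseteq> E" using MS unfolding inner_def by blast
  have finM: "finite M" using ME finE finite_subset by blast
  have fS: "finite S" by (rule finS[OF S])
  have z: "z \<in> V - S" and zS: "z \<notin> S" using cand unfolding candidate_def by auto
  let ?N = "nbrs E S z" and ?S = "insert z S"
  have fN: "finite ?N" using fS unfolding nbrs_def by auto
  note cs = candidate_surplus[OF S ed cand]
  define s t k m where "s = surplus E S" and "t = surplus E V" and "k = int (card ?N)"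
    and "m = int (card M)"
  have s': "surplus E ?S = s + 5 - 2 * k" and ts: "t \<le> s + 5 - 2 * k" and k3: "3 \<le> k"
    using cs unfolding s_def t_def k_def by auto
  have s5: "s \<le> 5" using iv unfolding inv_five_def s_def by blast
  have m0: "0 \<le> m" unfolding m_def by auto
  have D: "M = {} \<and> all_free S c L \<and> m = 0 \<or> m + 4 \<le> 8 - s"
    using iv unfolding inv_five_def m_def s_def by auto
  have MS': "M \<subseteq> inner E ?S" using MS inner_mono[of S ?S] by blast
  have cardins: "int (card (insert e M)) \<le> m + 1" for e unfolding m_def using finM
    by (simp add: card_insert_if)
  have invI: "inv_five ?S c' L' M'"
    if "M' = {} \<and> all_free ?S c' L' \<or> int (card M') + 4 \<le> 8 - (s + 5 - 2 * k)" for c' L' M'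
    unfolding inv_five_def s' using that s5 k3 by auto
  have add: ?thesis
    if M': "M \<subseteq> M'" "M' \<subseteq> inner E ?S" "matching_avoiding X M'"
      and all: "\<And>T. triangle E S T \<Longrightarrow> T \<subseteq> ?N \<Longrightarrow> hit M' (insert z T)"
      and ok: "M' = {} \<and> all_free S c L \<or> int (card M') + 4 \<le> 8 - (s + 5 - 2 * k)" for M'
  proof -
    obtain c' where c': "state X ?S c' L M'" "blocked ?S c' L M' \<subseteq> blocked S c L M"
      "all_free S c L \<Longrightarrow> all_free ?S c' L" "almost_free S c L \<Longrightarrow> almost_free ?S c' L"
      by (rule plain_step[OF st z M' all], assumption+, rule that)
    have "inv_five ?S c' L M'" using ok c'(3) by (intro invI) blast
    then show ?thesis using c'(1) by blast
  qed
  define U where "U = {T. triangle E S T \<and> T \<subseteq> ?N \<and> \<not> hit M T}"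
  have hitU: "hit M' (insert z T')" if "triangle E S T'" "T' \<subseteq> ?N" "T' \<notin> U" "M \<subseteq> M'" for T' M'
    using that hit_mono[of M T' M' "insert z T'"] unfolding U_def by blast
  consider (none) "U = {}" | (one) T0 where "U = {T0}" | (more) T1 T2 where "T1 \<in> U" "T2 \<in> U" "T1 \<noteq> T2"
    by blast
  then show ?thesis
  proof cases
    case none
    show ?thesis
    proof (rule add[OF order_refl MS' mM])
      show "hit M (insert z T)" if "triangle E S T" "T \<subseteq> ?N" for T
        using hitU[OF that _ order_refl] none by blast
      show "M = {} \<and> all_free S c L \<or> int (card M) + 4 \<le> 8 - (s + 5 - 2 * k)"
        using D k3 by (auto simp: m_def)
    qed
  next
    case (one T0)
    then have T0: "triangle E S T0" "T0 \<subseteq> ?N" "\<not> hit M T0" unfolding U_def by auto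
    have rest: "hit M' (insert z T')" if "triangle E S T'" "T' \<subseteq> ?N" "T' \<noteq> T0" "M \<subseteq> M'" for T' M'
      using hitU[OF that(1,2) _ that(4)] one that(3) by blast
    show ?thesis
    proof (cases "T0 \<in> blocked S c L M")
      case False
      then obtain x where x: "x \<in> T0" "free S c L T0 x" using T0 unfolding blocked_def by blast
      obtain c' L' where c': "state X ?S c' L' M"
        "\<not> has_five_clique \<Longrightarrow> blocked ?S c' L' M \<subseteq> insert T0 (blocked S c L M)"
        "\<not> has_five_clique \<Longrightarrow> almost_free S c L \<Longrightarrow> blocked ?S c' L' M = {}"
        by (rule leaf_step[OF st z order_refl MS' mM T0(1,2) x(1,2) rest[OF _ _ _ order_refl]], assumption+, rule that)
      have "m + 4 \<le> 8 - (s + 5 - 2 * k)" using D s5 k3 by auto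
      then have "inv_five ?S c' L' M" by (intro invI) (auto simp: m_def)
      then show ?thesis using c'(1) by blast
    next
      case True
      then have D2: "m + 4 \<le> 8 - s" using D all_free_blocked[of S c L M] by auto
      have D3: "int (card (insert e M)) + 4 \<le> 8 - (s + 5 - 2 * k)" for e using D2 k3 cardins[of e] by linarith
      show ?thesis
      proof (cases "card M + card (T0 \<inter> X) \<le> 1")
        case True
        obtain e where e: "e \<in> inner E S" "e \<subseteq> T0" "e \<inter> (\<Union>M \<union> X) = {}" "matching_avoiding X (insert e M)"
          by (rule edge_inside_triangle[OF T0(1,3) ME mM True], rule that)
        have hT0: "hit (insert e M) T0" using e(2) by (intro hitI[of e]) auto
        have all: "hit (insert e M) (insert z T')" if "triangle E S T'" "T' \<subseteq> ?N" for T'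
          using rest[OF that] hit_mono[OF hT0 order_refl] by (cases "T' = T0") blast+
        have M': "M \<subseteq> insert e M" "insert e M \<subseteq> inner E ?S"
          using MS' e(1) inner_mono[of S ?S] by auto
        show ?thesis by (rule add[OF M' e(4) all disjI2[OF D3]])
      next
        case False
        \<comment> \<open>A root means a final surplus of at least 3, hence at least 4 now, so
          \<open>M\<close> is still empty and at most one vertex of \<open>T0\<close> is
          excluded.\<close>
        have Xe: "X = {}"
        proof (rule ccontr)
          assume "X \<noteq> {}"
          then obtain r where r: "X = {r}" "3 \<le> t" using X unfolding t_def by blast
          then have "m = 0" using D2 ts k3 m0 by linarith
          moreover have "card (T0 \<inter> X) \<le> 1" using r card_mono[of X "T0 \<inter> X"] by auto
          ultimately show False using False unfolding m_def by simp
        qed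
        \<comment> \<open>This step still costs a unit, so the surplus is at least 2 now.\<close>
        have "m \<le> 2" using D2 ts k3 V1 unfolding t_def by linarith
        then have le2: "card M + card (T0 \<inter> X) \<le> 2" and zX: "z \<notin> X" using Xe unfolding m_def by auto
        obtain x where x: "x \<in> T0" "{z, x} \<in> inner E ?S" "matching_avoiding X (insert {z, x} M)"
          by (rule edge_to_triangle[OF T0(1,3) MS mM le2 zS zX T0(2)], rule that)
        have all: "hit (insert {z, x} M) (insert z T')" if "triangle E S T'" "T' \<subseteq> ?N" for T'
        proof (cases "T' = T0")
          case True then show ?thesis using x(1) by (intro hitI[of "{z, x}"]) auto
        next
          case False then show ?thesis using rest[OF that] by blast
        qed
        have M': "M \<subseteq> insert {z, x} M" "insert {z, x} M \<subseteq> inner E ?S" using MS' x(2) by auto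
        show ?thesis by (rule add[OF M' x(3) all disjI2[OF D3]])
      qed
    qed
  next
    case (more T1 T2)
    then have T12: "triangle E S T1" "triangle E S T2" "T1 \<subseteq> ?N" "T2 \<subseteq> ?N"
      unfolding U_def by auto
    have "4 \<le> card ?N" by (rule two_triangles_card[OF T12(1,2) more(3) T12(3,4) fN])
    then have k4: "k = 4" using ts s5 V1 unfolding k_def t_def by linarith
    then have cN: "card ?N = 4" unfolding k_def by simp
    \<comment> \<open>Four neighbours cost three units, so the surplus was at least 4 before and is
      at most 2 afterwards.\<close>
    have "m = 0" "t < 3" using D ts k4 s5 V1 m0 unfolding t_def by linarith+
    then have Xe: "X = {}" and Me: "M = {}" using X finM unfolding t_def m_def by auto
    obtain w x where wx: "w \<in> T1" "x \<in> T1" "w \<in> T2" "x \<in> T2" "w \<noteq> x"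
      "\<And>T. triangle E S T \<Longrightarrow> T \<subseteq> ?N \<Longrightarrow> T = T1 \<or> T = T2 \<or> clique E ?N"
      by (rule two_triangles_in_four[OF T12(1,2) more(3) T12(3,4) cN], rule that)
    obtain M' where M': "M' \<subseteq> inner E S" "matching_avoiding X M'" "card M' \<le> 2"
      "\<And>T. triangle E S T \<Longrightarrow> T \<subseteq> ?N \<Longrightarrow> hit M' T"
    proof (cases "clique E ?N")
      case True
      obtain a b d f where N: "?N = {a, b, d, f}"
        and dist: "a \<noteq> b" "a \<noteq> d" "a \<noteq> f" "b \<noteq> d" "b \<noteq> f" "d \<noteq> f"
        by (rule card_eq_4D[OF cN])
      have NS: "?N \<subseteq> S" unfolding nbrs_def by blast
      have mem: "a \<in> ?N" "b \<in> ?N" "d \<in> ?N" "f \<in> ?N" unfolding N by auto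
      show ?thesis
      proof (rule that[of "{{a, b}, {d, f}}"])
        show "{{a, b}, {d, f}} \<subseteq> inner E S"
          using cliqueD[OF True mem(1,2) dist(1)] cliqueD[OF True mem(3,4) dist(6)] mem NS
          unfolding inner_def by auto
        show "matching_avoiding X {{a, b}, {d, f}}"
          unfolding matching_avoiding_def Xe using dist by auto
        show "card {{a, b}, {d, f}} \<le> 2" by (simp add: card_insert_if)
        fix T assume T: "triangle E S T" "T \<subseteq> ?N"
        \<comment> \<open>A triangle leaves out only one of the four vertices, so it contains one of
          two disjoint edges.\<close>
        show "hit {{a, b}, {d, f}} T"
        proof (rule ccontr)
          assume nh: "\<not> ?thesis"
          then have "\<not> {a, b} \<subseteq> T" "\<not> {d, f} \<subseteq> T"
            using hitI[of "{a, b}" "{{a, b}, {d, f}}" T] hitI[of "{d, f}" "{{a, b}, {d, f}}" T] by auto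
          then obtain p q where "p \<in> {a, b}" "p \<notin> T" "q \<in> {d, f}" "q \<notin> T" by blast
          then have pq: "T \<subseteq> ?N - {p, q}" "p \<noteq> q" "{p, q} \<subseteq> ?N" using T(2) N dist by auto
          have "card (?N - {p, q}) = 2" using pq cN fN by (subst card_Diff_subset) auto
          moreover have "card T \<le> card (?N - {p, q})" using pq fN by (intro card_mono) auto
          ultimately show False using T(1) unfolding triangle_def by simp
        qed
      qed
    next
      case False
      have wxe: "{w, x} \<in> inner E S"
        using wx T12(1) cliqueD[of E T1 w x] unfolding triangle_def inner_def by blast
      show ?thesis
      proof (rule that[of "{{w, x}}"])
        fix T assume "triangle E S T" "T \<subseteq> ?N"
        then have "T = T1 \<or> T = T2" using wx(6) False by blast
        then show "hit {{w, x}} T" using wx by (intro hitI[of "{w, x}"]) auto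
      qed (use wxe Xe in \<open>auto simp: matching_avoiding_def\<close>)
    qed
    have all: "hit M' (insert z T')" if "triangle E S T'" "T' \<subseteq> ?N" for T'
      using hit_mono[OF M'(4)[OF that]] by blast
    have sub: "M \<subseteq> M'" "M' \<subseteq> inner E ?S" using Me M'(1) inner_mono[of S ?S] by auto
    show ?thesis
      by (rule add[OF sub M'(2) all], assumption+, rule disjI2) (use M'(3) k4 s5 in linarith)
  qed
qed

text \<open>Both budgets survive a double step: an edge of \<open>M\<close> comes only with a drop
  of four, more than its price in either budget, and no triangle becomes blocked.\<close>

lemma two_step_invariants:
  assumes st: "state X S c L M" and s8: "surplus E S \<le> 8" and V1: "1 \<le> surplus E V"
    and X: "admissible_roots X"
    and M0: "X \<noteq> {} \<longrightarrow> 7 \<le> surplus E S \<longrightarrow> M = {}"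
    and xy: "x \<in> V - S" "y \<in> V - S" "x \<noteq> y"
    and uv: "u \<in> S" "v \<in> S" "u \<noteq> v" "clique E {u, v, x, y}"
    and nc: "\<not> (\<exists>z T. candidate S z T)"
  shows "\<exists>c' M'. state X (insert y (insert x S)) c' L M' \<and>
    surplus E (insert y (insert x S)) \<le> surplus E S \<and>
    (inv_free S c L M \<longrightarrow> inv_free (insert y (insert x S)) c' L M') \<and>
    (inv_five S c L M \<longrightarrow> inv_five (insert y (insert x S)) c' L M')"
proof -
  let ?S = "insert y (insert x S)"
  have S: "S \<subseteq> V" and ed: "\<exists>e\<in>E. e \<subseteq> S" and ME: "M \<subseteq> inner E S" using st unfolding state_def by auto
  have fS: "finite S" by (rule finS[OF S])
  have finM: "finite M" using ME fin_inner finite_subset by blast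
  have VS: "surplus E V \<le> surplus E ?S" using xy S ed by (intro surplus_V_le) auto
  obtain c' M' where c': "state X ?S c' L M'" "blocked ?S c' L M' \<subseteq> blocked S c L M"
    "all_free S c L \<Longrightarrow> all_free ?S c' L" "almost_free S c L \<Longrightarrow> almost_free ?S c' L"
    "surplus E ?S \<le> surplus E S"
    "M' = M \<or> (\<exists>e. M' = insert e M) \<and> surplus E ?S \<le> surplus E S - 4"
    by (rule two_step_free[OF st s8 V1 X M0[rule_format] xy uv nc], assumption+, rule that)
  have b: "card (blocked ?S c' L M') \<le> card (blocked S c L M)" by (rule card_le_blocked[OF c'(2) fS])
  have fr: "inv_free ?S c' L M'" if iv: "inv_free S c L M"
    using c'(6)
  proof
    assume "M' = M"
    then show ?thesis using iv b c'(4,5) unfolding inv_free_def by auto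
  next
    assume a: "(\<exists>e. M' = insert e M) \<and> surplus E ?S \<le> surplus E S - 4"
    then have "card M' \<le> card M + 1" using finM by (auto simp: card_insert_if)
    moreover have "M = {} \<and> card (blocked S c L M) = 0 \<or>
        2 * int (card M) + int (card (blocked S c L M)) + 1 \<le> 8 - surplus E S"
      using iv a VS almost_free_blocked[of S c L M] unfolding inv_free_def by auto
    ultimately have "2 * int (card M') + int (card (blocked ?S c' L M')) + 1 \<le> 8 - surplus E ?S"
      using a b s8 by auto
    then show ?thesis using a s8 unfolding inv_free_def by auto
  qed
  have fi: "inv_five ?S c' L M'" if iv: "inv_five S c L M"
    using c'(6)
  proof
    assume "M' = M"
    then show ?thesis using iv c'(3,5) unfolding inv_five_def by auto
  next
    assume a: "(\<exists>e. M' = insert e M) \<and> surplus E ?S \<le> surplus E S - 4"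
    then have "card M' \<le> card M + 1" using finM by (auto simp: card_insert_if)
    then have "int (card M') + 4 \<le> 8 - surplus E ?S"
      using a iv unfolding inv_five_def by auto
    then show ?thesis using a iv unfolding inv_five_def by auto
  qed
  show ?thesis using c'(1,5) fr fi by blast
qed

lemma state_V_colouring:
  assumes "state X V c L M"
  shows "\<forall>e\<in>E. \<forall>h\<in>E. e \<noteq> h \<longrightarrow> c e = c h \<longrightarrow> e \<inter> h = {}" "M \<subseteq> E" "matching_avoiding X M"
    "\<And>Q. card Q = 4 \<Longrightarrow> clique E Q \<Longrightarrow> hit M Q \<or> repeats c (inner E Q)"
proof -
  have "inner E V = E" unfolding inner_def by blast
  then show "\<forall>e\<in>E. \<forall>h\<in>E. e \<noteq> h \<longrightarrow> c e = c h \<longrightarrow> e \<inter> h = {}" "M \<subseteq> E" "matching_avoiding X M"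
    using assms unfolding state_def coloured_def by auto
  fix Q assume Q: "card Q = 4" "clique E Q"
  have "Q \<subseteq> V" using clique_subset_V[OF Q(2)] Q(1) by simp
  then show "hit M Q \<or> repeats c (inner E Q)"
    using assms Q unfolding state_def good_def by blast
qed

lemma edge_state:
  assumes "{u, v} \<in> E"
  shows "state X {u, v} (\<lambda>_. 0) {} {}" "almost_free {u, v} (\<lambda>_. 0) {}"
    "\<not> triangle E {u, v} T" "surplus E {u, v} = 8"
proof -
  have ne: "u \<noteq> v" by (rule no_loop[OF assms])
  have in1: "inner E {u, v} = {{u, v}}"
  proof -
    have "e = {u, v}" if "e \<in> E" "e \<subseteq> {u, v}" for e
      using two[OF that(1)] that(2) ne card_subset_eq[of "{u, v}" e] by auto
    then show ?thesis using assms unfolding inner_def by auto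
  qed
  have small: "card Q \<le> 2" if "Q \<subseteq> {u, v}" for Q
    using card_mono[OF _ that] ne by simp
  have cl: "clique E {u, v}" using assms unfolding clique_def by (auto simp: insert_commute)
  have good: "good {u, v} (\<lambda>_. 0) {}"
    unfolding good_def
  proof (intro allI impI)
    fix Q :: "'a set" assume "Q \<subseteq> {u, v}" "card Q = 4"
    then show "hit {} Q \<or> (\<exists>e\<in>inner E Q. \<exists>h\<in>inner E Q. e \<noteq> h \<and> (0::nat) = 0)"
      using small[of Q] by simp
  qed
  have sub: "{u, v} \<subseteq> V" using assms by (auto intro: UnionI)
  show "state X {u, v} (\<lambda>_. 0) {} {}"
    unfolding state_def coloured_def in1 matching_avoiding_def using good sub assms cl by auto
  have nt: "\<not> triangle E {u, v} T" for T using small[of T] unfolding triangle_def by auto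
  then show "\<not> triangle E {u, v} T" .
  show "almost_free {u, v} (\<lambda>_. 0) {}" unfolding almost_free_def using nt by blast
  show "surplus E {u, v} = 8" unfolding surplus_def in1 using ne by simp
qed

text \<open>Two budgets are needed because \<open>five_clique\<close> limits the damage of leaf
  steps only if there is no 5-clique, whereas a 5-clique starts at so low a surplus that the cruder
  \<open>inv_five\<close> is enough.\<close>

theorem local_colouring:
  assumes ne: "E \<noteq> {}" and V1: "1 \<le> surplus E V"
    and X: "admissible_roots X"
  shows "\<exists>(c :: 'a set \<Rightarrow> nat) M. (\<forall>e\<in>E. \<forall>h\<in>E. e \<noteq> h \<longrightarrow> c e = c h \<longrightarrow> e \<inter> h = {}) \<and>
    M \<subseteq> E \<and> matching_avoiding X M \<and> (M \<noteq> {} \<longrightarrow> surplus E V \<le> 5) \<and>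
    (\<forall>Q. card Q = 4 \<longrightarrow> clique E Q \<longrightarrow>
      hit M Q \<or> repeats c (inner E Q))"
proof -
  have fin: ?thesis if "state X V c L M" "inv_free V c L M \<or> inv_five V c L M" for c L M
    using state_V_colouring[OF that(1)] that(2) unfolding inv_free_def inv_five_def
    by (intro exI[of _ c] exI[of _ M]) blast
  show ?thesis
  proof (cases has_five_clique)
    case True
    then obtain K where K: "clique E K" "card K = 5" by blast
    obtain c where c: "state X K c {} {}" "all_free K c {}" by (rule five_clique_state[OF K])
    have fK: "finite K" by (rule finite_of_card[OF K(2)])
    have "card (inner E K) = 10" using card_inner_clique[OF K(1) fK] K(2) by (simp add: choose_two)
    then have "surplus E K = 5" using K(2) unfolding surplus_def by simp
    then have iv: "inv_five K c {} {}" using c(2) unfolding inv_five_def by simp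
    obtain e where e: "e \<in> E" "e \<subseteq> K" and KV: "K \<subseteq> V" using c(1) unfolding state_def by blast
    have "\<exists>c L M. state X V c L M \<and> inv_five V c L M"
    proof (rule grow_induct[where P = "\<lambda>S. \<exists>c L M. state X S c L M \<and> inv_five S c L M", OF _ KV e])
      show "\<exists>c L M. state X K c L M \<and> inv_five K c L M" using c(1) iv by blast
    next
      fix S z T
      assume "\<exists>c L M. state X S c L M \<and> inv_five S c L M" "candidate S z T"
      then show "\<exists>c L M. state X (insert z S) c L M \<and> inv_five (insert z S) c L M"
        using one_step_five[OF _ _ _ V1 X] by blast
    next
      fix S u v x y
      assume h: "\<exists>c L M. state X S c L M \<and> inv_five S c L M" and
        xy: "x \<in> V - S" "y \<in> V - S" "x \<noteq> y" and uv: "u \<in> S" "v \<in> S" "u \<noteq> v" "clique E {u, v, x, y}"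
        and nc: "\<not> (\<exists>z T. candidate S z T)"
      obtain c L M where st: "state X S c L M" "inv_five S c L M" using h by blast
      have s: "surplus E S \<le> 8" "X \<noteq> {} \<longrightarrow> 7 \<le> surplus E S \<longrightarrow> M = {}"
        using st(2) unfolding inv_five_def by auto
      show "\<exists>c L M. state X (insert y (insert x S)) c L M \<and> inv_five (insert y (insert x S)) c L M"
        using two_step_invariants[OF st(1) s(1) V1 X s(2) xy uv nc] st(2)
        by blast
    qed
    then obtain c L M where "state X V c L M" "inv_five V c L M" by blast
    then show ?thesis by (intro fin[of c L M] disjI2)
  next
    case no5: False
    \<comment> \<open>At surplus 8, \<open>one_step_free\<close> only admits vertices with three
      neighbours. If some vertex sees a triangle of a 4-clique, the growth starts with these five
      vertices, at surplus 7. Otherwise \<open>P\<close> records that at surplus 8 every triangle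
      lies in a 4-clique, so that no vertex can see one.\<close>
    define extensible where "extensible \<longleftrightarrow> (\<exists>Q z T. clique E Q \<and> card Q = 4 \<and> candidate Q z T)"
    define P where "P S \<longleftrightarrow> (\<exists>c L M. state X S c L M \<and> inv_free S c L M) \<and> (surplus E S = 8 \<longrightarrow>
      \<not> extensible \<and> (\<forall>T. triangle E S T \<longrightarrow> (\<exists>Q\<subseteq>S. clique E Q \<and> card Q = 4 \<and> T \<subseteq> Q)))" for S
    have grow: "P V" if "P S0" "S0 \<subseteq> V" "e \<in> E" "e \<subseteq> S0" for S0 e
    proof (rule grow_induct[where P = P, OF that])
      fix S z T
      assume PS: "P S" and S: "S \<subseteq> V" and cand: "candidate S z T"
      obtain c L M where st: "state X S c L M" "inv_free S c L M"
        using PS unfolding P_def by blast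
      have "surplus E S \<noteq> 8"
      proof
        assume "surplus E S = 8"
        then obtain Q where Q: "Q \<subseteq> S" "clique E Q" "card Q = 4" "T \<subseteq> Q" and noQ: "\<not> extensible"
          using PS cand unfolding P_def candidate_def by blast
        have "candidate Q z T"
          using cand Q(1,4) unfolding candidate_def triangle_def nbrs_def by blast
        then show False using noQ Q unfolding extensible_def by blast
      qed
      then have s7: "surplus E S \<le> 7" using st(2) unfolding inv_free_def by linarith
      have "\<exists>c' L' M'. state X (insert z S) c' L' M' \<and> inv_free (insert z S) c' L' M'"
        by (rule one_step_free[OF no5 st(1,2) cand V1 X disjI1[OF s7]])
      moreover have "surplus E (insert z S) \<le> 7"
        using candidate_surplus[OF S _ cand] st(1) s7 unfolding state_def by force
      ultimately show "P (insert z S)" unfolding P_def by auto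
    next
      fix S u v x y
      assume PS: "P S" and S: "S \<subseteq> V" and
        xy: "x \<in> V - S" "y \<in> V - S" "x \<noteq> y" and uv: "u \<in> S" "v \<in> S" "u \<noteq> v" "clique E {u, v, x, y}"
        and nc: "\<not> (\<exists>z T. candidate S z T)"
      let ?S = "insert y (insert x S)"
      obtain c L M where st: "state X S c L M" "inv_free S c L M"
        using PS unfolding P_def by blast
      have s: "surplus E S \<le> 8" "X \<noteq> {} \<longrightarrow> 7 \<le> surplus E S \<longrightarrow> M = {}"
        using st(2) unfolding inv_free_def by auto
      obtain c' M' where ts: "state X ?S c' L M'" "surplus E ?S \<le> surplus E S"
        "inv_free S c L M \<longrightarrow> inv_free ?S c' L M'"
        using two_step_invariants[OF st(1) s(1) V1 X s(2) xy uv nc] by blast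
      \<comment> \<open>Surplus 8 after the step means that it cost nothing. Then \<open>u\<close>
        and \<open>v\<close> are the only neighbours of \<open>x\<close> and \<open>y\<close> in
        \<open>S\<close>, and a triangle with a new vertex lies in
        \<open>{u, v, x, y}\<close>.\<close>
      have tri: "\<exists>Q\<subseteq>?S. clique E Q \<and> card Q = 4 \<and> T \<subseteq> Q" if s8: "surplus E ?S = 8" and T: "triangle E ?S T" for T
      proof (cases "T \<subseteq> S")
        case True
        have "surplus E S = 8" using ts(2) s8 s(1) by linarith
        moreover have "triangle E S T" by (rule triangle_subset[OF T True])
        ultimately obtain Q where "Q \<subseteq> S" "clique E Q" "card Q = 4" "T \<subseteq> Q"
          using PS unfolding P_def by blast
        then show ?thesis by (intro exI[of _ Q]) auto
      next
        case False
        have nS: "x \<notin> S" "y \<notin> S" using xy by auto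
        have fS: "finite S" by (rule finS[OF S])
        have xyE: "{x, y} \<in> E" using cliqueD[OF uv(4)] xy(3) by blast
        have g2: "2 \<le> card (nbrs E S x)" "2 \<le> card (nbrs E S y)"
          using nbrs_ge2[OF S uv(1-4) nS(1)] nbrs_ge2[OF S uv(1-3), of y x] uv(4) nS(2)
          by (simp_all add: insert_commute)
        then have c2: "card (nbrs E S x) = 2" "card (nbrs E S y) = 2"
          using surplus_insert2[OF nS xyE fS] s8 s(1) by linarith+
        have "{u, v} \<subseteq> nbrs E S x" "{u, v} \<subseteq> nbrs E S y"
          using cliqueD[OF uv(4)] uv(1,2) nS unfolding nbrs_def by blast+
        moreover have "finite (nbrs E S x)" "finite (nbrs E S y)" using fS unfolding nbrs_def by auto
        ultimately have nx: "nbrs E S x = {u, v}" "nbrs E S y = {u, v}"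
          using c2 uv(3) card_subset_eq[of _ "{u, v}"] by (metis card_2_iff)+
        have clT: "clique E T" and TS: "T \<subseteq> ?S" using T unfolding triangle_def by auto
        have "T \<subseteq> {u, v, x, y}"
        proof
          fix a assume a: "a \<in> T"
          obtain w where w: "w \<in> T" "w = x \<or> w = y" using False TS by blast
          show "a \<in> {u, v, x, y}"
          proof (cases "a \<in> S")
            case True
            then have "w \<noteq> a" using w(2) nS by blast
            then have "a \<in> nbrs E S w" using cliqueD[OF clT w(1) a] True unfolding nbrs_def by blast
            then show ?thesis using w(2) nx by auto
          next
            case False then show ?thesis using a TS by blast
          qed
        qed
        moreover have "card {u, v, x, y} = 4"
        proof -
          have "u \<noteq> x" "u \<noteq> y" "v \<noteq> x" "v \<noteq> y" using uv(1,2) nS by metis+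
          then show ?thesis using uv(3) xy(3) by simp
        qed
        moreover have "{u, v, x, y} \<subseteq> ?S" using uv(1,2) by blast
        ultimately show ?thesis using uv(4) by (intro exI[of _ "{u, v, x, y}"]) auto
      qed
      have "\<not> extensible" if "surplus E ?S = 8"
        using that ts(2) s(1) PS unfolding P_def by auto
      moreover have "inv_free ?S c' L M'" using ts(3) st(2) by (rule mp)
      ultimately show "P ?S" using ts(1) tri unfolding P_def by blast
    qed
    have "P V"
    proof (cases extensible)
      case True
      then obtain Q z T where Q: "clique E Q" "card Q = 4" and cand: "candidate Q z T" unfolding extensible_def by blast
      have fQ: "finite Q" by (rule finite_of_card[OF Q(2)])
      obtain a b d f where Qs: "Q = {a, b, d, f}" by (rule card_eq_4D[OF Q(2)])
      obtain c where c: "state X Q c {} {}" "almost_free Q c {}"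
        unfolding Qs by (rule four_clique_state[OF Q[unfolded Qs]])
      have "card (inner E Q) = 6" using card_inner_clique[OF Q(1) fQ] Q(2) by (simp add: choose_two)
      then have s8: "surplus E Q = 8" using Q(2) unfolding surplus_def by simp
      then have iv: "inv_free Q c {} {}" using c(2) unfolding inv_free_def by simp
      obtain e where e: "e \<in> E" "e \<subseteq> Q" and QV: "Q \<subseteq> V" using c(1) unfolding state_def by blast
      have z: "z \<in> V - Q" using cand unfolding candidate_def by blast
      have sub: "nbrs E Q z \<subseteq> Q" unfolding nbrs_def by blast
      have "nbrs E Q z \<noteq> Q"
      proof
        assume "nbrs E Q z = Q"
        then have "clique E (insert z Q)" unfolding nbrs_def by (intro clique_insert[OF Q(1)]) blast
        moreover have "card (insert z Q) = 5" using z Q(2) fQ by simp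
        ultimately show False using no5 by blast
      qed
      then have "card (nbrs E Q z) < 4" using psubset_card_mono[OF fQ, of "nbrs E Q z"] sub Q(2) by auto
      moreover have cs: "surplus E (insert z Q) = surplus E Q + 5 - 2 * int (card (nbrs E Q z))"
        "3 \<le> card (nbrs E Q z)"
        using candidate_surplus[OF QV _ cand] e by blast+
      ultimately have c3: "card (nbrs E Q z) = 3" by simp
      have start: "\<exists>c' L' M'. state X (insert z Q) c' L' M' \<and> inv_free (insert z Q) c' L' M'"
        by (rule one_step_free[OF no5 c(1) iv cand V1 X disjI2[OF c3]])
      have "surplus E (insert z Q) = 7" using cs(1) c3 s8 by simp
      show ?thesis
      proof (rule grow[OF _ _ e(1)])
        show "P (insert z Q)" unfolding P_def using start \<open>surplus E (insert z Q) = 7\<close> by simp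
        show "insert z Q \<subseteq> V" "e \<subseteq> insert z Q" using QV z e by auto
      qed
    next
      case False
      obtain e where e: "e \<in> E" using ne by blast
      obtain u v where uv: "e = {u, v}" using two[OF e] by (meson card_2_iff)
      note es = edge_state[OF e[unfolded uv]]
      show ?thesis
      proof (rule grow[OF _ _ e order_refl])
        have "inv_free e (\<lambda>_. 0) {} {}" unfolding inv_free_def using es(2,4) uv by simp
        then show "P e" unfolding P_def using es(1,3) uv False by blast
        show "e \<subseteq> V" using e by auto
      qed
    qed
    then obtain c L M where "state X V c L M" "inv_free V c L M" unfolding P_def by blast
    then show ?thesis by (intro fin[of c L M] disjI1)
  qed
qed

end

section \<open>Components of a sparse graph\<close>

context simple_graph
begin

definition linked :: "('a set \<times> 'a set) set" where
  "linked = {(e, h). \<exists>Q. card Q = 4 \<and> clique E Q \<and> e \<in> inner E Q \<and> h \<in> inner E Q}"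

definition k4_class :: "'a set \<Rightarrow> 'a set set" where
  "k4_class e = linked\<^sup>* `` {e}"

lemma k4_class_self: "e \<in> k4_class e"
  unfolding k4_class_def by blast

lemma k4_class_subset: "e \<in> E \<Longrightarrow> k4_class e \<subseteq> E"
proof
  fix h assume e: "e \<in> E" and "h \<in> k4_class e"
  then have "(e, h) \<in> linked\<^sup>*" unfolding k4_class_def by blast
  then show "h \<in> E" by (induction) (use e in \<open>auto simp: linked_def inner_def\<close>)
qed

lemma k4_class_eq:
  assumes "h \<in> k4_class e"
  shows "k4_class h = k4_class e"
proof -
  have "sym linked" unfolding linked_def sym_def by blast
  then have "sym (linked\<^sup>*)" by (rule sym_rtrancl)
  then have "(e, h) \<in> linked\<^sup>*" "(h, e) \<in> linked\<^sup>*" using assms unfolding k4_class_def by (auto dest: symD)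
  then show ?thesis unfolding k4_class_def by (auto intro: rtrancl_trans)
qed

lemma k4_class_inner_clique:
  assumes "card Q = 4" "clique E Q" "e \<in> inner E Q" "e \<in> k4_class f"
  shows "inner E Q \<subseteq> k4_class f" "clique (k4_class f) Q" "inner (k4_class f) Q = inner E Q"
proof -
  have "inner E Q \<subseteq> k4_class e" using assms(1-3) unfolding k4_class_def linked_def by blast
  then show sub: "inner E Q \<subseteq> k4_class f" using k4_class_eq[OF assms(4)] by simp
  show "clique (k4_class f) Q"
    unfolding clique_def
  proof (intro ballI impI)
    fix u v assume uv: "u \<in> Q" "v \<in> Q" "u \<noteq> v"
    then have "{u, v} \<in> inner E Q" using cliqueD[OF assms(2) uv] unfolding inner_def by auto
    then show "{u, v} \<in> k4_class f" using sub by blast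
  qed
  have "x \<in> E" if "x \<in> k4_class f" for x
    using k4_class_subset[of e] k4_class_eq[OF assms(4)] assms(3) that unfolding inner_def by blast
  then show "inner (k4_class f) Q = inner E Q" using sub unfolding inner_def by blast
qed

text \<open>A chain of links from an edge inside \<open>S\<close> to one not inside \<open>S\<close>
  has a link where it leaves; the 4-clique of this link shares an edge with
  \<open>S\<close>.\<close>

lemma k4_component_k4_class:
  assumes "f \<in> E"
  shows "k4_component (k4_class f)"
proof
  show "finite (k4_class f)" using k4_class_subset[OF assms] finE finite_subset by blast
  show "card e = 2" if "e \<in> k4_class f" for e using k4_class_subset[OF assms] two that by blast
  fix S e assume S: "S \<subset> \<Union> (k4_class f)" and e: "e \<in> k4_class f" "e \<subseteq> S"
  obtain h where h: "h \<in> k4_class f" "\<not> h \<subseteq> S" using S by blast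
  have "(e, h) \<in> linked\<^sup>*" using h(1) k4_class_eq[OF e(1)] unfolding k4_class_def by blast
  then have "h \<subseteq> S \<or> (\<exists>g g'. (e, g) \<in> linked\<^sup>* \<and> (g, g') \<in> linked \<and> g \<subseteq> S \<and> \<not> g' \<subseteq> S)"
    by induction (use e in blast)+
  then obtain g g' where g: "(e, g) \<in> linked\<^sup>*" "(g, g') \<in> linked" "g \<subseteq> S" "\<not> g' \<subseteq> S" using h by blast
  obtain Q where Q: "card Q = 4" "clique E Q" "g \<in> inner E Q" "g' \<in> inner E Q"
    using g(2) unfolding linked_def by blast
  have "g \<in> k4_class f" using g(1) k4_class_eq[OF e(1)] unfolding k4_class_def by blast
  note cQ = k4_class_inner_clique[OF Q(1-3) this]
  have "card g = 2" "g \<subseteq> Q \<inter> S" using Q(3) g(3) two unfolding inner_def by auto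
  moreover have "finite (Q \<inter> S)" using finite_of_card[OF Q(1)] by blast
  ultimately have "2 \<le> card (Q \<inter> S)" by (metis card_mono)
  moreover have "\<not> Q \<subseteq> S" using Q(4) g(4) unfolding inner_def by blast
  ultimately show "\<exists>Q. clique (k4_class f) Q \<and> card Q = 4 \<and> 2 \<le> card (Q \<inter> S) \<and> \<not> Q \<subseteq> S"
    using cQ(2) Q(1) by blast
qed

end

section \<open>Sparsity, bounded components and roots\<close>

definition weight :: "'a set set \<Rightarrow> int" where
  "weight F = 5 * int (card (\<Union>F)) - 2 * int (card F)"

lemma weight_eq_surplus: "weight F = surplus F (\<Union>F)"
proof -
  have "inner F (\<Union>F) = F" unfolding inner_def by blast
  then show ?thesis unfolding weight_def surplus_def by simp
qed

text \<open>The range \<open>2 * k + 4\<close> covers the union of two sets of size \<open>k\<close>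
  as well as a set of size \<open>k\<close> enlarged by a growth step. Within it, surplus at most 8
  brings the size back to \<open>k\<close>, which lets inductions on growing sets go
  through.\<close>

definition sparse :: "nat \<Rightarrow> 'a set set \<Rightarrow> bool" where
  "sparse k E \<longleftrightarrow> (\<forall>U. finite U \<longrightarrow> U \<noteq> {} \<longrightarrow> card U \<le> 2 * k + 4 \<longrightarrow>
     1 \<le> surplus E U \<and> (surplus E U \<le> 8 \<longrightarrow> card U \<le> k))"

context simple_graph
begin

lemma surplus_antimono: "F \<subseteq> E \<Longrightarrow> surplus E U \<le> surplus F U"
  unfolding surplus_def using card_mono[OF fin_inner[of U], of "inner F U"]
  unfolding inner_def by auto

lemma sparse_surplus:
  assumes "sparse k E" "F \<subseteq> E" "finite U" "U \<noteq> {}" "card U \<le> 2 * k + 4"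
  shows "1 \<le> surplus F U" "surplus F U \<le> 8 \<Longrightarrow> card U \<le> k"
  using assms surplus_antimono[OF assms(2), of U] unfolding sparse_def by force+

lemma sparse_weight:
  assumes "sparse k E" "F \<subseteq> E" "F \<noteq> {}" "card (\<Union>F) \<le> 2 * k + 4"
  shows "1 \<le> weight F" "weight F \<le> 8 \<Longrightarrow> card (\<Union>F) \<le> k"
proof -
  have fin: "finite (\<Union>F)" using finV assms(2) by (meson Union_mono finite_subset)
  obtain e where e: "e \<in> F" using assms(3) by blast
  then have "card e = 2" using assms(2) two by blast
  then have "\<Union>F \<noteq> {}" using e by fastforce
  note sp = sparse_surplus[OF assms(1,2) fin this assms(4), folded weight_eq_surplus]
  show "1 \<le> weight F" by (rule sp(1))
  show "weight F \<le> 8 \<Longrightarrow> card (\<Union>F) \<le> k" by (rule sp(2))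
qed

text \<open>The growth starts at surplus at most 8 and never raises it. Each step adds at most two
  vertices to a set of size at most \<open>k\<close>, so sparsity still applies and restores the
  bound \<open>k\<close>.\<close>

lemma k4_class_bounded:
  assumes sp: "sparse k E" and f: "f \<in> E"
  shows "card (\<Union>(k4_class f)) \<le> k" "1 \<le> weight (k4_class f)"
proof -
  interpret D: k4_component "k4_class f" by (rule k4_component_k4_class[OF f])
  note DE = k4_class_subset[OF f]
  note ss = sparse_surplus[OF sp DE]
  have c2: "card f = 2" using two f by blast
  have ff: "finite f" by (rule finite_of_card[OF c2])
  have "f \<in> inner (k4_class f) f" using k4_class_self unfolding inner_def by blast
  then have "1 \<le> card (inner (k4_class f) f)" using D.fin_inner by (simp add: Suc_le_eq card_gt_0_iff) blast
  then have s8: "surplus (k4_class f) f \<le> 8" using c2 unfolding surplus_def by simp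
  have fne: "f \<noteq> {}" using c2 by auto
  have V: "card (\<Union>(k4_class f)) \<le> k \<and> surplus (k4_class f) (\<Union>(k4_class f)) \<le> 8"
  proof (rule D.grow_induct[where P = "\<lambda>S. card S \<le> k \<and> surplus (k4_class f) S \<le> 8", OF _ _ k4_class_self])
    show "card f \<le> k \<and> surplus (k4_class f) f \<le> 8"
      using ss(2)[OF ff fne _ s8] c2 s8 by simp
    show "f \<subseteq> \<Union>(k4_class f)" "f \<subseteq> f" using k4_class_self by blast+
  next
    fix S z T
    assume *: "card S \<le> k \<and> surplus (k4_class f) S \<le> 8" "S \<subseteq> \<Union>(k4_class f)" "D.candidate S z T"
    have fin: "finite S" by (rule D.finS[OF *(2)])
    have s: "surplus (k4_class f) (insert z S) \<le> 8"
      using D.surplus_one_step[OF *(2,3)] *(1) by linarith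
    have "card (insert z S) \<le> 2 * k + 4" using *(1) fin by (simp add: card_insert_if)
    then show "card (insert z S) \<le> k \<and> surplus (k4_class f) (insert z S) \<le> 8"
      using s ss(2)[of "insert z S"] fin by blast
  next
    fix S u v x y
    assume *: "card S \<le> k \<and> surplus (k4_class f) S \<le> 8" "S \<subseteq> \<Union>(k4_class f)" "x \<in> \<Union>(k4_class f) - S"
      "y \<in> \<Union>(k4_class f) - S" "x \<noteq> y" "u \<in> S" "v \<in> S" "u \<noteq> v" "clique (k4_class f) {u, v, x, y}"
    have fin: "finite S" by (rule D.finS[OF *(2)])
    have s: "surplus (k4_class f) (insert y (insert x S)) \<le> 8"
      using D.surplus_two_step[OF *(2-9)] *(1) by linarith
    have "card (insert y (insert x S)) \<le> 2 * k + 4" using *(1) fin by (simp add: card_insert_if)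
    then show "card (insert y (insert x S)) \<le> k \<and> surplus (k4_class f) (insert y (insert x S)) \<le> 8"
      using s ss(2)[of "insert y (insert x S)"] fin by blast
  qed
  then show "card (\<Union>(k4_class f)) \<le> k" by blast
  show "1 \<le> weight (k4_class f)"
    by (rule sparse_weight(1)[OF sp DE]) (use k4_class_self V in auto)
qed

definition rooted :: "'a set set set \<Rightarrow> ('a set set \<Rightarrow> 'a option) \<Rightarrow> bool" where
  "rooted J \<rho> \<longleftrightarrow> (\<forall>D\<in>J. \<forall>v. \<rho> D = Some v \<longrightarrow> 3 \<le> weight D) \<and>
     (\<forall>D\<in>J. \<forall>D'\<in>J. \<forall>v. D \<noteq> D' \<longrightarrow> v \<in> \<Union>D \<inter> \<Union>D' \<longrightarrow> \<rho> D = Some v \<or> \<rho> D' = Some v)"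

lemma weight_Un:
  assumes "F \<subseteq> E" "D \<subseteq> E" "F \<inter> D = {}"
  shows "weight (F \<union> D) = weight F + weight D - 5 * int (card (\<Union>F \<inter> \<Union>D))"
proof -
  have fin: "finite F" "finite D" "finite (\<Union>F)" "finite (\<Union>D)"
    using assms(1,2) finE finV by (meson Union_mono finite_subset)+
  have "int (card (\<Union>F \<union> \<Union>D)) + int (card (\<Union>F \<inter> \<Union>D)) = int (card (\<Union>F)) + int (card (\<Union>D))"
    using card_Un_Int[OF fin(3,4)] by linarith
  moreover have "card (F \<union> D) = card F + card D" using card_Un_disjoint[OF fin(1,2) assms(3)] .
  ultimately show ?thesis unfolding weight_def by simp
qed

text \<open>Start from a member of minimal weight and keep adding members that meet what was collected so
  far. Sparsity forces each new member to meet it in a single vertex, which becomes its root, and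
  the collection never leaves the range in which sparsity applies.\<close>

lemma roots_exist:
  assumes sp: "sparse k E"
    and "finite I" "\<And>D. D \<in> I \<Longrightarrow> D \<subseteq> E \<and> D \<noteq> {} \<and> card (\<Union>D) \<le> k \<and> weight D \<le> 5"
    and "\<And>D D'. D \<in> I \<Longrightarrow> D' \<in> I \<Longrightarrow> D \<noteq> D' \<Longrightarrow> D \<inter> D' = {}"
  shows "\<exists>\<rho>. rooted I \<rho>"
  using assms(2-)
proof (induction "card I" arbitrary: I rule: less_induct)
  case less
  note fin = less.prems(1) and mem = less.prems(2) and dis = less.prems(3)
  show ?case
  proof (cases "I = {}")
    case True then show ?thesis unfolding rooted_def by blast
  next
    case False
    obtain D0 where D0: "D0 \<in> I" "\<And>D. D \<in> I \<Longrightarrow> weight D0 \<le> weight D"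
      using ex_min_if_finite[of "weight ` I"] fin False by (metis (no_types, lifting) finite_imageI image_iff image_is_empty linorder_not_le)
    \<comment> \<open>A maximal member of this family is a collection to which nothing can be added
      any more.\<close>
    define \<J> where "\<J> = {J. J \<subseteq> I \<and> J \<noteq> {} \<and> weight (\<Union>J) \<le> weight D0 \<and> card (\<Union>(\<Union>J)) \<le> k \<and> (\<exists>\<rho>. rooted J \<rho>)}"
    have "finite \<J>" unfolding \<J>_def using fin by (auto intro: finite_subset[of _ "Pow I"])
    moreover have "{D0} \<in> \<J>"
      unfolding \<J>_def using D0(1) mem by (auto simp: rooted_def intro!: exI[of _ "\<lambda>_. None"])
    ultimately obtain J where J: "J \<in> \<J>" "\<And>J'. J' \<in> \<J> \<Longrightarrow> J \<subseteq> J' \<Longrightarrow> J' = J"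
      using finite_has_maximal[of \<J>] by blast
    obtain \<rho> where JI: "J \<subseteq> I" "J \<noteq> {}" and spJ: "weight (\<Union>J) \<le> weight D0" and cJ: "card (\<Union>(\<Union>J)) \<le> k"
      and \<rho>: "rooted J \<rho>" using J(1) unfolding \<J>_def by blast
    have JE: "\<Union>J \<subseteq> E" using JI mem by blast
    obtain D1 where "D1 \<in> J" using JI by blast
    then have Jne: "\<Union>J \<noteq> {}" using mem[of D1] JI by blast
    have closed: "\<Union>(\<Union>J) \<inter> \<Union>D = {}" if D: "D \<in> I - J" for D
    proof (rule ccontr)
      assume ne: "\<not> ?thesis"
      have DI: "D \<in> I" "D \<notin> J" using D by auto
      have DE: "D \<subseteq> E" "card (\<Union>D) \<le> k" "weight D \<le> 5" using mem[OF DI(1)] by auto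
      have "\<Union>J \<inter> D = {}" using dis[OF _ DI(1)] JI DI(2) by blast
      note sU = weight_Un[OF JE DE(1) this]
      let ?F = "\<Union>J \<union> D"
      have UF: "\<Union>?F = \<Union>(\<Union>J) \<union> \<Union>D" by blast
      have "card (\<Union>?F) \<le> card (\<Union>(\<Union>J)) + card (\<Union>D)" unfolding UF by (rule card_Un_le)
      then have cF: "card (\<Union>?F) \<le> 2 * k + 4" using cJ DE by linarith
      have FE: "?F \<subseteq> E" "?F \<noteq> {}" using JE DE Jne by auto
      note sF = sparse_weight[OF sp FE cF]
      have finI: "finite (\<Union>(\<Union>J) \<inter> \<Union>D)" using finV DE(1) by (meson Union_mono finite_Int finite_subset)
      then have "card (\<Union>(\<Union>J) \<inter> \<Union>D) \<noteq> 0" using ne by simp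
      moreover have D0D: "weight D0 \<le> weight D" by (rule D0(2)[OF DI(1)])
      \<comment> \<open>With \<open>c\<close> shared vertices, 1 \<le> \<open>weight ?F\<close>
        \<le> \<open>2 * weight D - 5 * c\<close> and \<open>weight D \<le> 5\<close>. So
        \<open>c = 1\<close>, and then \<open>weight D \<ge> 3\<close>.\<close>
      ultimately have c1: "card (\<Union>(\<Union>J) \<inter> \<Union>D) = 1" and s3: "3 \<le> weight D"
        using sF(1) sU spJ DE(3) by linarith+
      obtain v where v: "\<Union>(\<Union>J) \<inter> \<Union>D = {v}" using c1 card_1_singletonE by blast
      \<comment> \<open>The shared vertex takes away 5, at least what \<open>D\<close>
        contributes.\<close>
      have sF5: "weight ?F \<le> weight D0" using sU c1 spJ DE(3) by linarith
      have "weight ?F \<le> 8" using sF5 D0D DE(3) by linarith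
      then have cF': "card (\<Union>?F) \<le> k" by (rule sF(2))
      have UJ: "\<Union>(insert D J) = ?F" by blast
      have "rooted (insert D J) (\<rho>(D := Some v))"
        unfolding rooted_def
      proof (intro conjI ballI allI impI)
        fix D' w assume "D' \<in> insert D J" "(\<rho>(D := Some v)) D' = Some w"
        then show "3 \<le> weight D'" using s3 \<rho> unfolding rooted_def by (cases "D' = D") auto
      next
        fix D1 D2 w assume a: "D1 \<in> insert D J" "D2 \<in> insert D J" "D1 \<noteq> D2" "w \<in> \<Union>D1 \<inter> \<Union>D2"
        consider "D1 = D" "D2 \<in> J" | "D2 = D" "D1 \<in> J" | "D1 \<in> J" "D2 \<in> J" using a by blast
        then show "(\<rho>(D := Some v)) D1 = Some w \<or> (\<rho>(D := Some v)) D2 = Some w"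
        proof cases
          case 1
          then have "w \<in> \<Union>(\<Union>J) \<inter> \<Union>D" using a(4) by blast
          then show ?thesis using v 1 by auto
        next
          case 2
          then have "w \<in> \<Union>(\<Union>J) \<inter> \<Union>D" using a(4) by blast
          then show ?thesis using v 2 by auto
        next
          case 3
          then have "D1 \<noteq> D" "D2 \<noteq> D" using DI(2) by auto
          moreover have "\<rho> D1 = Some w \<or> \<rho> D2 = Some w" using \<rho> 3 a(3,4) unfolding rooted_def by blast
          ultimately show ?thesis by simp
        qed
      qed
      then have "insert D J \<in> \<J>"
        unfolding \<J>_def UJ mem_Collect_eq using DI(1) JI(1) sF5 cF' by (intro conjI exI) auto
      then show False using J(2)[of "insert D J"] DI(2) by blast
    qed
    \<comment> \<open>By \<open>closed\<close>, members inside and outside the maximal collection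
      have no common vertex, so the rest can be rooted independently.\<close>
    have "card (I - J) < card I" using JI fin by (intro psubset_card_mono) auto
    then obtain \<sigma> where \<sigma>: "rooted (I - J) \<sigma>"
      using less.hyps[of "I - J"] fin mem dis by blast
    have "rooted I (\<lambda>D. if D \<in> J then \<rho> D else \<sigma> D)"
      unfolding rooted_def
    proof (intro conjI ballI allI impI)
      fix D v assume "D \<in> I" "(if D \<in> J then \<rho> D else \<sigma> D) = Some v"
      then show "3 \<le> weight D" using \<rho> \<sigma> unfolding rooted_def by (cases "D \<in> J") auto
    next
      fix D D' v assume a: "D \<in> I" "D' \<in> I" "D \<noteq> D'" "v \<in> \<Union>D \<inter> \<Union>D'"
      consider "D \<in> J" "D' \<in> J" | "D \<in> J" "D' \<in> I - J" | "D \<in> I - J" "D' \<in> J" | "D \<in> I - J" "D' \<in> I - J"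
        using a by blast
      then show "(if D \<in> J then \<rho> D else \<sigma> D) = Some v \<or> (if D' \<in> J then \<rho> D' else \<sigma> D') = Some v"
      proof cases
        case 1
        then have "\<rho> D = Some v \<or> \<rho> D' = Some v" using \<rho> a(3,4) unfolding rooted_def by blast
        then show ?thesis using 1 by simp
      next
        case 2
        then show ?thesis using closed[of D'] a(4) by blast
      next
        case 3
        then show ?thesis using closed[of D] a(4) by blast
      next
        case 4
        then have "\<sigma> D = Some v \<or> \<sigma> D' = Some v" using \<sigma> a(3,4) unfolding rooted_def by blast
        then show ?thesis using 4 by simp
      qed
    qed
    then show ?thesis by blast
  qed
qed

end

section \<open>Colouring the whole graph\<close>

definition colouring :: "'a set set \<Rightarrow> ('a set \<Rightarrow> 'b) \<Rightarrow> bool" where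
  "colouring H c \<longleftrightarrow> (\<forall>e\<in>H. \<forall>h\<in>H. e \<noteq> h \<longrightarrow> c e = c h \<longrightarrow> e \<inter> h = {})"

context simple_graph
begin

text \<open>All edges of a 4-clique are linked, so each 4-clique is treated by the local colouring
  of a single class. The local matchings fit together since two of them could meet only in a root
  that one of them avoids.\<close>

lemma clique_hit_or_repeated:
  assumes sp: "sparse k E"
  shows "\<exists>(M :: 'a set set) (c :: 'a set \<Rightarrow> 'a set set \<times> nat). M \<subseteq> E \<and> matching_avoiding {} M \<and> colouring E c \<and>
    (\<forall>Q. card Q = 4 \<longrightarrow> clique E Q \<longrightarrow>
      hit M Q \<or> repeats c (inner E Q - M))"
proof -
  define \<D> where "\<D> = k4_class ` E"
  have fin: "finite \<D>" unfolding \<D>_def using finE by simp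
  have D: "D \<subseteq> E" "D \<noteq> {}" "card (\<Union>D) \<le> k" "1 \<le> weight D" "k4_component D" if "D \<in> \<D>" for D
  proof -
    obtain f where f: "f \<in> E" "D = k4_class f" using \<open>D \<in> \<D>\<close> unfolding \<D>_def by blast
    show "D \<subseteq> E" "D \<noteq> {}" "card (\<Union>D) \<le> k" "1 \<le> weight D" "k4_component D"
      using f k4_class_subset k4_class_self[of f] k4_class_bounded[OF sp f(1)] k4_component_k4_class by auto
  qed
  have own: "k4_class e = D" if "e \<in> D" "D \<in> \<D>" for e D
    using that k4_class_eq[of e] unfolding \<D>_def by blast
  have dis: "D = D'" if "D \<in> \<D>" "D' \<in> \<D>" "e \<in> D" "e \<in> D'" for D D' e
    using own[OF that(3,1)] own[OF that(4,2)] by simp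
  have "\<exists>\<rho>. rooted {D\<in>\<D>. weight D \<le> 5} \<rho>"
  proof (rule roots_exist[OF sp])
    show "finite {D \<in> \<D>. weight D \<le> 5}" using fin by simp
    show "D \<subseteq> E \<and> D \<noteq> {} \<and> card (\<Union>D) \<le> k \<and> weight D \<le> 5" if "D \<in> {D \<in> \<D>. weight D \<le> 5}" for D
      using D that by blast
    show "D \<inter> D' = {}" if "D \<in> {D \<in> \<D>. weight D \<le> 5}" "D' \<in> {D \<in> \<D>. weight D \<le> 5}" "D \<noteq> D'" for D D'
      using dis that by blast
  qed
  then obtain \<rho> where \<rho>: "rooted {D\<in>\<D>. weight D \<le> 5} \<rho>" by blast
  \<comment> \<open>Above weight 5 no root is necessary, because \<open>M\<close> is empty
    there.\<close>
  define X where "X D = (if weight D \<le> 5 then set_option (\<rho> D) else {})" for D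
  define ok where "ok D c M \<longleftrightarrow> (\<forall>e\<in>D. \<forall>h\<in>D. e \<noteq> h \<longrightarrow> c e = c h \<longrightarrow> e \<inter> h = {}) \<and>
      M \<subseteq> D \<and> matching_avoiding (X D) M \<and> (M \<noteq> {} \<longrightarrow> surplus D (\<Union>D) \<le> 5) \<and>
      (\<forall>Q. card Q = 4 \<longrightarrow> clique D Q \<longrightarrow>
        hit M Q \<or> repeats c (inner D Q))" for D and c :: "'a set \<Rightarrow> nat" and M
  have "\<exists>c M. ok D c M" if "D \<in> \<D>" for D
    unfolding ok_def
  proof (rule k4_component.local_colouring[OF D(5)[OF that] D(2)[OF that]])
    show "1 \<le> surplus D (\<Union>D)" using D(4)[OF that] unfolding weight_eq_surplus .
    show "X D = {} \<or> (\<exists>r. X D = {r} \<and> 3 \<le> surplus D (\<Union>D))"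
    proof (cases "weight D \<le> 5 \<and> \<rho> D \<noteq> None")
      case True
      then obtain r where r: "\<rho> D = Some r" by blast
      then have "3 \<le> weight D" using \<rho> True that unfolding rooted_def by blast
      then show ?thesis using r True unfolding X_def weight_eq_surplus by simp
    next
      case False then show ?thesis unfolding X_def by auto
    qed
  qed
  then obtain c M where cM: "\<And>D. D \<in> \<D> \<Longrightarrow> ok D (c D) (M D)" by metis
  have M: "M D \<subseteq> D" "matching_avoiding (X D) (M D)" "M D \<noteq> {} \<Longrightarrow> weight D \<le> 5" if "D \<in> \<D>" for D
    using cM[OF that] unfolding ok_def weight_eq_surplus by auto
  define N where "N = (\<Union>D\<in>\<D>. M D)"
  \<comment> \<open>Recording the class keeps the colours of different classes apart.\<close>
  define \<kappa> where "\<kappa> e = (k4_class e, c (k4_class e) e)" for e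
  have "N \<subseteq> E" unfolding N_def using M(1) D(1) by blast
  moreover have "matching_avoiding {} N"
    unfolding matching_avoiding_def
  proof (intro conjI ballI impI)
    fix e h assume eh: "e \<in> N" "h \<in> N" "e \<noteq> h"
    then obtain D D' where DD: "D \<in> \<D>" "e \<in> M D" "D' \<in> \<D>" "h \<in> M D'" unfolding N_def by blast
    show "e \<inter> h = {}"
    proof (cases "D = D'")
      case True then show ?thesis using M(2)[OF DD(1)] DD eh(3) unfolding matching_avoiding_def by blast
    next
      case False
      have w: "weight D \<le> 5" "weight D' \<le> 5" using M(3)[of D] M(3)[of D'] DD by auto
      show ?thesis
      proof (rule ccontr)
        assume "e \<inter> h \<noteq> {}"
        then obtain v where v: "v \<in> e" "v \<in> h" by blast
        then have "v \<in> \<Union>D \<inter> \<Union>D'" using M(1) DD by blast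
        then have "\<rho> D = Some v \<or> \<rho> D' = Some v" using \<rho> DD w False unfolding rooted_def by blast
        then have "v \<in> X D \<or> v \<in> X D'" using w unfolding X_def by auto
        moreover have "\<Union>(M D) \<inter> X D = {}" "\<Union>(M D') \<inter> X D' = {}"
          using M(2)[OF DD(1)] M(2)[OF DD(3)] unfolding matching_avoiding_def by auto
        moreover have "v \<in> \<Union>(M D)" "v \<in> \<Union>(M D')" using v DD by auto
        ultimately show False by auto
      qed
    qed
  qed simp
  moreover have "colouring E \<kappa>"
    unfolding colouring_def
  proof (intro ballI impI)
    fix e h assume eh: "e \<in> E" "h \<in> E" "e \<noteq> h" "\<kappa> e = \<kappa> h"
    have De: "k4_class e \<in> \<D>" using eh(1) unfolding \<D>_def by blast
    have eq: "k4_class e = k4_class h" "c (k4_class e) e = c (k4_class e) h" using eh(4) unfolding \<kappa>_def by auto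
    have "e \<in> k4_class e" "h \<in> k4_class e" using k4_class_self[of e] k4_class_self[of h] eq(1) by auto
    moreover have "\<forall>e'\<in>k4_class e. \<forall>h\<in>k4_class e. e' \<noteq> h \<longrightarrow> c (k4_class e) e' = c (k4_class e) h \<longrightarrow> e' \<inter> h = {}"
      using cM[OF De] unfolding ok_def by (rule conjunct1)
    ultimately show "e \<inter> h = {}" using eq(2) eh(3) by blast
  qed
  moreover have "hit N Q \<or> repeats \<kappa> (inner E Q - N)"
    if Q: "card Q = 4" "clique E Q" for Q
  proof (cases "hit N Q")
    case nh: False
    obtain u where u: "u \<in> Q" using Q(1) by fastforce
    have "Q \<noteq> {u}" using Q(1) by auto
    then obtain v where v: "v \<in> Q" "v \<noteq> u" using u by blast
    have f: "{u, v} \<in> inner E Q" using cliqueD[OF Q(2) u v(1)] u v unfolding inner_def by auto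
    define D where "D = k4_class {u, v}"
    have DD: "D \<in> \<D>" using f unfolding D_def \<D>_def inner_def by blast
    note cQ = k4_class_inner_clique[OF Q f k4_class_self, folded D_def]
    have "\<not> hit (M D) Q" using nh DD hit_mono[of "M D" Q N Q] unfolding N_def by blast
    then obtain e h where eh: "e \<in> inner D Q" "h \<in> inner D Q" "e \<noteq> h" "c D e = c D h"
      using cM[OF DD] Q(1) cQ(2) unfolding ok_def by blast
    then have "e \<in> D" "h \<in> D" unfolding inner_def by auto
    then have "\<kappa> e = \<kappa> h" using own[OF _ DD] eh(4) unfolding \<kappa>_def by simp
    moreover have "e \<notin> N" "h \<notin> N" using nh eh(1,2) unfolding hit_def inner_def by blast+
    moreover have "e \<in> inner E Q" "h \<in> inner E Q" using eh(1,2) cQ(3) by auto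
    ultimately show ?thesis using eh(3) by blast
  qed simp
  ultimately show ?thesis by (intro exI[of _ N] exI[of _ \<kappa>] conjI allI impI)
qed

end

text \<open>A rainbow 8-clique has at most one edge in \<open>M\<close>, whose edges all have the
  same colour. Yet each of its 4-subsets inside one part contains an edge of \<open>M\<close>, the
  alternative being a repeated colour.\<close>

theorem rainbow_clique_free_colouring:
  fixes H :: "'a set set" and A :: "'a set"
  assumes finH: "finite H" and twoH: "\<And>e. e \<in> H \<Longrightarrow> card e = 2"
    and sp: "sparse k {e \<in> H. e \<subseteq> A \<or> e \<inter> A = {}}"
  shows "\<exists>c :: 'a set \<Rightarrow> nat. colouring H c \<and>
    (\<forall>W. card W = 8 \<longrightarrow> clique H W \<longrightarrow> \<not> inj_on c (inner H W))"
proof -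
  define E where "E = {e \<in> H. e \<subseteq> A \<or> e \<inter> A = {}}"
  interpret simple_graph E using finH twoH by unfold_locales (auto simp: E_def)
  obtain M c where M: "M \<subseteq> E" "matching_avoiding {} M" and c: "colouring E (c :: 'a set \<Rightarrow> 'a set set \<times> nat)"
    and Q: "\<And>Q. card Q = 4 \<Longrightarrow> clique E Q \<Longrightarrow>
      hit M Q \<or> repeats c (inner E Q - M)"
    using clique_hit_or_repeated[OF sp[folded E_def]] by blast
  \<comment> \<open>\<open>None\<close> is the common colour of \<open>M\<close>. Edges between the
    parts get private colours \<open>Inr e\<close>, which are of no use to a repetition and cannot
    spoil properness.\<close>
  define \<kappa> where "\<kappa> e = (if e \<in> M then None else Some (if e \<in> E then Inl (c e) else Inr e))" for e
  obtain f :: "_ \<Rightarrow> nat" where f: "inj_on f (\<kappa> ` H)"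
    using finite_imp_inj_to_nat_seg[of "\<kappa> ` H"] finH by blast
  have EH: "E \<subseteq> H" unfolding E_def by blast
  have "colouring H (f \<circ> \<kappa>)"
    unfolding colouring_def
  proof (intro ballI impI)
    fix e h assume eh: "e \<in> H" "h \<in> H" "e \<noteq> h" "(f \<circ> \<kappa>) e = (f \<circ> \<kappa>) h"
    have eq: "\<kappa> e = \<kappa> h" by (rule inj_onD[OF f]) (use eh in auto)
    then consider "e \<in> M" "h \<in> M" | "e \<in> E" "h \<in> E" "c e = c h"
      using eh(3) unfolding \<kappa>_def by (auto split: if_splits)
    then show "e \<inter> h = {}"
    proof cases
      case 1 then show ?thesis using M(2) eh(3) unfolding matching_avoiding_def by blast
    next
      case 2 then show ?thesis using c eh(3) unfolding colouring_def by blast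
    qed
  qed
  moreover have "\<not> inj_on (f \<circ> \<kappa>) (inner H W)" if W: "card W = 8" "clique H W" for W
  proof
    assume "inj_on (f \<circ> \<kappa>) (inner H W)"
    then have inj: "inj_on \<kappa> (inner H W)" by (rule inj_on_imageI2)
    have finW: "finite W" by (rule finite_of_card[OF W(1)])
    have one: "e = h" if "e \<in> M" "h \<in> M" "e \<subseteq> W" "h \<subseteq> W" for e h
      using inj_onD[OF inj, of e h] that M(1) EH unfolding \<kappa>_def inner_def by auto
    have hitting: "hit M Q'" if Q': "Q' \<subseteq> W" "card Q' = 4" "clique E Q'" for Q'
    proof (rule ccontr)
      assume "\<not> hit M Q'"
      then obtain e h where eh: "e \<in> inner E Q' - M" "h \<in> inner E Q' - M" "e \<noteq> h" "c e = c h"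
        using Q[OF Q'(2,3)] by blast
      then have "\<kappa> e = \<kappa> h" "e \<in> inner H W" "h \<in> inner H W"
        using Q'(1) EH unfolding \<kappa>_def inner_def by auto
      then show False using inj_onD[OF inj] eh(3) by blast
    qed
    have side: "clique E U" if "U \<subseteq> W" "U \<subseteq> A \<or> U \<inter> A = {}" for U
      using that clique_subset[OF W(2)] unfolding clique_def E_def by blast
    \<comment> \<open>Deleting \<open>x\<close> leaves a 4-clique containing an edge
      \<open>e\<close> of \<open>M\<close>; deleting a vertex of \<open>e\<close> instead leaves one
      containing a different edge of \<open>M\<close>.\<close>
    have five: False if U: "U \<subseteq> W" "U \<subseteq> A \<or> U \<inter> A = {}" "5 \<le> card U" for U
    proof -
      obtain U' where U': "U' \<subseteq> U" "card U' = 5" by (rule obtain_subset_with_card_n[OF U(3)])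
      have hit4: "hit M (U' - {x})" if "x \<in> U'" for x
      proof (rule hitting)
        show "card (U' - {x}) = 4" using U'(2) that finite_of_card[OF U'(2)] by simp
        show "U' - {x} \<subseteq> W" using U' U by blast
        show "clique E (U' - {x})" by (rule side) (use U' U in blast)+
      qed
      obtain x where x: "x \<in> U'" using U'(2) by fastforce
      obtain e where e: "e \<in> M" "e \<subseteq> U' - {x}" using hit4[OF x] unfolding hit_def by blast
      have "e \<noteq> {}" using two M(1) e(1) by fastforce
      then obtain y where y: "y \<in> e" by blast
      then have "y \<in> U'" using e(2) by blast
      then obtain h where h: "h \<in> M" "h \<subseteq> U' - {y}" using hit4[of y] unfolding hit_def by blast
      have "e = h" by (rule one) (use e h U' U in blast)+
      then show False using h(2) y by blast
    qed
    have "card (W \<inter> A) + card (W - A) = 8" using W(1) card_Int_Diff[OF finW, of A] by linarith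
    moreover have "\<not> 5 \<le> card (W \<inter> A)" "\<not> 5 \<le> card (W - A)" using five[of "W \<inter> A"] five[of "W - A"] by blast+
    ultimately have c4: "card (W \<inter> A) = 4" "card (W - A) = 4" by linarith+
    have "hit M (W \<inter> A)" by (rule hitting[OF _ c4(1) side]) blast+
    moreover have "hit M (W - A)" by (rule hitting[OF _ c4(2) side]) blast+
    ultimately obtain e h where eh: "e \<in> M" "e \<subseteq> W \<inter> A" "h \<in> M" "h \<subseteq> W - A" unfolding hit_def by blast
    then have "e = h" by (intro one) blast+
    then have "e = {}" using eh by blast
    then show False using two[of e] eh(1) M(1) by auto
  qed
  ultimately show ?thesis by blast
qed

section \<open>The random graph\<close>

lemma finite_all_edges: "finite (all_edges n)"
  by (rule finite_subset[of _ "Pow {..<n}"]) (auto simp: all_edges_def)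

lemma all_edgesD:
  assumes "e \<in> all_edges n"
  shows "card e = 2" "e \<subseteq> {..<n}"
  using assms unfolding all_edges_def by auto

text \<open>Expanding the product over all edges of \<open>p + g x\<close> gives the sum over all
  graphs; \<open>g\<close> vanishes on \<open>F\<close>, which removes the graphs that do not
  contain \<open>F\<close>.\<close>

lemma gnp_prob_superset:
  assumes "F \<subseteq> all_edges n"
  shows "gnp_prob n p (\<lambda>R. F \<subseteq> R) = p ^ card F"
proof -
  let ?A = "all_edges n"
  define g where "g x = (if x \<in> F then 0 else 1 - p)" for x
  note fA = finite_all_edges[of n]
  have g: "prod g (?A - X) = (if F \<subseteq> X then (1 - p) ^ (card ?A - card X) else 0)" if X: "X \<in> Pow ?A" for X
  proof (cases "F \<subseteq> X")
    case True
    have "prod g (?A - X) = (\<Prod>x\<in>?A - X. 1 - p)"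
      by (rule prod.cong) (use True in \<open>auto simp: g_def\<close>)
    also have "\<dots> = (1 - p) ^ (card ?A - card X)"
      using X fA by (simp add: card_Diff_subset finite_subset)
    finally show ?thesis using True by simp
  next
    case False
    then obtain x where "x \<in> F" "x \<notin> X" by blast
    then have "x \<in> ?A - X" "g x = 0" using assms unfolding g_def by auto
    then have "prod g (?A - X) = 0" using fA by (meson finite_Diff prod_zero)
    then show ?thesis using False by simp
  qed
  have "gnp_prob n p (\<lambda>R. F \<subseteq> R) = (\<Sum>X\<in>Pow ?A. (\<Prod>x\<in>X. p) * prod g (?A - X))"
    unfolding gnp_prob_def by (rule sum.cong) (auto simp: g)
  also have "\<dots> = (\<Prod>x\<in>?A. p + g x)" by (rule prod_add[OF fA, symmetric])
  also have "\<dots> = (\<Prod>x\<in>?A. if x \<in> F then p else 1)" unfolding g_def by (rule prod.cong) auto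
  also have "\<dots> = (\<Prod>x\<in>?A \<inter> F. p)" by (rule prod.inter_restrict[OF fA, symmetric])
  also have "\<dots> = p ^ card F" using assms by (simp add: Int_absorb1)
  finally show ?thesis .
qed

lemma gnp_prob_mono:
  assumes "0 \<le> p" "p \<le> 1" "\<And>R. R \<subseteq> all_edges n \<Longrightarrow> P R \<Longrightarrow> Q R"
  shows "gnp_prob n p P \<le> gnp_prob n p Q"
  unfolding gnp_prob_def using assms by (intro sum_mono) auto

lemma gnp_prob_True: "gnp_prob n p (\<lambda>R. True) = 1"
  using gnp_prob_superset[of "{}" n p] by simp

lemma gnp_prob_not: "gnp_prob n p (\<lambda>R. \<not> P R) = 1 - gnp_prob n p P"
proof -
  have "gnp_prob n p (\<lambda>R. \<not> P R) + gnp_prob n p P = gnp_prob n p (\<lambda>R. True)"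
    unfolding gnp_prob_def sum.distrib[symmetric] by (rule sum.cong) auto
  then show ?thesis using gnp_prob_True[of n p] by simp
qed

lemma gnp_prob_Bex_le:
  assumes "finite I" "0 \<le> p" "p \<le> 1"
  shows "gnp_prob n p (\<lambda>R. \<exists>i\<in>I. Q i R) \<le> (\<Sum>i\<in>I. gnp_prob n p (Q i))"
proof -
  define w where "w R = p ^ card R * (1 - p) ^ (card (all_edges n) - card R)" for R :: "nat set set"
  have w: "0 \<le> w R" for R unfolding w_def using assms by simp
  have "gnp_prob n p (\<lambda>R. \<exists>i\<in>I. Q i R) \<le> (\<Sum>R\<in>Pow (all_edges n). \<Sum>i\<in>I. if Q i R then w R else 0)"
    unfolding gnp_prob_def w_def[symmetric]
  proof (rule sum_mono)
    fix R
    show "(if \<exists>i\<in>I. Q i R then w R else 0) \<le> (\<Sum>i\<in>I. if Q i R then w R else 0)"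
    proof (cases "\<exists>i\<in>I. Q i R")
      case True
      then obtain i where i: "i \<in> I" "Q i R" by blast
      then have "(if Q i R then w R else 0) \<le> (\<Sum>i\<in>I. if Q i R then w R else 0)"
        using w assms(1) by (intro member_le_sum) auto
      then show ?thesis using i True by simp
    next
      case False then show ?thesis using w by (simp add: sum_nonneg)
    qed
  qed
  also have "\<dots> = (\<Sum>i\<in>I. gnp_prob n p (Q i))"
    unfolding gnp_prob_def w_def[symmetric] by (rule sum.swap)
  finally show ?thesis .
qed

section \<open>The first moment bound\<close>

definition locally_sparse :: "nat \<Rightarrow> real \<Rightarrow> nat \<Rightarrow> nat set set \<Rightarrow> bool" where
  "locally_sparse n a K R \<longleftrightarrow>
     (\<forall>U\<subseteq>{..<n}. card U \<le> K \<longrightarrow> a * real (card (inner R U)) \<le> real (card U))"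

text \<open>There are at most \<open>n ^ s\<close> sets of size \<open>s\<close>, so each of the
  \<open>K + 1\<close> sizes contributes at most 1.\<close>

lemma sum_small_subsets_le:
  assumes "n \<ge> 1"
  shows "(\<Sum>U\<in>{U. U \<subseteq> {..<n} \<and> card U \<le> K}. real n powr - real (card U)) \<le> real K + 1"
proof -
  let ?I = "\<lambda>s. {U. U \<subseteq> {..<n} \<and> card U = s}"
  have fin: "finite (?I s)" for s by (rule finite_subset[of _ "Pow {..<n}"]) auto
  have "{U. U \<subseteq> {..<n} \<and> card U \<le> K} = (\<Union>s\<in>{..K}. ?I s)" by auto
  then have "(\<Sum>U\<in>{U. U \<subseteq> {..<n} \<and> card U \<le> K}. real n powr - real (card U))
      = (\<Sum>s\<le>K. \<Sum>U\<in>?I s. real n powr - real (card U))"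
    using fin by (simp only:) (rule sum.UNION_disjoint, auto)
  also have "\<dots> \<le> (\<Sum>s\<le>K. 1)"
  proof (rule sum_mono)
    fix s
    have "(\<Sum>U\<in>?I s. real n powr - real (card U)) = (\<Sum>U\<in>?I s. real n powr - real s)"
      by (rule sum.cong) auto
    also have "\<dots> = real (n choose s) * real n powr - real s"
      using n_subsets[of "{..<n}" s] by simp
    also have "\<dots> \<le> real n ^ s * real n powr - real s"
    proof (rule mult_right_mono)
      have "n choose s \<le> n ^ s" by (cases "s \<le> n") (auto simp: binomial_le_pow binomial_eq_0)
      then show "real (n choose s) \<le> real n ^ s" by (metis of_nat_le_iff of_nat_power)
    qed simp
    also have "\<dots> = 1" using assms by (simp add: powr_minus powr_realpow)
    finally show "(\<Sum>U\<in>?I s. real n powr - real (card U)) \<le> 1" .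
  qed
  finally show ?thesis by simp
qed

text \<open>A union bound over vertex sets \<open>U\<close> and edge sets \<open>F\<close> that are
  too large for \<open>U\<close>. With \<open>s\<close> vertices and \<open>t\<close> edges such an
  \<open>F\<close> appears with probability \<open>n powr (- a * t)\<close>, which is at most
  \<open>n powr (- s - \<delta>)\<close>. The first part of the exponent pays for the choice of
  \<open>U\<close>, and \<open>F\<close> has only a constant number of choices.\<close>

lemma gnp_prob_not_locally_sparse_le:
  assumes n: "n \<ge> 1" and a: "0 < a"
    and \<delta>: "\<And>s t :: nat. s \<le> K \<Longrightarrow> t \<le> 2 ^ K \<Longrightarrow> real s < a * real t \<Longrightarrow> real s + \<delta> \<le> a * real t"
  shows "gnp_prob n (real n powr - a) (\<lambda>R. \<not> locally_sparse n a K R)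
    \<le> (real K + 1) * 2 ^ (2 ^ K) * real n powr - \<delta>"
proof -
  let ?p = "real n powr - a"
  let ?B = "{U. U \<subseteq> {..<n} \<and> card U \<le> K}"
  define I where "I = {(U, F). U \<in> ?B \<and> F \<subseteq> all_edges n \<inter> Pow U \<and> real (card U) < a * real (card F)}"
  have finB: "finite ?B" by (rule finite_subset[of _ "Pow {..<n}"]) auto
  have finU: "finite U" if "U \<in> ?B" for U using that by (auto intro: finite_subset)
  have finS: "finite (Sigma ?B (\<lambda>U. Pow (Pow U)))"
    by (intro finite_SigmaI finB) (simp only: finite_Pow_iff finU)
  have IS: "I \<subseteq> Sigma ?B (\<lambda>U. Pow (Pow U))"
  proof
    fix i assume "i \<in> I"
    then obtain U F where "i = (U, F)" "U \<in> ?B" "F \<subseteq> Pow U" unfolding I_def by blast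
    then show "i \<in> Sigma ?B (\<lambda>U. Pow (Pow U))" by simp
  qed
  have finI: "finite I" using finS IS finite_subset by blast
  have p: "0 \<le> ?p" "?p \<le> 1" using n a powr_mono[of "- a" 0 "real n"] by auto
  have "gnp_prob n ?p (\<lambda>R. \<not> locally_sparse n a K R) \<le> gnp_prob n ?p (\<lambda>R. \<exists>i\<in>I. snd i \<subseteq> R)"
  proof (rule gnp_prob_mono[OF p])
    fix R assume R: "R \<subseteq> all_edges n" "\<not> locally_sparse n a K R"
    then obtain U where U: "U \<subseteq> {..<n}" "card U \<le> K" "real (card U) < a * real (card (inner R U))"
      unfolding locally_sparse_def by (auto simp: not_le)
    then have "(U, inner R U) \<in> I" unfolding I_def using R(1) by (auto simp: inner_def)
    moreover have "inner R U \<subseteq> R" unfolding inner_def by blast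
    ultimately show "\<exists>i\<in>I. snd i \<subseteq> R" by force
  qed
  also have "\<dots> \<le> (\<Sum>i\<in>I. gnp_prob n ?p (\<lambda>R. snd i \<subseteq> R))"
    by (rule gnp_prob_Bex_le[OF finI p])
  also have "\<dots> \<le> (\<Sum>i\<in>I. real n powr - real (card (fst i)) * real n powr - \<delta>)"
  proof (rule sum_mono)
    fix i assume "i \<in> I"
    then obtain U F where i: "i = (U, F)" and UF: "U \<subseteq> {..<n}" "card U \<le> K" "F \<subseteq> all_edges n" "F \<subseteq> Pow U"
      "real (card U) < a * real (card F)" unfolding I_def by auto
    have fU: "finite U" using UF(1) finite_subset by blast
    have "card F \<le> card (Pow U)" by (rule card_mono[OF _ UF(4)]) (simp add: fU)
    also have "\<dots> = 2 ^ card U" using fU by (simp add: card_Pow)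
    also have "\<dots> \<le> 2 ^ K" using UF(2) by simp
    finally have "real (card U) + \<delta> \<le> a * real (card F)" using \<delta> UF(2,5) by blast
    have "gnp_prob n ?p (\<lambda>R. snd i \<subseteq> R) = ?p ^ card F" unfolding i using gnp_prob_superset[OF UF(3)] by simp
    also have "\<dots> = real n powr (- a * real (card F))"
      using n by (simp add: powr_power mult.commute)
    also have "\<dots> \<le> real n powr (- real (card U) + - \<delta>)"
      using n \<open>real (card U) + \<delta> \<le> a * real (card F)\<close> by (intro powr_mono) auto
    also have "\<dots> = real n powr - real (card (fst i)) * real n powr - \<delta>" unfolding i powr_add by simp
    finally show "gnp_prob n ?p (\<lambda>R. snd i \<subseteq> R) \<le> real n powr - real (card (fst i)) * real n powr - \<delta>" .
  qed
  also have "\<dots> \<le> (\<Sum>i\<in>Sigma ?B (\<lambda>U. Pow (Pow U)). real n powr - real (card (fst i)) * real n powr - \<delta>)"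
    by (rule sum_mono2[OF finS IS]) simp
  also have "\<dots> = (\<Sum>U\<in>?B. \<Sum>F\<in>Pow (Pow U). real n powr - real (card U) * real n powr - \<delta>)"
    by (subst sum.Sigma[OF finB], intro ballI, simp only: finite_Pow_iff finU, simp only: case_prod_unfold)
  also have "\<dots> \<le> (\<Sum>U\<in>?B. 2 ^ (2 ^ K) * real n powr - \<delta> * real n powr - real (card U))"
  proof (rule sum_mono)
    fix U assume U: "U \<in> ?B"
    have "card (Pow (Pow U)) = 2 ^ (2 ^ card U)" using finU[OF U] by (simp add: card_Pow)
    also have "\<dots> \<le> 2 ^ (2 ^ K)" using U by (intro power_increasing) auto
    finally have "real (card (Pow (Pow U))) \<le> real (2 ^ (2 ^ K))" by (simp only: of_nat_le_iff)
    then have "real (card (Pow (Pow U))) * (real n powr - real (card U) * real n powr - \<delta>)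
        \<le> 2 ^ (2 ^ K) * (real n powr - real (card U) * real n powr - \<delta>)"
      by (intro mult_right_mono) auto
    then show "(\<Sum>F\<in>Pow (Pow U). real n powr - real (card U) * real n powr - \<delta>)
        \<le> 2 ^ (2 ^ K) * real n powr - \<delta> * real n powr - real (card U)"
      by (simp only: sum_constant) (simp add: mult.commute mult.left_commute)
  qed
  also have "\<dots> = 2 ^ (2 ^ K) * real n powr - \<delta> * (\<Sum>U\<in>?B. real n powr - real (card U))"
    by (rule sum_distrib_left[symmetric])
  also have "\<dots> \<le> 2 ^ (2 ^ K) * real n powr - \<delta> * (real K + 1)"
    by (intro mult_left_mono sum_small_subsets_le n) simp
  finally show ?thesis by (simp add: mult.commute mult.left_commute)
qed

text \<open>Bounded \<open>s\<close> and \<open>t\<close> give finitely many positive differences,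
  and the least of them serves; the extra element 1 keeps the set nonempty.\<close>

lemma gap_exists:
  fixes a :: real
  obtains \<delta> where "0 < \<delta>"
    "\<And>s t :: nat. s \<le> K \<Longrightarrow> t \<le> L \<Longrightarrow> real s < a * real t \<Longrightarrow> real s + \<delta> \<le> a * real t"
proof -
  define D where "D = insert 1 ((\<lambda>(s, t). a * real t - real s) ` {(s, t). s \<le> K \<and> t \<le> L \<and> real s < a * real t})"
  have "finite {(s, t). s \<le> K \<and> t \<le> L \<and> real s < a * real t}"
    by (rule finite_subset[of _ "{..K} \<times> {..L}"]) auto
  then have fin: "finite D" unfolding D_def by simp
  have ne: "D \<noteq> {}" unfolding D_def by simp
  show ?thesis
  proof (rule that[of "Min D"])
    show "0 < Min D" unfolding Min_gr_iff[OF fin ne] unfolding D_def by auto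
    fix s t :: nat assume "s \<le> K" "t \<le> L" "real s < a * real t"
    then have "a * real t - real s \<in> D" unfolding D_def by (intro insertI2 image_eqI[of _ _ "(s, t)"]) auto
    then have "Min D \<le> a * real t - real s" using fin by (rule Min_le[rotated])
    then show "real s + Min D \<le> a * real t" by simp
  qed
qed

text \<open>With \<open>e\<close> edges in \<open>U\<close>, the bound
  \<open>(2/5 + \<epsilon>) * e \<le> card U\<close> turns into
  \<open>5 * \<epsilon> * e \<le> surplus F U\<close>. So surplus at most 8 leaves at most
  \<open>8 / (5 * \<epsilon>)\<close> edges, and the definition of the surplus then bounds the
  number of vertices; the condition on \<open>k\<close> is this bound.\<close>

lemma locally_sparse_imp_sparse:
  assumes R: "R \<subseteq> all_edges n" "locally_sparse n (2/5 + \<epsilon>) (2 * k + 4) R" and F: "F \<subseteq> R"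
    and \<epsilon>: "0 < \<epsilon>" and k: "(8 + 16 / (5 * \<epsilon>)) / 5 \<le> real k"
  shows "sparse k F"
  unfolding sparse_def
proof (intro allI impI)
  fix U :: "nat set" assume U: "finite U" "U \<noteq> {}" "card U \<le> 2 * k + 4"
  \<comment> \<open>Points of \<open>U\<close> outside the vertex set carry no edges and only raise
    the surplus.\<close>
  let ?U = "U \<inter> {..<n}"
  define e where "e = card (inner F U)"
  have fR: "finite R" using R(1) finite_all_edges finite_subset by blast
  have "inner F U \<subseteq> inner R ?U" using F all_edgesD(2) R(1) unfolding inner_def by blast
  moreover have "finite (inner R ?U)" using fR unfolding inner_def by simp
  ultimately have "e \<le> card (inner R ?U)" unfolding e_def by (rule card_mono[rotated])
  then have "(2/5 + \<epsilon>) * real e \<le> (2/5 + \<epsilon>) * real (card (inner R ?U))"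
    using \<epsilon> by (intro mult_left_mono) auto
  moreover have cU: "card ?U \<le> card U" using U(1) by (intro card_mono) auto
  then have "(2/5 + \<epsilon>) * real (card (inner R ?U)) \<le> real (card ?U)"
    using R(2) U(3) unfolding locally_sparse_def by force
  ultimately have d: "(2/5 + \<epsilon>) * real e \<le> real (card U)" using cU by linarith
  have s: "real_of_int (surplus F U) = 5 * real (card U) - 2 * real e" unfolding surplus_def e_def by simp
  have lower: "5 * \<epsilon> * real e \<le> real_of_int (surplus F U)" using d unfolding s by (simp add: algebra_simps)
  have "0 < card U" using U by (simp add: card_gt_0_iff)
  have "0 < real_of_int (surplus F U)"
  proof (cases "e = 0")
    case True then show ?thesis using s \<open>0 < card U\<close> by simp
  next
    case False
    then have "0 < 5 * \<epsilon> * real e" using \<epsilon> by simp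
    then show ?thesis using lower by linarith
  qed
  then have "1 \<le> surplus F U" by linarith
  moreover have "card U \<le> k" if "surplus F U \<le> 8"
  proof -
    have "real_of_int (surplus F U) \<le> 8" using that by simp
    then have "5 * \<epsilon> * real e \<le> 8" using lower by linarith
    then have "real e \<le> 8 / (5 * \<epsilon>)" using \<epsilon> by (simp add: field_simps)
    moreover have "5 * real (card U) \<le> 8 + 2 * real e" using s \<open>real_of_int (surplus F U) \<le> 8\<close> by linarith
    ultimately have "real (card U) \<le> (8 + 16 / (5 * \<epsilon>)) / 5" by (simp add: field_simps)
    then show ?thesis using k by linarith
  qed
  ultimately show "1 \<le> surplus F U \<and> (surplus F U \<le> 8 \<longrightarrow> card U \<le> k)" by blast
qed

section \<open>The bipartite graph and the conclusion\<close>

definition balanced_bipartite :: "nat \<Rightarrow> nat set set" where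
  "balanced_bipartite n = (\<lambda>(u, v). {u, v}) ` ({..<n div 2} \<times> {n div 2..<n})"

lemma balanced_bipartite_subset: "balanced_bipartite n \<subseteq> all_edges n"
proof
  fix e assume "e \<in> balanced_bipartite n"
  then obtain u v where "e = {u, v}" "u < n div 2" "n div 2 \<le> v" "v < n"
    unfolding balanced_bipartite_def by auto
  then show "e \<in> all_edges n" unfolding all_edges_def by (intro CollectI exI[of _ u] exI[of _ v]) auto
qed

lemma balanced_bipartite_dense:
  assumes "d \<le> 1 / 2"
  shows "balanced_bipartite n \<in> dense_graphs d n"
proof -
  have "inj_on (\<lambda>(u, v). {u, v}) ({..<n div 2} \<times> {n div 2..<n})"
    by (auto simp: inj_on_def doubleton_eq_iff)
  then have card: "card (balanced_bipartite n) = (n div 2) * (n - n div 2)"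
    unfolding balanced_bipartite_def by (simp add: card_image)
  have "d * real (n choose 2) \<le> 1 / 2 * real (n choose 2)" by (rule mult_right_mono[OF assms]) simp
  also have "\<dots> \<le> real ((n div 2) * (n - n div 2))"
  proof -
    have "n choose 2 = n * (n - 1) div 2" by (rule choose_two)
    then have "n choose 2 \<le> 2 * ((n div 2) * (n - n div 2))"
    proof (cases "even n")
      case True
      then obtain m where "n = 2 * m" by blast
      then show ?thesis by (cases m) (auto simp: choose_two algebra_simps)
    next
      case False
      then obtain m where "n = 2 * m + 1" by (rule oddE)
      then show ?thesis by (auto simp: choose_two algebra_simps)
    qed
    then have "real (n choose 2) \<le> real (2 * ((n div 2) * (n - n div 2)))" by (simp only: of_nat_le_iff)
    then show ?thesis by simp
  qed
  finally show ?thesis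
    unfolding dense_graphs_def card[symmetric] using balanced_bipartite_subset by simp
qed

text \<open>Every edge of the bipartite graph crosses between the parts, so the edges inside the
  parts form a subgraph of \<open>R\<close>.\<close>

lemma sparse_imp_not_rbw:
  assumes R: "R \<subseteq> all_edges n" and sp: "\<And>F. F \<subseteq> R \<Longrightarrow> sparse k F"
  shows "\<not> rbw_arrows_clique (balanced_bipartite n \<union> R) 8"
proof -
  let ?H = "balanced_bipartite n \<union> R"
  let ?A = "{..<n div 2}"
  have H: "?H \<subseteq> all_edges n" using R balanced_bipartite_subset by blast
  have finH: "finite ?H" using H finite_all_edges finite_subset by blast
  have two: "card e = 2" if "e \<in> ?H" for e using H all_edgesD(1) that by blast
  have "{e \<in> ?H. e \<subseteq> ?A \<or> e \<inter> ?A = {}} \<subseteq> R" unfolding balanced_bipartite_def by auto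
  then obtain c :: "nat set \<Rightarrow> nat" where c: "colouring ?H c"
    "\<And>W. card W = 8 \<Longrightarrow> clique ?H W \<Longrightarrow> \<not> inj_on c (inner ?H W)"
    using rainbow_clique_free_colouring[OF finH two sp] by blast
  have "proper_edge_colouring ?H c"
    using c(1) unfolding colouring_def proper_edge_colouring_def by blast
  moreover have "\<not> has_rainbow_clique ?H c 8"
  proof
    assume "has_rainbow_clique ?H c 8"
    then obtain f :: "nat \<Rightarrow> nat" where f: "inj_on f {..<8}"
      "\<And>i j. i < 8 \<Longrightarrow> j < 8 \<Longrightarrow> i \<noteq> j \<Longrightarrow> {f i, f j} \<in> ?H"
      "inj_on c {{f i, f j} | i j. i < 8 \<and> j < 8 \<and> i \<noteq> j}"
      unfolding has_rainbow_clique_def by blast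
    let ?W = "f ` {..<8}"
    have "card ?W = 8" using f(1) by (simp add: card_image)
    moreover have "clique ?H ?W" unfolding clique_def using f(2) by blast
    moreover have "inner ?H ?W \<subseteq> {{f i, f j} | i j. i < 8 \<and> j < 8 \<and> i \<noteq> j}"
    proof
      fix e assume e: "e \<in> inner ?H ?W"
      then have "card e = 2" using two unfolding inner_def by blast
      then obtain u v where uv: "e = {u, v}" "u \<noteq> v" by (meson card_2_iff)
      then obtain i j where "u = f i" "v = f j" "i < 8" "j < 8" using e unfolding inner_def by auto
      then show "e \<in> {{f i, f j} | i j. i < 8 \<and> j < 8 \<and> i \<noteq> j}" using uv by blast
    qed
    ultimately show False using c(2) inj_on_subset[OF f(3)] by blast
  qed
  ultimately show ?thesis unfolding rbw_arrows_clique_def by blast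
qed

theorem theorem1p4:
  fixes d \<epsilon> :: real
  assumes "0 < d" and "d \<le> 1/2" and "\<epsilon> > 0"
  shows "\<exists>G :: nat \<Rightarrow> nat set set.
           (\<forall>n. G n \<in> dense_graphs d n) \<and>
           (\<lambda>n. gnp_prob n (real n powr (-(2/5 + \<epsilon>)))
                   (\<lambda>R. \<not> rbw_arrows_clique (G n \<union> R) 8)) \<longlonglongrightarrow> 1"
proof (intro exI conjI allI)
  show "balanced_bipartite n \<in> dense_graphs d n" for n by (rule balanced_bipartite_dense[OF assms(2)])
  obtain k where k: "(8 + 16 / (5 * \<epsilon>)) / 5 \<le> real k" using real_arch_simple by blast
  \<comment> \<open>\<open>k\<close> bounds the size of the components, and \<open>K\<close> is the
    size up to which \<open>sparse k\<close> inspects vertex sets.\<close>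
  define a K where "a = 2/5 + \<epsilon>" and "K = 2 * k + 4"
  have a: "0 < a" unfolding a_def using assms(3) by simp
  obtain \<delta> where \<delta>: "0 < \<delta>"
    "\<And>s t :: nat. s \<le> K \<Longrightarrow> t \<le> 2 ^ K \<Longrightarrow> real s < a * real t \<Longrightarrow> real s + \<delta> \<le> a * real t"
    by (rule gap_exists[of K "2 ^ K" a], rule that)
  let ?prob = "\<lambda>n. gnp_prob n (real n powr - a) (\<lambda>R. \<not> rbw_arrows_clique (balanced_bipartite n \<union> R) 8)"
  have p: "0 \<le> real n powr - a" "real n powr - a \<le> 1" if "1 \<le> n" for n
    using that a powr_mono[of "- a" 0 "real n"] by auto
  have lower: "1 - (real K + 1) * 2 ^ (2 ^ K) * real n powr - \<delta> \<le> ?prob n" if n: "1 \<le> n" for n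
  proof -
    have "1 - (real K + 1) * 2 ^ (2 ^ K) * real n powr - \<delta> \<le> 1 - gnp_prob n (real n powr - a) (\<lambda>R. \<not> locally_sparse n a K R)"
      by (intro diff_left_mono gnp_prob_not_locally_sparse_le[OF n a] \<delta>(2))
    also have "\<dots> = gnp_prob n (real n powr - a) (locally_sparse n a K)"
      unfolding gnp_prob_not by simp
    also have "\<dots> \<le> ?prob n"
    proof (rule gnp_prob_mono[OF p[OF n]])
      fix R assume R: "R \<subseteq> all_edges n" "locally_sparse n a K R"
      show "\<not> rbw_arrows_clique (balanced_bipartite n \<union> R) 8"
        by (rule sparse_imp_not_rbw[OF R(1)], rule locally_sparse_imp_sparse[OF R(1) R(2)[unfolded a_def K_def] _ assms(3) k])
    qed
    finally show ?thesis .
  qed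
  have upper: "?prob n \<le> 1" if "1 \<le> n" for n
    using gnp_prob_mono[OF p[OF that], of n "\<lambda>R. \<not> rbw_arrows_clique (balanced_bipartite n \<union> R) 8" "\<lambda>R. True"]
    unfolding gnp_prob_True by simp
  have "(\<lambda>n. real n powr - \<delta>) \<longlonglongrightarrow> 0"
    using \<delta>(1) by (intro tendsto_neg_powr filterlim_real_sequentially) simp
  then have "(\<lambda>n. 1 - (real K + 1) * 2 ^ (2 ^ K) * real n powr - \<delta>) \<longlonglongrightarrow> 1 - (real K + 1) * 2 ^ (2 ^ K) * 0"
    by (intro tendsto_intros)
  then have "(\<lambda>n. 1 - (real K + 1) * 2 ^ (2 ^ K) * real n powr - \<delta>) \<longlonglongrightarrow> 1" by simp
  then have "?prob \<longlonglongrightarrow> 1"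
    by (rule tendsto_sandwich[rotated 2, OF _ tendsto_const])
      (use lower upper in \<open>auto intro: eventually_sequentiallyI[of 1]\<close>)
  then show "(\<lambda>n. gnp_prob n (real n powr (-(2/5 + \<epsilon>)))
      (\<lambda>R. \<not> rbw_arrows_clique (balanced_bipartite n \<union> R) 8)) \<longlonglongrightarrow> 1"
    unfolding a_def .
qed

end
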